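(* Let $\mathbb{F}$ be an arbitrary field, let $E$ be the natural $2$-dimensional representation of $\mathrm{SL}_2(\mathbb{F})$, let $k\ge1$, and let $N_k>\cdots>N_2>N_1>N_0=0$ be integers in generic position. Then successive application of the isomorphisms $$\textstyle\bigwedge^{M}\mathrm{Sym}^{N+M-1}E\otimes\bigwedge^{M+N}\mathrm{Sym}^{e}E\cong\bigwedge^{N}\mathrm{Sym}^{e-M}E\otimes\bigwedge^{M}\mathrm{Sym}^{e}E$$ to $\bigotimes_{i=1}^{k-1}\bigwedge^{N_i}\mathrm{Sym}^{N_{i+1}-1}E$ yields $C_{k-1}$ isomorphic constructions of this $\mathrm{SL}_2(\mathbb{F})$-representation. That is, there are exactly $C_{k-1}$ election processes on the team hierarchy $N_k>\cdots>N_1$, and for each election process $\prod_{r=1}^{k-1}\binom{a_r}{b_r}$ there is an isomorphism of $\mathrm{SL}_2(\mathbb{F})$-representations $$\bigotimes_{r=1}^{k-1}\textstyle\bigwedge^{b_r}\mathrm{Sym}^{a_r-1}E\;\cong\;\bigotimes_{i=1}^{k-1}\bigwedge^{N_i}\mathrm{Sym}^{N_{i+1}-1}E.$$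
   Context: $C_n=\frac{1}{n+1}\binom{2n}{n}$ is the $n$-th Catalan number. $\mathrm{Sym}^d E$ is the space of homogeneous polynomials of degree $d$ in $X,Y$ over $\mathbb{F}$ (where $X,Y$ is a basis of $E$), with action $\begin{pmatrix}\alpha&\beta\\ \gamma&\delta\end{pmatrix}\cdot P(X,Y) = P(\alpha X+\gamma Y,\beta X+\delta Y)$; $\bigwedge^R V$ is the $R$-th exterior power. Generic position: $N_j-N_i\neq N_m-N_p$ for all distinct pairs $(j,i)\ne(m,p)$ with $j>i\ge 0$ and $m>p\ge 0$. Election processes: consider the formal product of binomial coefficients $$\binom{N_k}{N_{k-1}}\cdots\binom{N_3}{N_2}\binom{N_2}{N_1}$$ (the empty product if $k=1$). An election process is any formal product of binomial coefficient symbols, considered up to permutation of the factors, obtained from this product by successive application (zero or more times) of the trinomial revision identity $\binom{a}{b}\binom{b}{c}=\binom{a}{c}\binom{a-c}{b-c}$, that is, by successively replacing pairs of factors according to $$\binom{N_j-N_{i-1}}{N_m-N_{i-1}}\binom{N_m-N_{i-1}}{N_{p-1}-N_{i-1}} \;\longmapsto\; \binom{N_j-N_{i-1}}{N_{p-1}-N_{i-1}}\binom{N_j-N_{p-1}}{N_m-N_{p-1}}$$ where $j>m\ge p>i\ge 1$. The isomorphism of exterior powers displayed in the claim (for $M,N\in\mathbb{N}_0$ and $e\ge M+N-1$) is the counterpart of this replacement under the dictionary $\binom{a}{b}\leftrightarrow\bigwedge^{b}\mathrm{Sym}^{a-1}E$. *)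

theory Defs
  imports
    "HOL-Analysis.Determinants"
    "HOL-Library.Poly_Mapping"
    "HOL-Library.Product_Plus"
    "HOL-Library.Set_Algebras"
    "HOL-Library.Multiset"
begin

section \<open>Catalan numbers\<close>

definition catalan :: "nat \<Rightarrow> nat" where
  "catalan n = (2 * n choose n) div (n + 1)"

text \<open>The division is exact.\<close>

lemma Suc_times_catalan: "(n + 1) * catalan n = (2 * n choose n)"
proof -
  have "Suc n * (2 * n choose Suc n) = n * (2 * n choose n)"
    using binomial_absorption[of n "2 * n"] binomial_absorb_comp[of "2 * n" n] by auto
  then have "(n + 1) * ((2 * n choose n) - (2 * n choose Suc n)) = (2 * n choose n)"
    by (simp add: diff_mult_distrib2)
  then have "(n + 1) dvd (2 * n choose n)"
    by (metis dvd_triv_left)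
  then show ?thesis
    unfolding catalan_def by (rule dvd_mult_div_cancel)
qed


section \<open>Formal linear combinations\<close>

definition fscale :: "'f \<Rightarrow> ('x \<Rightarrow>\<^sub>0 'f) \<Rightarrow> ('x \<Rightarrow>\<^sub>0 'f::field)" where
  "fscale c p = Poly_Mapping.map ((*) c) p"

lemma lookup_fscale: "Poly_Mapping.lookup (fscale c p) x = c * Poly_Mapping.lookup p x"
  unfolding fscale_def by (transfer, simp add: when_def)

global_interpretation formal: vector_space "fscale :: 'f::field \<Rightarrow> ('x \<Rightarrow>\<^sub>0 'f) \<Rightarrow> _"
  by unfold_locales
    (auto intro!: poly_mapping_eqI simp: lookup_fscale lookup_add algebra_simps)

text \<open>The linear extension of a map between the bases.\<close>

definition linear_ext :: "('x \<Rightarrow> 'y) \<Rightarrow> ('x \<Rightarrow>\<^sub>0 'f) \<Rightarrow> ('y \<Rightarrow>\<^sub>0 'f::field)" where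
  "linear_ext h p = (\<Sum>x\<in>Poly_Mapping.keys p. Poly_Mapping.single (h x) (Poly_Mapping.lookup p x))"


section \<open>Representations of the special linear group\<close>

definition SL2 :: "('f::field ^ 2 ^ 2) set" where
  "SL2 = {g. det g = 1}"

text \<open>
  A representation has an explicit carrier, because the quotients below depend on
  parameters. The operations are meaningful on the carrier only, and the action
  for elements of \<^const>\<open>SL2\<close> only.
\<close>

record ('f, 'v) sl2_rep =
  rep_space :: "'v set"
  rep_add :: "'v \<Rightarrow> 'v \<Rightarrow> 'v"
  rep_scale :: "'f \<Rightarrow> 'v \<Rightarrow> 'v"
  rep_act :: "'f ^ 2 ^ 2 \<Rightarrow> 'v \<Rightarrow> 'v"

definition rep_isomorphic :: "('f::field, 'v) sl2_rep \<Rightarrow> ('f, 'w) sl2_rep \<Rightarrow> bool" where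
  "rep_isomorphic V W \<longleftrightarrow>
    (\<exists>\<phi>. bij_betw \<phi> (rep_space V) (rep_space W) \<and>
      (\<forall>u\<in>rep_space V. \<forall>v\<in>rep_space V. \<phi> (rep_add V u v) = rep_add W (\<phi> u) (\<phi> v)) \<and>
      (\<forall>c. \<forall>v\<in>rep_space V. \<phi> (rep_scale V c v) = rep_scale W c (\<phi> v)) \<and>
      (\<forall>g\<in>SL2. \<forall>v\<in>rep_space V. \<phi> (rep_act V g v) = rep_act W g (\<phi> v)))"


section \<open>Symmetric powers of the natural representation\<close>

text \<open>
  The polynomial ring in \<open>X\<close> and \<open>Y\<close> is the monoid algebra of the additive monoid of
  exponent pairs: \<open>Poly_Mapping.single (i, j) c\<close> is the monomial \<open>c X^i Y^j\<close>.
\<close>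

type_synonym 'f bipoly = "(nat \<times> nat) \<Rightarrow>\<^sub>0 'f"

definition subst_XY :: "'f bipoly \<Rightarrow> 'f bipoly \<Rightarrow> 'f bipoly \<Rightarrow> 'f::field bipoly" where
  "subst_XY S T P = (\<Sum>(i, j)\<in>Poly_Mapping.keys P. fscale (Poly_Mapping.lookup P (i, j)) (S ^ i * T ^ j))"

definition sl2_subst :: "'f ^ 2 ^ 2 \<Rightarrow> 'f bipoly \<Rightarrow> 'f::field bipoly" where
  "sl2_subst g P =
    (let X = Poly_Mapping.single (1, 0) 1; Y = Poly_Mapping.single (0, 1) 1
     in subst_XY (fscale (g $ 1 $ 1) X + fscale (g $ 2 $ 1) Y)
                 (fscale (g $ 1 $ 2) X + fscale (g $ 2 $ 2) Y) P)"

definition Sym_E :: "nat \<Rightarrow> ('f::field, 'f bipoly) sl2_rep" where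
  "Sym_E d =
    \<lparr> rep_space = {P. \<forall>(i, j)\<in>Poly_Mapping.keys P. i + j = d},
      rep_add = (+),
      rep_scale = fscale,
      rep_act = sl2_subst \<rparr>"


section \<open>Tensor products and exterior powers\<close>

text \<open>
  Both are presented by generators and relations: the vector space of formal linear
  combinations of tuples of vectors, modulo the span of the relations. Tuples are lists.
\<close>

definition tuples :: "('f::field, 'v) sl2_rep list \<Rightarrow> 'v list set" where
  "tuples Vs = listset (map rep_space Vs)"

definition multilinear_relations ::
    "('f::field, 'v) sl2_rep list \<Rightarrow> ('v list \<Rightarrow>\<^sub>0 'f) set" where
  "multilinear_relations Vs =
    {Poly_Mapping.single (xs[i := rep_add (Vs ! i) u v]) 1
       - Poly_Mapping.single (xs[i := u]) 1 - Poly_Mapping.single (xs[i := v]) 1 | xs i u v.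
       xs \<in> tuples Vs \<and> i < length Vs \<and> u \<in> rep_space (Vs ! i) \<and> v \<in> rep_space (Vs ! i)} \<union>
    {Poly_Mapping.single (xs[i := rep_scale (Vs ! i) c v]) 1
       - fscale c (Poly_Mapping.single (xs[i := v]) 1) | xs i c v.
       xs \<in> tuples Vs \<and> i < length Vs \<and> v \<in> rep_space (Vs ! i)}"

definition alternating_relations ::
    "('f::field, 'v) sl2_rep list \<Rightarrow> ('v list \<Rightarrow>\<^sub>0 'f) set" where
  "alternating_relations Vs =
    {Poly_Mapping.single xs 1 | xs. xs \<in> tuples Vs \<and> \<not> distinct xs}"

definition diagonal_act ::
    "('f::field, 'v) sl2_rep list \<Rightarrow> 'f ^ 2 ^ 2 \<Rightarrow> ('v list \<Rightarrow>\<^sub>0 'f) \<Rightarrow> ('v list \<Rightarrow>\<^sub>0 'f)" where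
  "diagonal_act Vs g = linear_ext (map2 (\<lambda>V v. rep_act V g v) Vs)"

text \<open>
  Elements of the quotient are cosets of the span \<open>U\<close> of the relations. Scalars and group
  elements act through representatives; the union identifies the cosets obtained from
  different representatives.
\<close>

definition tuple_quotient ::
    "('f::field, 'v) sl2_rep list \<Rightarrow> ('v list \<Rightarrow>\<^sub>0 'f) set \<Rightarrow> ('f, ('v list \<Rightarrow>\<^sub>0 'f) set) sl2_rep"
  where
  "tuple_quotient Vs relations =
    (let U = formal.span relations in
     \<lparr> rep_space = {p +o U | p. Poly_Mapping.keys p \<subseteq> tuples Vs},
       rep_add = (\<lambda>A B. A + B),
       rep_scale = (\<lambda>c A. \<Union>p\<in>A. fscale c p +o U),
       rep_act = (\<lambda>g A. \<Union>p\<in>A. diagonal_act Vs g p +o U) \<rparr>)"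

definition tensor_product ::
    "('f::field, 'v) sl2_rep list \<Rightarrow> ('f, ('v list \<Rightarrow>\<^sub>0 'f) set) sl2_rep" where
  "tensor_product Vs = tuple_quotient Vs (multilinear_relations Vs)"

definition exterior_power ::
    "nat \<Rightarrow> ('f::field, 'v) sl2_rep \<Rightarrow> ('f, ('v list \<Rightarrow>\<^sub>0 'f) set) sl2_rep" where
  "exterior_power R V =
    (let Vs = replicate R V
     in tuple_quotient Vs (multilinear_relations Vs \<union> alternating_relations Vs))"


section \<open>Election processes\<close>

text \<open>
  Differences of the \<open>N i\<close> are only ever taken in the order of increasing indices, so for
  increasing \<open>N\<close> the subtraction of natural numbers does not truncate.
\<close>

definition generic_position :: "nat \<Rightarrow> (nat \<Rightarrow> nat) \<Rightarrow> bool" where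
  "generic_position k N \<longleftrightarrow>
    (\<forall>j i m p. i < j \<and> j \<le> k \<and> p < m \<and> m \<le> k \<and> (j, i) \<noteq> (m, p) \<longrightarrow>
      N j - N i \<noteq> N m - N p)"

text \<open>
  The pair \<open>(a, b)\<close> is the symbol of the binomial coefficient \<open>a choose b\<close>, and a formal product
  up to permutation of the factors is a multiset of such pairs.
\<close>

inductive_set election_processes :: "nat \<Rightarrow> (nat \<Rightarrow> nat) \<Rightarrow> (nat \<times> nat) multiset set"
  for k :: nat and N :: "nat \<Rightarrow> nat" where
  initial: "mset (map (\<lambda>i. (N (i + 1), N i)) [1..<k]) \<in> election_processes k N"
| revision:
    "{# (N j - N (i - 1), N m - N (i - 1)), (N m - N (i - 1), N (p - 1) - N (i - 1)) #} + Q
       \<in> election_processes k N \<Longrightarrow>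
     k \<ge> j \<Longrightarrow> j > m \<Longrightarrow> m \<ge> p \<Longrightarrow> p > i \<Longrightarrow> i \<ge> 1 \<Longrightarrow>
     {# (N j - N (i - 1), N (p - 1) - N (i - 1)), (N j - N (p - 1), N m - N (p - 1)) #} + Q
       \<in> election_processes k N"

end

theory Submission
  imports Defs "HOL-Library.Function_Algebras" "HOL-Computational_Algebra.Polynomial_Factorial"
    "Jordan_Normal_Form.Determinant"
begin

text \<open>
  Since differences of the \<open>N i\<close> determine their indices, an election process is a binary tree on the
  leaves \<open>0, \<dots>, k - 1\<close>: a factor \<open>(N j - N i, N m - N i)\<close> is an internal node that splits the interval
  from \<open>i\<close> to \<open>j\<close> at \<open>m\<close>, the revision identity is a rotation, and the initial product is the left comb.

  The exterior power \<open>\<Lambda>\<^sup>b Sym\<^sup>a\<^sup>-\<^sup>1 E\<close> is realized by alternating functions \<open>det (P\<^sub>s (z\<^sub>t))\<close> of \<open>b\<close> points of the plane.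
  Division by the Vandermonde determinant, which is invariant, yields exactly the span of the \<open>(a - b)\<close>-fold products
  of elementary symmetric functions. Let the node \<open>(i, m, j)\<close> use the points with indices from \<open>N i\<close> to
  \<open>N m - 1\<close> and send a tensor to the product of the functions of its factors. By the coproduct of the
  elementary symmetric functions, a rotation can only enlarge the span of these products. For the left
  comb the products are linearly independent, and the trinomial revision identity shows that the number of basis
  tensors is the same for all trees. So all trees are realized faithfully on one and the same function space.
\<close>

section \<open>The Catalan recurrence\<close>

text \<open>No single replacement is shown to be an isomorphism: expanding an elementary symmetric
  function over two blocks of points gives only one inclusion of spans, and the converse is not
  argued directly. Counting supplies it: a spanning family that is no larger than an independent set
  inside its span is a basis. This gives at once the independence of the generators of a tensor
  product, hence a faithful realization, and the equality of the spaces. So independence has to be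
  proved for one tree only. The comb is suited to this because its nodes use nested initial segments
  of the points, which allows an induction that removes one factor at a time. In the linear algebra
  nothing divides by an integer: the terms in the Pieri rule have coefficient 1, so the argument
  holds in every characteristic. Determinant one enters because division by the Vandermonde
  determinant must commute with the action.\<close>

lemma catalan_0 [simp]: "catalan 0 = 1"
  by (simp add: catalan_def)

text \<open>Passing from the central binomial coefficient of \<open>2 * n\<close> to that of
  \<open>2 * n + 2\<close> takes two absorptions and one symmetry; the common factor
  \<open>Suc n\<close> is cancelled at the end. This quotient of consecutive values is all that the
  recurrence needs.\<close>

lemma catalan_Suc_mult: "(n + 2) * catalan (Suc n) = (4 * n + 2) * catalan n"
proof -
  have s: "(2 * n + 1 choose n) = (2 * n + 1 choose Suc n)"
    using binomial_symmetric[of n "2 * n + 1"] by simp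
  have "Suc n * (2 * n + 2 choose Suc n) = (2 * n + 2) * (2 * n + 1 choose n)"
    using Suc_times_binomial_eq[of "2 * n + 1" n] by (simp add: mult.commute)
  then have "Suc n * (2 * n + 2 choose Suc n) = 2 * (Suc n * (2 * n + 1 choose Suc n))"
    unfolding s by simp
  also have "Suc n * (2 * n + 1 choose Suc n) = (2 * n + 1) * (2 * n choose n)"
    using Suc_times_binomial_eq[of "2 * n" n] by (simp add: mult.commute)
  finally have "Suc n * (2 * Suc n choose Suc n) = (4 * n + 2) * (2 * n choose n)"
    by simp
  then have "Suc n * ((n + 2) * catalan (Suc n)) = Suc n * ((4 * n + 2) * catalan n)"
    unfolding Suc_times_catalan[symmetric] by (simp only: Suc_eq_plus1 one_add_one[symmetric] ac_simps)
  then show ?thesis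
    by (simp only: mult_cancel1) simp
qed

text \<open>Let \<open>S\<close> be the convolution and \<open>T\<close> the same sum weighted by
  the index. Reversing the sum gives \<open>2 * T n = n * S n\<close>. The sum with weights
  \<open>i + 1\<close> is then computed twice: as \<open>T + S\<close>, and by
  \<open>catalan_Suc_mult\<close> applied to the first factors, which lowers it to
  \<open>4 * T m + 2 * S m\<close>, known by induction. Comparison shows that
  \<open>S (Suc m)\<close> has the ratio to \<open>catalan (Suc m)\<close> that characterizes the
  next Catalan number.\<close>

theorem catalan_recurrence: "catalan (Suc n) = (\<Sum>i\<le>n. catalan i * catalan (n - i))"
proof (induction n)
  case 0
  then show ?case using catalan_Suc_mult[of 0] by simp
next
  case (Suc m)
  define S where "S n = (\<Sum>i\<le>n. catalan i * catalan (n - i))" for n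
  define T where "T n = (\<Sum>i\<le>n. i * (catalan i * catalan (n - i)))" for n
  have T: "2 * T n = n * S n" for n
  proof -
    have "T n = (\<Sum>i\<le>n. (n - i) * (catalan i * catalan (n - i)))"
      unfolding T_def
      by (rule sum.reindex_bij_witness[of _ "\<lambda>i. n - i" "\<lambda>i. n - i"]) (auto simp: mult.commute)
    then have "2 * T n = (\<Sum>i\<le>n. i * (catalan i * catalan (n - i)) + (n - i) * (catalan i * catalan (n - i)))"
      by (simp only: sum.distrib) (simp add: T_def)
    also have "\<dots> = (\<Sum>i\<le>n. n * (catalan i * catalan (n - i)))"
      by (intro sum.cong refl) (simp flip: add_mult_distrib)
    finally show ?thesis
      by (simp add: S_def sum_distrib_left)
  qed
  have "(\<Sum>i\<le>Suc m. (i + 1) * (catalan i * catalan (Suc m - i)))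
      = catalan (Suc m) + (\<Sum>i\<le>m. (i + 2) * catalan (Suc i) * catalan (m - i))"
    by (subst sum.atMost_Suc_shift) (simp add: algebra_simps)
  also have "\<dots> = catalan (Suc m) + (\<Sum>i\<le>m. 4 * (i * (catalan i * catalan (m - i))) + 2 * (catalan i * catalan (m - i)))"
    unfolding catalan_Suc_mult by (simp add: algebra_simps)
  also have "\<dots> = catalan (Suc m) + (4 * T m + 2 * S m)"
    by (simp add: S_def T_def sum.distrib sum_distrib_left)
  also have "\<dots> = (2 * Suc m + 1) * catalan (Suc m)"
    using T[of m] Suc.IH by (simp add: S_def)
  finally have "2 * (T (Suc m) + S (Suc m)) = (4 * Suc m + 2) * catalan (Suc m)"
    by (simp add: S_def T_def sum.distrib algebra_simps)
  then have "(Suc m + 2) * S (Suc m) = (4 * Suc m + 2) * catalan (Suc m)"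
    using T[of "Suc m"] by (simp add: algebra_simps)
  then have "(Suc m + 2) * catalan (Suc (Suc m)) = (Suc m + 2) * S (Suc m)"
    unfolding catalan_Suc_mult by simp
  then show ?case
    unfolding S_def by (simp only: mult_cancel1) simp
qed

section \<open>Binary trees as multisets of split intervals\<close>

text \<open>
  The triple \<open>(i, m, j)\<close> stands for an internal node that splits the interval from \<open>i\<close> to \<open>j\<close>
  at \<open>m\<close>; \<open>trees n i\<close> consists of the binary trees with \<open>n\<close> internal nodes on the interval
  from \<open>i\<close> to \<open>i + n + 1\<close>.
\<close>

function trees :: "nat \<Rightarrow> nat \<Rightarrow> (nat \<times> nat \<times> nat) multiset set" where
  "trees 0 i = {{#}}"
| "trees (Suc n) i =
    (\<Union>q\<in>{..n}. \<Union>l\<in>trees q i. \<Union>r\<in>trees (n - q) (i + q + 1).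
      {add_mset (i, i + q + 1, i + n + 2) (l + r)})"
  by pat_completeness auto
termination by (relation "measure fst") auto

declare trees.simps(2) [simp del]

lemma trees_SucI:
  "q \<le> n \<Longrightarrow> l \<in> trees q i \<Longrightarrow> r \<in> trees (n - q) (i + q + 1) \<Longrightarrow>
    add_mset (i, i + q + 1, i + n + 2) (l + r) \<in> trees (Suc n) i"
  unfolding trees.simps by blast

lemma trees_SucE:
  assumes "t \<in> trees (Suc n) i"
  obtains q l r where "q \<le> n" "l \<in> trees q i" "r \<in> trees (n - q) (i + q + 1)"
    "t = add_mset (i, i + q + 1, i + n + 2) (l + r)"
  using assms unfolding trees.simps by blast

lemma trees_range:
  "t \<in> trees n i \<Longrightarrow> (a, b, c) \<in># t \<Longrightarrow> i \<le> a \<and> a < b \<and> b < c \<and> c \<le> i + n + 1"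
proof (induction n arbitrary: t i rule: less_induct)
  case (less n)
  show ?case
  proof (cases n)
    case 0
    then show ?thesis using less.prems by simp
  next
    case (Suc m)
    from less.prems(1)[unfolded Suc] obtain q l r
      where q: "q \<le> m" and l: "l \<in> trees q i" and r: "r \<in> trees (m - q) (i + q + 1)"
        and t: "t = add_mset (i, i + q + 1, i + m + 2) (l + r)"
      by (rule trees_SucE)
    consider "(a, b, c) = (i, i + q + 1, i + m + 2)" | "(a, b, c) \<in># l" | "(a, b, c) \<in># r"
      using less.prems(2) t by auto
    then show ?thesis
    proof cases
      case 1
      then show ?thesis using q Suc by simp
    next
      case 2
      then show ?thesis using less.IH[of q l i] l q Suc by auto
    next
      case 3
      then show ?thesis using less.IH[of "m - q" r "i + q + 1"] r q Suc by fastforce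
    qed
  qed
qed

text \<open>A multiset of nodes does not record which node is the root or to which subtree a node
  belongs. The interval bounds recover both: only the root spans the whole interval, and every other
  node lies on one side of the split.\<close>

lemma filter_tree_node:
  assumes "q \<le> n" "l \<in> trees q i" "r \<in> trees (n - q) (i + q + 1)"
    and t: "t = add_mset (i, i + q + 1, i + n + 2) (l + r)"
  shows "filter_mset (\<lambda>(a, b, c). a = i \<and> c = i + n + 2) t = {#(i, i + q + 1, i + n + 2)#}"
    and "filter_mset (\<lambda>(a, b, c). c \<le> i + q + 1) t = l"
    and "filter_mset (\<lambda>(a, b, c). i + q + 1 \<le> a) t = r"
proof -
  have L: "i \<le> a \<and> a < b \<and> b < c \<and> c \<le> i + q + 1" if "(a, b, c) \<in># l" for a b c
    using trees_range[OF assms(2) that] by simp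
  have R: "i + q + 1 \<le> a \<and> a < b \<and> b < c \<and> c \<le> i + n + 2" if "(a, b, c) \<in># r" for a b c
    using trees_range[OF assms(3) that] assms(1) by simp
  have "filter_mset (\<lambda>(a, b, c). a = i \<and> c = i + n + 2) l = {#}"
    using L assms(1) by fastforce
  moreover have "filter_mset (\<lambda>(a, b, c). a = i \<and> c = i + n + 2) r = {#}"
    using R assms(1) by fastforce
  ultimately show "filter_mset (\<lambda>(a, b, c). a = i \<and> c = i + n + 2) t = {#(i, i + q + 1, i + n + 2)#}"
    by (simp add: t)
  have "filter_mset (\<lambda>(a, b, c). c \<le> i + q + 1) l = l"
    using L by (intro filter_mset_cong0[THEN trans, OF _ filter_mset_True]) auto
  moreover have "filter_mset (\<lambda>(a, b, c). c \<le> i + q + 1) r = {#}"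
    using R by fastforce
  ultimately show "filter_mset (\<lambda>(a, b, c). c \<le> i + q + 1) t = l"
    using assms(1) by (simp add: t)
  have "filter_mset (\<lambda>(a, b, c). i + q + 1 \<le> a) r = r"
    using R by (intro filter_mset_cong0[THEN trans, OF _ filter_mset_True]) auto
  moreover have "filter_mset (\<lambda>(a, b, c). i + q + 1 \<le> a) l = {#}"
    using L by fastforce
  ultimately show "filter_mset (\<lambda>(a, b, c). i + q + 1 \<le> a) t = r"
    by (simp add: t)
qed

text \<open>By \<open>filter_tree_node\<close> the split of the root and both subtrees can be read
  off, so the union over the splits is disjoint and each of its parts is in bijection with a
  product.\<close>

lemma card_trees: "finite (trees n i) \<and> card (trees n i) = catalan n"
proof (induction n arbitrary: i rule: less_induct)
  case (less n)
  show ?case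
  proof (cases n)
    case 0
    then show ?thesis by simp
  next
    case (Suc m)
    define F where "F q = (\<lambda>(l, r). add_mset (i, i + q + 1, i + m + 2) (l + r)) `
      (trees q i \<times> trees (m - q) (i + q + 1))" for q
    have F: "trees n i = (\<Union>q\<in>{..m}. F q)"
      unfolding Suc trees.simps F_def by fastforce
    have card: "finite (F q) \<and> card (F q) = catalan q * catalan (m - q)" if "q \<le> m" for q
    proof -
      have "inj_on (\<lambda>(l, r). add_mset (i, i + q + 1, i + m + 2) (l + r))
          (trees q i \<times> trees (m - q) (i + q + 1))"
      proof (rule inj_onI, clarify)
        fix l r l' r'
        assume "l \<in> trees q i" "r \<in> trees (m - q) (i + q + 1)"
          "l' \<in> trees q i" "r' \<in> trees (m - q) (i + q + 1)"
          "add_mset (i, i + q + 1, i + m + 2) (l + r) = add_mset (i, i + q + 1, i + m + 2) (l' + r')"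
        then show "l = l' \<and> r = r'"
          using filter_tree_node(2,3)[OF that] by metis
      qed
      then show ?thesis
        unfolding F_def using less.IH[of q i] less.IH[of "m - q" "i + q + 1"] that Suc
        by (simp add: card_image card_cartesian_product)
    qed
    have disj: "F q \<inter> F q' = {}" if "q \<le> m" "q' \<le> m" "q \<noteq> q'" for q q'
    proof (rule ccontr)
      assume "F q \<inter> F q' \<noteq> {}"
      then obtain l r l' r' where *: "l \<in> trees q i" "r \<in> trees (m - q) (i + q + 1)"
          "l' \<in> trees q' i" "r' \<in> trees (m - q') (i + q' + 1)"
          "add_mset (i, i + q + 1, i + m + 2) (l + r) = add_mset (i, i + q' + 1, i + m + 2) (l' + r')"
        by (auto simp: F_def)
      from filter_tree_node(1)[OF that(1) *(1,2) refl] filter_tree_node(1)[OF that(2) *(3,4) *(5)] that(3)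
      show False by simp
    qed
    have "card (trees n i) = (\<Sum>q\<in>{..m}. card (F q))"
      unfolding F by (rule card_UN_disjoint) (use card disj in auto)
    also have "\<dots> = catalan n"
      using card by (simp add: Suc catalan_recurrence)
    finally show ?thesis
      unfolding F using card by auto
  qed
qed

text \<open>The indices \<open>i\<close> and \<open>p\<close> stand for \<open>i - 1\<close> and
  \<open>p - 1\<close> in \<open>election_processes\<close>, which turns \<open>m \<ge> p\<close>
  into \<open>p < m\<close>.\<close>

inductive_set rotations :: "nat \<Rightarrow> (nat \<times> nat \<times> nat) multiset set" for k :: nat where
  initial: "mset (map (\<lambda>i. (0, i, i + 1)) [1..<k]) \<in> rotations k"
| rotate: "{#(i, m, j), (i, p, m)#} + Q \<in> rotations k \<Longrightarrow> j \<le> k \<Longrightarrow> i < p \<Longrightarrow> p < m \<Longrightarrow> m < j \<Longrightarrow>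
    {#(i, p, j), (p, m, j)#} + Q \<in> rotations k"

section \<open>Rotations and the reachability of all trees\<close>

definition left_comb :: "nat \<Rightarrow> nat \<Rightarrow> (nat \<times> nat \<times> nat) multiset" where
  "left_comb i n = mset (map (\<lambda>s. (i, i + s, i + s + 1)) [1..<n + 1])"

lemma left_comb_0 [simp]: "left_comb i 0 = {#}"
  by (simp add: left_comb_def)

lemma left_comb_Suc: "left_comb i (Suc n) = add_mset (i, i + n + 1, i + n + 2) (left_comb i n)"
  by (simp add: left_comb_def)

lemma left_comb_in_trees: "left_comb i n \<in> trees n i"
proof (induction n)
  case (Suc n)
  show ?case using trees_SucI[OF order_refl Suc.IH, of "{#}"] by (simp add: left_comb_Suc)
qed simp

text \<open>If \<open>(i, m, j)\<close> is the root, then \<open>(i, p, m)\<close> covers the whole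
  left part, so it is the root of the left subtree and the three remaining subtrees are
  reassociated. Otherwise neither node is the root; the interval of the second lies inside that of
  the first, so both belong to the same subtree and induction applies there.\<close>

lemma trees_rotate:
  assumes "{#(i, m, j), (i, p, m)#} + Q \<in> trees n i0"
  shows "{#(i, p, j), (p, m, j)#} + Q \<in> trees n i0"
  using assms
proof (induction n arbitrary: i0 Q rule: less_induct)
  case (less n)
  show ?case
  proof (cases n)
    case 0
    then show ?thesis using less.prems by simp
  next
    case (Suc n')
    define t where "t = {#(i, m, j), (i, p, m)#} + Q"
    have "t \<in> trees (Suc n') i0" using less.prems Suc t_def by simp
    then obtain q l r
      where q: "q \<le> n'" and l: "l \<in> trees q i0" and r: "r \<in> trees (n' - q) (i0 + q + 1)"
        and t: "t = add_mset (i0, i0 + q + 1, i0 + n' + 2) (l + r)"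
      by (rule trees_SucE)
    have L: "i0 \<le> a \<and> a < b \<and> b < c \<and> c \<le> i0 + q + 1" if "(a, b, c) \<in># l" for a b c
      using trees_range[OF l that] by simp
    have R: "i0 + q + 1 \<le> a \<and> a < b \<and> b < c \<and> c \<le> i0 + n' + 2" if "(a, b, c) \<in># r" for a b c
      using trees_range[OF r that] q by simp
    have jr: "i0 \<le> i \<and> i < p \<and> p < m \<and> m < j \<and> j \<le> i0 + n' + 2"
      using trees_range[OF \<open>t \<in> _\<close>, of i m j] trees_range[OF \<open>t \<in> _\<close>, of i p m] by (auto simp: t_def)
    show ?thesis
    proof (cases "(i, m, j) = (i0, i0 + q + 1, i0 + n' + 2)")
      case True
      then have lr: "add_mset (i, p, m) Q = l + r"
        using t t_def by simp
      then have "(i, p, m) \<in># l"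
      proof -
        have "(i, p, m) \<in># l + r" using lr[symmetric] by simp
        moreover have "(i, p, m) \<notin># r" using R[of i p m] True jr by auto
        ultimately show ?thesis by simp
      qed
      then have "q \<noteq> 0" using l by (cases q) auto
      then obtain q1 where q1: "q = Suc q1" by (cases q) auto
      from l[unfolded q1] obtain s l1 l2
        where s: "s \<le> q1" and l1: "l1 \<in> trees s i0" and l2: "l2 \<in> trees (q1 - s) (i0 + s + 1)"
          and l': "l = add_mset (i0, i0 + s + 1, i0 + q1 + 2) (l1 + l2)"
        by (rule trees_SucE)
      have "(i, p, m) \<in># filter_mset (\<lambda>(a, b, c). a = i0 \<and> c = i0 + q1 + 2) l"
        using True \<open>(i, p, m) \<in># l\<close> q1 by simp
      then have p: "p = i0 + s + 1"
        unfolding filter_tree_node(1)[OF s l1 l2 l'] by simp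
      have Q: "Q = l1 + l2 + r"
        using lr l' p True q1 by simp
      have "add_mset (p, m, j) (l2 + r) \<in> trees (Suc (n' - Suc s)) p"
        using trees_SucI[of "q1 - s" "n' - Suc s" l2 p r] l2 r s q q1 True p
        by (simp add: Suc_diff_le)
      then have "add_mset (i, p, j) (l1 + add_mset (p, m, j) (l2 + r)) \<in> trees (Suc n') i0"
        using trees_SucI[of s n' l1 i0 "add_mset (p, m, j) (l2 + r)"] l1 s q q1 True p
        by (simp add: Suc_diff_Suc)
      then show ?thesis
        unfolding Suc Q by (simp add: union_assoc)
    next
      case False
      let ?root = "(i0, i0 + q + 1, i0 + n' + 2)"
      have np: "(i, p, m) \<noteq> ?root" using jr by auto
      have "?root \<in># t" by (simp add: t)
      then have "?root \<in># Q" using False np by (auto simp: t_def)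
      then obtain Q0 where Q0: "Q = add_mset ?root Q0" by (blast dest: multi_member_split)
      then have "add_mset ?root (l + r) = add_mset ?root ({#(i, m, j), (i, p, m)#} + Q0)"
        using t t_def by (simp add: add_mset_commute)
      then have lr: "l + r = {#(i, m, j), (i, p, m)#} + Q0"
        by (subst (asm) add_mset_add_mset_same_iff)
      then have sub: "{#(i, m, j), (i, p, m)#} \<subseteq># add_mset ?root (l + r)"
        by (metis mset_subset_eq_add_left union_mset_add_mset_right)
      have mem: "(i, m, j) \<in># l + r" "(i, p, m) \<in># l + r"
        using lr by auto
      have "j \<le> i0 + q + 1 \<or> i0 + q + 1 \<le> i"
        using mem(1) L[of i m j] R[of i m j] by auto
      then show ?thesis
      proof
        assume j: "j \<le> i0 + q + 1"
        \<comment> \<open>Filtering by position recovers \<open>l\<close> from the whole tree, so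
          the pair is a submultiset of \<open>l\<close> and not only of
          \<open>l + r\<close>.\<close>
        then have "{#(i, m, j), (i, p, m)#} = filter_mset (\<lambda>(a, b, c). c \<le> i0 + q + 1) {#(i, m, j), (i, p, m)#}"
          using jr by simp
        also have "\<dots> \<subseteq># filter_mset (\<lambda>(a, b, c). c \<le> i0 + q + 1) (add_mset ?root (l + r))"
          using sub by (intro multiset_filter_mono) (metis add_mset_add_single mset_subset_eq_add_left subset_mset.order_trans)
        also have "\<dots> = l" by (rule filter_tree_node(2)[OF q l r refl])
        finally obtain Q' where Q': "l = {#(i, m, j), (i, p, m)#} + Q'"
          by (auto simp: subset_mset.le_iff_add)
        from less.IH[of q Q' i0] l Q' q Suc
        have "{#(i, p, j), (p, m, j)#} + Q' \<in> trees q i0" by auto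
        from trees_SucI[OF q this r]
        have "add_mset ?root ({#(i, p, j), (p, m, j)#} + Q' + r) \<in> trees (Suc n') i0" .
        moreover have "Q = add_mset ?root (Q' + r)"
          using lr Q0 Q' by (simp add: add_mset_commute)
        ultimately show ?thesis
          unfolding Suc by (simp add: union_assoc add_mset_commute)
      next
        assume j: "i0 + q + 1 \<le> i"
        then have "{#(i, m, j), (i, p, m)#} = filter_mset (\<lambda>(a, b, c). i0 + q + 1 \<le> a) {#(i, m, j), (i, p, m)#}"
          using jr by simp
        also have "\<dots> \<subseteq># filter_mset (\<lambda>(a, b, c). i0 + q + 1 \<le> a) (add_mset ?root (l + r))"
          using sub by (intro multiset_filter_mono) (metis add_mset_add_single mset_subset_eq_add_left subset_mset.order_trans)
        also have "\<dots> = r" by (rule filter_tree_node(3)[OF q l r refl])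
        finally obtain Q' where Q': "r = {#(i, m, j), (i, p, m)#} + Q'"
          by (auto simp: subset_mset.le_iff_add)
        from less.IH[of "n' - q" Q' "i0 + q + 1"] r Q' q Suc
        have "{#(i, p, j), (p, m, j)#} + Q' \<in> trees (n' - q) (i0 + q + 1)" by auto
        from trees_SucI[OF q l this]
        have "add_mset ?root (l + ({#(i, p, j), (p, m, j)#} + Q')) \<in> trees (Suc n') i0" .
        moreover have "Q = add_mset ?root (l + Q')"
          using lr Q0 Q' by (simp add: add_mset_commute)
        ultimately show ?thesis
          unfolding Suc by (simp add: union_assoc add_mset_commute)
      qed
    qed
  qed
qed

text \<open>The top node of the comb is set aside in \<open>Q\<close> while induction brings the
  split \<open>q\<close> to the root of the smaller comb. One rotation then splits the whole
  interval at \<open>q\<close>, and the old split survives as the top node of the right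
  comb.\<close>

lemma rotations_split_root:
  assumes "left_comb i (Suc n) + Q \<in> rotations k" "q \<le> n" "i + n + 2 \<le> k"
  shows "add_mset (i, i + q + 1, i + n + 2) (left_comb i q + left_comb (i + q + 1) (n - q)) + Q
    \<in> rotations k"
  using assms
proof (induction n arbitrary: Q)
  case 0
  then show ?case by (simp add: left_comb_Suc)
next
  case (Suc n)
  show ?case
  proof (cases "q = Suc n")
    case True
    then show ?thesis using Suc.prems(1) by (simp add: left_comb_Suc)
  next
    case False
    then have q: "q \<le> n" using Suc.prems by simp
    let ?root = "(i, i + n + 2, i + n + 3)"
    have "left_comb i (Suc n) + add_mset ?root Q \<in> rotations k"
      using Suc.prems(1) by (simp add: left_comb_Suc[of _ "Suc n"] numeral_3_eq_3 add_mset_commute)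
    from Suc.IH[OF this q] Suc.prems(3)
    have "{#?root, (i, i + q + 1, i + n + 2)#} + (left_comb i q + left_comb (i + q + 1) (n - q) + Q) \<in> rotations k"
      by (simp add: add_mset_commute)
    from rotations.rotate[OF this] Suc.prems(3) q
    have "{#(i, i + q + 1, i + n + 3), (i + q + 1, i + n + 2, i + n + 3)#}
        + (left_comb i q + left_comb (i + q + 1) (n - q) + Q) \<in> rotations k"
      by simp
    moreover have "left_comb (i + q + 1) (Suc n - q)
        = add_mset (i + q + 1, i + n + 2, i + n + 3) (left_comb (i + q + 1) (n - q))"
      using q by (simp add: Suc_diff_le left_comb_Suc)
    ultimately show ?thesis
      by (simp add: ac_simps numeral_3_eq_3 add_mset_commute)
  qed
qed

text \<open>Rotations go in one direction only, so every tree is built from the comb: the root is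
  fixed, then the two combs below it are rebuilt. The context \<open>Q\<close> holds the nodes that
  are currently not touched.\<close>

lemma trees_reachable:
  assumes "t \<in> trees n i" "left_comb i n + Q \<in> rotations k" "i + n + 1 \<le> k"
  shows "t + Q \<in> rotations k"
  using assms
proof (induction n arbitrary: t i Q rule: less_induct)
  case (less n)
  show ?case
  proof (cases n)
    case 0
    then show ?thesis using less.prems by simp
  next
    case (Suc m)
    from less.prems(1)[unfolded Suc] obtain q l r
      where q: "q \<le> m" and l: "l \<in> trees q i" and r: "r \<in> trees (m - q) (i + q + 1)"
        and t: "t = add_mset (i, i + q + 1, i + m + 2) (l + r)"
      by (rule trees_SucE)
    let ?root = "(i, i + q + 1, i + m + 2)"
    have "add_mset ?root (left_comb i q + left_comb (i + q + 1) (m - q)) + Q \<in> rotations k"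
      using less.prems Suc q by (intro rotations_split_root) auto
    then have "left_comb i q + (add_mset ?root (left_comb (i + q + 1) (m - q)) + Q) \<in> rotations k"
      by (simp add: ac_simps)
    from less.IH[OF _ l this] have "l + (add_mset ?root (left_comb (i + q + 1) (m - q)) + Q) \<in> rotations k"
      using q Suc less.prems(3) by simp
    then have "left_comb (i + q + 1) (m - q) + (add_mset ?root l + Q) \<in> rotations k"
      by (simp add: ac_simps)
    from less.IH[OF _ r this] have "r + (add_mset ?root l + Q) \<in> rotations k"
      using q Suc less.prems(3) by simp
    then show ?thesis by (simp add: t ac_simps)
  qed
qed

theorem rotations_eq_trees:
  assumes "k \<ge> 1"
  shows "rotations k = trees (k - 1) 0"
proof (intro equalityI subsetI)
  fix t assume "t \<in> rotations k"
  then show "t \<in> trees (k - 1) 0"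
  proof induction
    case initial
    then show ?case using left_comb_in_trees[of 0 "k - 1"] assms by (simp add: left_comb_def)
  next
    case rotate
    then show ?case using trees_rotate by metis
  qed
next
  fix t assume "t \<in> trees (k - 1) 0"
  moreover have "left_comb 0 (k - 1) + {#} \<in> rotations k"
    using rotations.initial[of k] assms by (simp add: left_comb_def)
  ultimately show "t \<in> rotations k"
    using trees_reachable[of t "k - 1" 0 "{#}" k] assms by simp
qed

lemma rotations_range:
  assumes "k \<ge> 1" "t \<in> rotations k" "(i, m, j) \<in># t"
  shows "i < m \<and> m < j \<and> j \<le> k"
  using trees_range[of t "k - 1" 0 i m j] assms by (simp add: rotations_eq_trees)

section \<open>Election processes as trees\<close>

definition node_symbol :: "(nat \<Rightarrow> nat) \<Rightarrow> nat \<times> nat \<times> nat \<Rightarrow> nat \<times> nat" where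
  "node_symbol N = (\<lambda>(i, m, j). (N j - N i, N m - N i))"

lemma generic_position_eqD:
  assumes "generic_position k N" "i < j" "j \<le> k" "p < m" "m \<le> k" "N j - N i = N m - N p"
  shows "j = m \<and> i = p"
  using assms unfolding generic_position_def by (metis Pair_inject)

text \<open>Genericity is used for the upper entry, which fixes the interval, and again for the
  lower entry, which fixes the split.\<close>

lemma node_symbol_eqD:
  assumes "strict_mono_on {0..k} N" "generic_position k N"
    and "i < m" "m < j" "j \<le> k" "i' < m'" "m' < j'" "j' \<le> k"
    and "node_symbol N (i, m, j) = node_symbol N (i', m', j')"
  shows "(i, m, j) = (i', m', j')"
  using generic_position_eqD[OF assms(2), of i j i' j'] generic_position_eqD[OF assms(2), of i m i' m'] assms
  by (auto simp: node_symbol_def)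

text \<open>A revision cannot combine factors by a numerical coincidence: genericity forces the
  nodes above the two symbols to share the endpoints that a rotation needs.\<close>

lemma election_processes_eq:
  assumes "k \<ge> 1" "N 0 = 0" "strict_mono_on {0..k} N" "generic_position k N"
  shows "election_processes k N = image_mset (node_symbol N) ` rotations k"
proof -
  have init: "mset (map (\<lambda>i. (N (i + 1), N i)) [1..<k]) =
      image_mset (node_symbol N) (mset (map (\<lambda>i. (0, i, i + 1)) [1..<k]))"
    by (simp add: node_symbol_def assms(2) multiset.map_comp o_def)
  show ?thesis
  proof (intro equalityI subsetI)
    fix P assume "P \<in> election_processes k N"
    then show "P \<in> image_mset (node_symbol N) ` rotations k"
    proof induction
      case initial
      show ?case unfolding init using rotations.initial by blast
    next
      case (revision j i m p Q)
      then obtain t where t: "t \<in> rotations k"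
        and "image_mset (node_symbol N) t
          = add_mset (N j - N (i - 1), N m - N (i - 1)) (add_mset (N m - N (i - 1), N (p - 1) - N (i - 1)) Q)"
        by auto
      then obtain x t1 where x: "t = add_mset x t1" "node_symbol N x = (N j - N (i - 1), N m - N (i - 1))"
        and "image_mset (node_symbol N) t1 = add_mset (N m - N (i - 1), N (p - 1) - N (i - 1)) Q"
        by (blast dest: msed_map_invR)
      then obtain y t2 where y: "t1 = add_mset y t2" "node_symbol N y = (N m - N (i - 1), N (p - 1) - N (i - 1))"
        and Q: "image_mset (node_symbol N) t2 = Q"
        by (blast dest: msed_map_invR)
      obtain x1 x2 x3 y1 y2 y3 where xy: "x = (x1, x2, x3)" "y = (y1, y2, y3)"
        by (cases x, cases y)
      have xr: "x1 < x2 \<and> x2 < x3 \<and> x3 \<le> k" and yr: "y1 < y2 \<and> y2 < y3 \<and> y3 \<le> k"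
        using rotations_range[OF assms(1) t] x(1) y(1) xy by auto
      have X: "(x1, x2, x3) = (i - 1, m, j)"
        using xr revision.hyps x(2) xy
        by (intro node_symbol_eqD[OF assms(3,4)]) (auto simp: node_symbol_def)
      have Y: "(y1, y2, y3) = (i - 1, p - 1, m)"
        using yr revision.hyps y(2) xy
        by (intro node_symbol_eqD[OF assms(3,4)]) (auto simp: node_symbol_def)
      have "{#(i - 1, m, j), (i - 1, p - 1, m)#} + t2 \<in> rotations k"
        using t x(1) y(1) xy X Y by simp
      then have "{#(i - 1, p - 1, j), (p - 1, m, j)#} + t2 \<in> rotations k"
        by (rule rotations.rotate) (use revision.hyps in auto)
      moreover have "image_mset (node_symbol N) ({#(i - 1, p - 1, j), (p - 1, m, j)#} + t2) =
          {# (N j - N (i - 1), N (p - 1) - N (i - 1)), (N j - N (p - 1), N m - N (p - 1)) #} + Q"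
        unfolding Q[symmetric] by (simp add: node_symbol_def)
      ultimately show ?case by (metis imageI)
    qed
  next
    fix P assume "P \<in> image_mset (node_symbol N) ` rotations k"
    then obtain t where "P = image_mset (node_symbol N) t" "t \<in> rotations k" by blast
    from this(2) have "image_mset (node_symbol N) t \<in> election_processes k N"
    proof induction
      case initial
      show ?case using election_processes.initial[where k = k and N = N] unfolding init .
    next
      case (rotate i m j p Q)
      \<comment> \<open>The successors undo the index shift between \<open>rotations\<close> and the
        revision rule.\<close>
      have "{# (N j - N (Suc i - 1), N (Suc p - 1) - N (Suc i - 1)), (N j - N (Suc p - 1), N m - N (Suc p - 1)) #}
          + image_mset (node_symbol N) Q \<in> election_processes k N"
        by (rule election_processes.revision) (use rotate in \<open>auto simp: node_symbol_def\<close>)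
      then show ?case by (simp add: node_symbol_def)
    qed
    then show "P \<in> election_processes k N"
      using \<open>P = _\<close> by simp
  qed
qed

theorem card_election_processes:
  assumes "k \<ge> 1" "N 0 = 0" "strict_mono_on {0..k} N" "generic_position k N"
  shows "card (election_processes k N) = catalan (k - 1)"
proof -
  have inj: "inj_on (node_symbol N) {(i, m, j). i < m \<and> m < j \<and> j \<le> k}"
    using node_symbol_eqD[OF assms(3,4)] by (fastforce intro!: inj_onI)
  have "inj_on (image_mset (node_symbol N)) {t. set_mset t \<subseteq> {(i, m, j). i < m \<and> m < j \<and> j \<le> k}}"
  proof (rule inj_onI)
    fix s t
    assume "s \<in> {t. set_mset t \<subseteq> {(i, m, j). i < m \<and> m < j \<and> j \<le> k}}"
      and "t \<in> {t. set_mset t \<subseteq> {(i, m, j). i < m \<and> m < j \<and> j \<le> k}}"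
      and eq: "image_mset (node_symbol N) s = image_mset (node_symbol N) t"
    then have "x = y" if "x \<in># s" "y \<in># t" "node_symbol N x = node_symbol N y" for x y
      using that by (intro inj_onD[OF inj that(3)]) auto
    then show "s = t"
      using eq by (rule multiset.inj_map_strong)
  qed
  moreover have "rotations k \<subseteq> {t. set_mset t \<subseteq> {(i, m, j). i < m \<and> m < j \<and> j \<le> k}}"
    using rotations_range[OF assms(1)] by auto
  ultimately have "inj_on (image_mset (node_symbol N)) (rotations k)"
    by (rule inj_on_subset)
  then show ?thesis
    unfolding election_processes_eq[OF assms] rotations_eq_trees[OF assms(1)]
    by (simp add: card_image card_trees)
qed

hide_const (open) Determinants.det Finite_Cartesian_Product.mat Finite_Cartesian_Product.row
  Finite_Cartesian_Product.column Finite_Cartesian_Product.transpose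

no_notation vec_index (infixl "$" 100)

section \<open>Configurations of points\<close>

definition const_fract :: "'f::field \<Rightarrow> 'f poly fract" where
  "const_fract c = to_fract [:c:]"

lemma const_fract_simps [simp]:
  "const_fract 0 = 0" "const_fract 1 = 1"
  "const_fract (a + b) = const_fract a + const_fract b"
  "const_fract (a * b) = const_fract a * const_fract b"
  "const_fract (- a) = - const_fract a"
  "const_fract (a - b) = const_fract a - const_fract b"
  "const_fract a = 0 \<longleftrightarrow> a = 0"
  unfolding const_fract_def
  by (simp_all flip: to_fract_add to_fract_mult to_fract_uminus to_fract_diff one_pCons)

text \<open>
  The coordinates are rational functions over the field, which may be finite, so that there are
  infinitely many points. The first condition keeps the second coordinates non-zero under the
  action of \<^const>\<open>SL2\<close>.
\<close>

typedef (overloaded) ('f::field) config =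
  "{z :: nat \<Rightarrow> 'f poly fract \<times> 'f poly fract.
     (\<forall>i a b. (a, b) \<noteq> (0, 0) \<longrightarrow> const_fract a * fst (z i) + const_fract b * snd (z i) \<noteq> 0) \<and>
     (\<forall>i j. i \<noteq> j \<longrightarrow> fst (z i) * snd (z j) \<noteq> fst (z j) * snd (z i))}"
proof -
  \<comment> \<open>Powers of the variable with distinct positive exponents: none of them is
    proportional to 1 over the base field, and no two are equal.\<close>
  define z :: "nat \<Rightarrow> 'f poly fract \<times> 'f poly fract" where
    "z i = (to_fract (monom 1 (Suc i)), 1)" for i
  have "const_fract a * fst (z i) + const_fract b * snd (z i) \<noteq> 0" if "(a, b) \<noteq> (0, 0)" for a b i
  proof -
    have "const_fract a * fst (z i) + const_fract b * snd (z i) = to_fract (monom a (Suc i) + [:b:])"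
      unfolding z_def const_fract_def by (simp add: smult_monom flip: to_fract_mult to_fract_add)
    moreover have "monom a (Suc i) + [:b:] \<noteq> 0"
    proof
      assume "monom a (Suc i) + [:b:] = 0"
      then have "coeff (monom a (Suc i) + [:b:]) 0 = 0" "coeff (monom a (Suc i) + [:b:]) (Suc i) = 0"
        by simp_all
      then show False using that by simp
    qed
    ultimately show ?thesis by (metis to_fract_eq_0_iff)
  qed
  moreover have "fst (z i) * snd (z j) \<noteq> fst (z j) * snd (z i)" if "i \<noteq> j" for i j
    using that by (simp add: z_def monom_eq_iff')
  ultimately show ?thesis by (intro exI[of _ z]) auto
qed

definition coord_x :: "'f::field config \<Rightarrow> nat \<Rightarrow> 'f poly fract" where
  "coord_x z i = fst (Rep_config z i)"

definition coord_y :: "'f::field config \<Rightarrow> nat \<Rightarrow> 'f poly fract" where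
  "coord_y z i = snd (Rep_config z i)"

text \<open>Only an injective \<open>\<sigma>\<close> keeps the points pairwise non-proportional;
  for any other \<open>\<sigma>\<close> the value of \<open>Abs_config\<close> is
  unspecified.\<close>

definition reindex :: "(nat \<Rightarrow> nat) \<Rightarrow> 'f::field config \<Rightarrow> 'f config" where
  "reindex \<sigma> z = Abs_config (\<lambda>i. Rep_config z (\<sigma> i))"

text \<open>The coefficients are those of the substitution in \<open>sl2_subst\<close>, so that
  substituting in a form amounts to evaluating it at the moved point.\<close>

definition move :: "'f ^ 2 ^ 2 \<Rightarrow> 'f::field config \<Rightarrow> 'f config" where
  "move g z = Abs_config (\<lambda>i.
     (const_fract (g $ 1 $ 1) * coord_x z i + const_fract (g $ 2 $ 1) * coord_y z i,
      const_fract (g $ 1 $ 2) * coord_x z i + const_fract (g $ 2 $ 2) * coord_y z i))"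

lemma coord_independent:
  "(a, b) \<noteq> (0, 0) \<Longrightarrow> const_fract a * coord_x z i + const_fract b * coord_y z i \<noteq> 0"
  using Rep_config[of z] by (auto simp: coord_x_def coord_y_def)

lemma coord_y_nonzero [simp]: "coord_y z i \<noteq> 0"
  using coord_independent[of 0 1 z i] by simp

lemma points_independent:
  "i \<noteq> j \<Longrightarrow> coord_x z i * coord_y z j \<noteq> coord_x z j * coord_y z i"
  using Rep_config[of z] by (auto simp: coord_x_def coord_y_def)

lemma coord_reindex [simp]:
  assumes "inj \<sigma>"
  shows "coord_x (reindex \<sigma> z) i = coord_x z (\<sigma> i)" "coord_y (reindex \<sigma> z) i = coord_y z (\<sigma> i)"
proof -
  have "Rep_config (reindex \<sigma> z) = (\<lambda>i. Rep_config z (\<sigma> i))"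
    unfolding reindex_def
    by (rule Abs_config_inverse) (use Rep_config[of z] assms in \<open>auto simp: inj_eq\<close>)
  then show "coord_x (reindex \<sigma> z) i = coord_x z (\<sigma> i)" "coord_y (reindex \<sigma> z) i = coord_y z (\<sigma> i)"
    by (simp_all add: coord_x_def coord_y_def)
qed

lemma config_eqI: "(\<And>i. coord_x z i = coord_x w i) \<Longrightarrow> (\<And>i. coord_y z i = coord_y w i) \<Longrightarrow> z = w"
  unfolding coord_x_def coord_y_def by (simp add: Rep_config_inject[symmetric] fun_eq_iff prod_eq_iff)

lemma SL2_det: "g \<in> SL2 \<longleftrightarrow> g $ 1 $ 1 * g $ 2 $ 2 - g $ 1 $ 2 * g $ 2 $ 1 = 1"
  by (simp add: SL2_def det_2)

text \<open>What has to be shown is that the moved points form a configuration. A non-zero linear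
  form over the base field pulls back to a non-zero one by Cramer's rule, and the cross product of
  two points is multiplied by the determinant.\<close>

lemma coord_move:
  assumes "g \<in> SL2"
  shows "coord_x (move g z) i = const_fract (g $ 1 $ 1) * coord_x z i + const_fract (g $ 2 $ 1) * coord_y z i"
    and "coord_y (move g z) i = const_fract (g $ 1 $ 2) * coord_x z i + const_fract (g $ 2 $ 2) * coord_y z i"
proof -
  let ?c = "const_fract :: 'a \<Rightarrow> _"
  let ?x = "\<lambda>i. ?c (g $ 1 $ 1) * coord_x z i + ?c (g $ 2 $ 1) * coord_y z i"
  let ?y = "\<lambda>i. ?c (g $ 1 $ 2) * coord_x z i + ?c (g $ 2 $ 2) * coord_y z i"
  from assms have det: "g $ 1 $ 1 * g $ 2 $ 2 - g $ 1 $ 2 * g $ 2 $ 1 = 1"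
    by (simp add: SL2_det)
  have "?c (g $ 1 $ 1 * g $ 2 $ 2 - g $ 1 $ 2 * g $ 2 $ 1) = 1"
    unfolding det by simp
  then have detc: "?c (g $ 1 $ 1) * ?c (g $ 2 $ 2) - ?c (g $ 1 $ 2) * ?c (g $ 2 $ 1) = 1"
    by simp
  have "?c a * ?x i + ?c b * ?y i \<noteq> 0" if "(a, b) \<noteq> (0, 0)" for a b i
  proof -
    have "(a * g $ 1 $ 1 + b * g $ 1 $ 2, a * g $ 2 $ 1 + b * g $ 2 $ 2) \<noteq> (0, 0)"
    proof
      assume "(a * g $ 1 $ 1 + b * g $ 1 $ 2, a * g $ 2 $ 1 + b * g $ 2 $ 2) = (0, 0)"
      then have *: "a * g $ 1 $ 1 + b * g $ 1 $ 2 = 0" "a * g $ 2 $ 1 + b * g $ 2 $ 2 = 0" by auto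
      have "a * (g $ 1 $ 1 * g $ 2 $ 2 - g $ 1 $ 2 * g $ 2 $ 1)
          = (a * g $ 1 $ 1 + b * g $ 1 $ 2) * g $ 2 $ 2 - (a * g $ 2 $ 1 + b * g $ 2 $ 2) * g $ 1 $ 2"
        "b * (g $ 1 $ 1 * g $ 2 $ 2 - g $ 1 $ 2 * g $ 2 $ 1)
          = (a * g $ 2 $ 1 + b * g $ 2 $ 2) * g $ 1 $ 1 - (a * g $ 1 $ 1 + b * g $ 1 $ 2) * g $ 2 $ 1"
        by (simp_all add: algebra_simps)
      then show False using that unfolding * det by simp
    qed
    from coord_independent[OF this, of z i] show ?thesis
      by (simp add: algebra_simps)
  qed
  moreover have "?x i * ?y j \<noteq> ?x j * ?y i" if "i \<noteq> j" for i j
  proof -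
    have "?x i * ?y j - ?x j * ?y i = (?c (g $ 1 $ 1) * ?c (g $ 2 $ 2) - ?c (g $ 1 $ 2) * ?c (g $ 2 $ 1)) *
        (coord_x z i * coord_y z j - coord_x z j * coord_y z i)"
      by (simp add: algebra_simps)
    then show ?thesis
      using points_independent[OF that, of z] by (metis detc mult_1 right_minus_eq)
  qed
  ultimately have "Rep_config (move g z) = (\<lambda>i. (?x i, ?y i))"
    unfolding move_def by (intro Abs_config_inverse) auto
  then show "coord_x (move g z) i = ?x i" "coord_y (move g z) i = ?y i"
    by (simp_all add: coord_x_def coord_y_def)
qed

text \<open>The cross product is scaled by the determinant, which is 1. Hence division by the
  Vandermonde determinant will commute with the action.\<close>

lemma wedge_move:
  assumes "g \<in> SL2"
  shows "coord_y (move g z) i * coord_x (move g z) j - coord_x (move g z) i * coord_y (move g z) j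
    = coord_y z i * coord_x z j - coord_x z i * coord_y z j"
proof -
  let ?c = "const_fract :: 'a \<Rightarrow> _"
  have "?c (g $ 1 $ 1 * g $ 2 $ 2 - g $ 1 $ 2 * g $ 2 $ 1) = ?c 1"
    using assms by (simp only: SL2_det)
  then have detc: "?c (g $ 1 $ 1) * ?c (g $ 2 $ 2) - ?c (g $ 1 $ 2) * ?c (g $ 2 $ 1) = 1"
    by simp
  have "coord_y (move g z) i * coord_x (move g z) j - coord_x (move g z) i * coord_y (move g z) j
    = (?c (g $ 1 $ 1) * ?c (g $ 2 $ 2) - ?c (g $ 1 $ 2) * ?c (g $ 2 $ 1)) *
      (coord_y z i * coord_x z j - coord_x z i * coord_y z j)"
    unfolding coord_move[OF assms] by (simp add: algebra_simps)
  then show ?thesis unfolding detc by simp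
qed

lemma reindex_move:
  assumes "g \<in> SL2" "inj \<sigma>"
  shows "reindex \<sigma> (move g z) = move g (reindex \<sigma> z)"
  by (rule config_eqI) (simp_all add: coord_move assms)

section \<open>Functions on configurations\<close>

type_synonym 'f config_fun = "'f config \<Rightarrow> 'f poly fract"

definition fun_scale :: "'f::field \<Rightarrow> ('f config_fun) \<Rightarrow> 'f config_fun" where
  "fun_scale c f = (\<lambda>z. const_fract c * f z)"

lemma fun_scale_apply [simp]: "fun_scale c f z = const_fract c * f z"
  by (simp add: fun_scale_def)

global_interpretation funs: vector_space fun_scale
  by unfold_locales (auto simp: fun_eq_iff algebra_simps)

lemma sum_fun_apply: "(\<Sum>x\<in>A. f x) z = (\<Sum>x\<in>A. f x z)"
  by (induction A rule: infinite_finite_induct) auto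

lemma prod_fun_apply: "(\<Prod>x\<in>A. f x) z = (\<Prod>x\<in>A. f x z)"
  by (induction A rule: infinite_finite_induct) auto

lemma fun_scale_mult: "fun_scale c (f * g) = fun_scale c f * g" "fun_scale c (f * g) = f * fun_scale c g"
  by (auto simp: fun_eq_iff algebra_simps)

text \<open>Division by a power of \<open>coord_y\<close> gives a polynomial of degree below
  \<open>n\<close> in the ratio of the coordinates, and the \<open>n\<close> ratios are distinct.
  The coefficients lie in the large field, since they will be built from determinants of values at
  other points.\<close>

lemma form_eq_0:
  fixes l :: "nat \<Rightarrow> 'f::field poly fract"
  assumes "\<And>i. i < n \<Longrightarrow> (\<Sum>j<n. l j * (coord_x z i ^ j * coord_y z i ^ (n - 1 - j))) = 0"
    and "j < n"
  shows "l j = 0"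
proof -
  define p where "p = (\<Sum>j<n. monom (l j) j)"
  have coeff: "coeff p j = (if j < n then l j else 0)" for j
    unfolding p_def coeff_sum by (simp add: sum.delta[where 'b = "'f poly fract"])
  have root: "poly p (coord_x z i / coord_y z i) = 0" if "i < n" for i
  proof -
    have "coord_y z i ^ (n - 1) * poly p (coord_x z i / coord_y z i) =
        (\<Sum>j<n. l j * (coord_x z i ^ j * coord_y z i ^ (n - 1 - j)))"
      unfolding p_def poly_sum sum_distrib_left
    proof (intro sum.cong refl)
      fix j assume "j \<in> {..<n}"
      then have "coord_y z i ^ (n - 1) = coord_y z i ^ (n - 1 - j) * coord_y z i ^ j"
        by (simp flip: power_add)
      then show "coord_y z i ^ (n - 1) * poly (monom (l j) j) (coord_x z i / coord_y z i)
          = l j * (coord_x z i ^ j * coord_y z i ^ (n - 1 - j))"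
        by (simp add: poly_monom power_divide)
    qed
    then show ?thesis using assms(1)[OF that] by simp
  qed
  have "p = 0"
  proof (rule ccontr)
    assume "p \<noteq> 0"
    have "inj_on (\<lambda>i. coord_x z i / coord_y z i) {..<n}"
      by (rule inj_onI) (metis coord_y_nonzero frac_eq_eq points_independent)
    then have "n = card ((\<lambda>i. coord_x z i / coord_y z i) ` {..<n})"
      by (simp add: card_image)
    also have "\<dots> \<le> card {x. poly p x = 0}"
      using root \<open>p \<noteq> 0\<close> by (intro card_mono poly_roots_finite) auto
    also have "\<dots> \<le> degree p"
      using \<open>p \<noteq> 0\<close> by (rule card_poly_roots_bound)
    also have "\<dots> < n"
      using \<open>p \<noteq> 0\<close> coeff[of "degree p"] by (auto split: if_splits)
    finally show False by simp
  qed
  then show ?thesis using coeff[of j] assms(2) by simp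
qed

section \<open>Determinants of functions of two indices\<close>

lemma permutes_lessD: "p permutes {0..<b} \<Longrightarrow> i < b \<Longrightarrow> p i < b" for b :: nat
  using permutes_in_image[of p "{0..<b}" i] by simp

text \<open>The entries are an unrestricted function, so that rows can be exchanged by function
  update without dimension conditions on matrices.\<close>

definition fdet :: "nat \<Rightarrow> (nat \<Rightarrow> nat \<Rightarrow> 'a::comm_ring_1) \<Rightarrow> 'a" where
  "fdet b u = det (mat b b (\<lambda>(i, j). u i j))"

lemma fdet_leibniz: "fdet b u = (\<Sum>p | p permutes {0..<b}. signof p * (\<Prod>i = 0..<b. u i (p i)))"
proof -
  have "fdet b u = (\<Sum>p | p permutes {0..<b}. signof p *
      (\<Prod>i = 0..<b. mat b b (\<lambda>(i, j). u i j) $$ (i, p i)))"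
    unfolding fdet_def by (rule det_def') simp
  also have "\<dots> = (\<Sum>p | p permutes {0..<b}. signof p * (\<Prod>i = 0..<b. u i (p i)))"
    by (intro sum.cong arg_cong2[where f = "(*)"] prod.cong refl) (auto simp: permutes_lessD)
  finally show ?thesis .
qed

lemma fdet_transpose: "fdet b (\<lambda>i j. u j i) = fdet b u"
proof -
  have "transpose_mat (mat b b (\<lambda>(i, j). u i j)) = mat b b (\<lambda>(i, j). u j i)"
    by (rule eq_matI) auto
  then show ?thesis
    unfolding fdet_def using det_transpose[of "mat b b (\<lambda>(i, j). u i j)" b] by simp
qed

lemma fdet_cong: "(\<And>i j. i < b \<Longrightarrow> j < b \<Longrightarrow> u i j = v i j) \<Longrightarrow> fdet b u = fdet b v"
  unfolding fdet_def by (intro arg_cong[where f = det] cong_mat) auto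

lemma fdet_identical_rows:
  assumes "i \<noteq> j" "i < b" "j < b" "\<And>l. l < b \<Longrightarrow> u i l = u j l"
  shows "fdet b u = 0"
  unfolding fdet_def
  by (rule det_identical_rows[OF _ assms(1-3)]) (use assms in \<open>auto intro!: eq_vecI\<close>)

lemma fdet_permute_rows:
  assumes "p permutes {0..<b}"
  shows "fdet b (\<lambda>i. u (p i)) = signof p * fdet b u"
proof -
  have "fdet b (\<lambda>i. u (p i)) = det (mat b b (\<lambda>(i, j). mat b b (\<lambda>(i, j). u i j) $$ (p i, j)))"
    unfolding fdet_def using assms
    by (intro arg_cong[where f = det] cong_mat) (auto simp: permutes_lessD)
  also have "\<dots> = signof p * fdet b u"
    unfolding fdet_def by (rule det_permute_rows) (use assms in auto)
  finally show ?thesis .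
qed

text \<open>The Leibniz formula with the entry from row \<open>m\<close> pulled out: linearity in
  \<open>v\<close> becomes evident, and the rules for sums and multiples of a row follow.\<close>

lemma fdet_row_eq:
  assumes "m < b"
  shows "fdet b (u(m := v)) =
    (\<Sum>p | p permutes {0..<b}. signof p * (\<Prod>i\<in>{0..<b} - {m}. u i (p i)) * v (p m))"
  unfolding fdet_leibniz
proof (intro sum.cong refl)
  fix p
  have "(\<Prod>i = 0..<b. (u(m := v)) i (p i)) = v (p m) * (\<Prod>i\<in>{0..<b} - {m}. (u(m := v)) i (p i))"
    using assms by (subst prod.remove[of _ m]) auto
  also have "(\<Prod>i\<in>{0..<b} - {m}. (u(m := v)) i (p i)) = (\<Prod>i\<in>{0..<b} - {m}. u i (p i))"
    by (rule prod.cong) auto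
  finally show "signof p * (\<Prod>i = 0..<b. (u(m := v)) i (p i)) =
      signof p * (\<Prod>i\<in>{0..<b} - {m}. u i (p i)) * v (p m)"
    by (simp add: ac_simps)
qed

lemma fdet_row_sum:
  assumes "m < b"
  shows "fdet b (u(m := (\<lambda>j. \<Sum>q\<in>Q. a q * w q j))) = (\<Sum>q\<in>Q. a q * fdet b (u(m := w q)))"
  unfolding fdet_row_eq[OF assms] sum_distrib_left
  by (subst sum.swap) (simp add: ac_simps)

lemma fdet_row_add:
  assumes "m < b"
  shows "fdet b (u(m := (\<lambda>j. v j + w j))) = fdet b (u(m := v)) + fdet b (u(m := w))"
  unfolding fdet_row_eq[OF assms] by (simp add: algebra_simps sum.distrib)

lemma fdet_row_scale:
  assumes "m < b"
  shows "fdet b (u(m := (\<lambda>j. c * v j))) = c * fdet b (u(m := v))"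
  unfolding fdet_row_eq[OF assms] by (simp add: algebra_simps sum_distrib_left)

lemma fdet_zero_row:
  assumes "m < b" "\<And>j. j < b \<Longrightarrow> u m j = 0"
  shows "fdet b u = 0"
proof -
  have "fdet b u = fdet b (u(m := (\<lambda>j. 0 * 0)))"
    by (rule fdet_cong) (use assms in auto)
  also have "\<dots> = 0"
    by (subst fdet_row_scale[OF assms(1)]) simp
  finally show ?thesis .
qed

lemma fdet_last_row:
  "fdet (Suc b) u = (\<Sum>j<Suc b. u b j * ((-1) ^ (b + j) *
     det (mat_delete (mat (Suc b) (Suc b) (\<lambda>(i, j). u i j)) b j)))"
  unfolding fdet_def
  by (subst laplace_expansion_row[of _ "Suc b" b]) (auto simp: cofactor_def)

lemma fdet_delete_last: "det (mat_delete (mat (Suc b) (Suc b) (\<lambda>(i, j). u i j)) b b) = fdet b u"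
  unfolding fdet_def mat_delete_def by (intro arg_cong[where f = det] eq_matI) auto

section \<open>Alternants\<close>

text \<open>The generalized Vandermonde determinant in the numerator of a Schur function, made
  homogeneous of degree \<open>d\<close> in each point. The subtraction is exact when
  \<open>\<gamma> i \<le> d\<close>.\<close>

definition alternant :: "nat \<Rightarrow> nat \<Rightarrow> (nat \<Rightarrow> nat) \<Rightarrow> 'f::field config_fun" where
  "alternant b d \<gamma> z = fdet b (\<lambda>i j. coord_x z j ^ \<gamma> i * coord_y z j ^ (d - \<gamma> i))"

lemma alternant_cong: "(\<And>i. i < b \<Longrightarrow> \<gamma> i = \<gamma>' i) \<Longrightarrow> alternant b d \<gamma> = alternant b d \<gamma>'"
  unfolding alternant_def by (intro ext fdet_cong) simp

lemma alternant_eq_0: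
  assumes "i \<noteq> j" "i < b" "j < b" "\<gamma> i = \<gamma> j"
  shows "alternant b d \<gamma> = 0"
  by (rule ext) (auto simp: alternant_def assms intro: fdet_identical_rows[of i j])

lemma alternant_reindex:
  assumes "\<sigma> permutes {0..<b}"
  shows "alternant b d \<gamma> (reindex \<sigma> z) = signof \<sigma> * alternant b d \<gamma> z"
proof -
  let ?u = "\<lambda>j i. coord_x z j ^ \<gamma> i * coord_y z j ^ (d - \<gamma> i)"
  have "alternant b d \<gamma> (reindex \<sigma> z) = fdet b (\<lambda>i j. ?u (\<sigma> j) i)"
    unfolding alternant_def using permutes_inj[OF assms] by simp
  also have "\<dots> = signof \<sigma> * fdet b ?u"
    by (subst fdet_transpose) (rule fdet_permute_rows[OF assms])
  also have "fdet b ?u = alternant b d \<gamma> z"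
    unfolding alternant_def by (rule fdet_transpose)
  finally show ?thesis .
qed

text \<open>The elementary symmetric function homogenized to degree 1 in each point, so that a
  product with it raises the degree \<open>d\<close> of an alternant by exactly one. It vanishes for
  \<open>r > b\<close>.\<close>

definition elem_sym :: "nat \<Rightarrow> nat \<Rightarrow> 'f::field config_fun" where
  "elem_sym b r z = (\<Sum>S | S \<subseteq> {0..<b} \<and> card S = r.
     \<Prod>t = 0..<b. if t \<in> S then coord_x z t else coord_y z t)"

text \<open>Pieri's rule before vanishing terms are dropped. In the Leibniz term of
  \<open>p\<close>, row \<open>i\<close> meets the point \<open>p i\<close>; so the sum over subsets
  of points is reindexed by \<open>p\<close> to a sum over subsets \<open>S\<close> of rows, and the
  factor of degree 1 raises precisely the exponents in \<open>S\<close>. The bound on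
  \<open>\<gamma>\<close> keeps the complementary exponents exact.\<close>

lemma elem_sym_mult_alternant:
  assumes "\<And>i. i < b \<Longrightarrow> \<gamma> i \<le> d"
  shows "elem_sym b r * alternant b d \<gamma> =
    (\<Sum>S | S \<subseteq> {0..<b} \<and> card S = r. alternant b (Suc d) (\<lambda>i. \<gamma> i + of_bool (i \<in> S)))"
proof
  fix z :: "'a config"
  let ?S = "{S. S \<subseteq> {0..<b} \<and> card S = r}" and ?P = "{p. p permutes {0..<b}}"
  let ?f = "\<lambda>S t. if t \<in> S then coord_x z t else coord_y z t"
  let ?u = "\<lambda>i j. coord_x z j ^ \<gamma> i * coord_y z j ^ (d - \<gamma> i)"
  have summand: "(\<Sum>S\<in>?S. (\<Prod>t = 0..<b. ?f S t)) * (\<Prod>i = 0..<b. ?u i (p i)) =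
      (\<Sum>S\<in>?S. \<Prod>i = 0..<b. coord_x z (p i) ^ (\<gamma> i + of_bool (i \<in> S)) *
        coord_y z (p i) ^ (Suc d - (\<gamma> i + of_bool (i \<in> S))))"
    if p: "p permutes {0..<b}" for p
  proof -
    have inj: "inj p" using permutes_inj[OF p] .
    have "(\<Sum>S\<in>?S. \<Prod>t = 0..<b. ?f S t) = (\<Sum>S\<in>?S. \<Prod>t = 0..<b. ?f (p ` S) t)"
    proof (rule sum.reindex_bij_witness[of _ "\<lambda>S. p ` S" "\<lambda>S. inv_into UNIV p ` S"], goal_cases)
      case (1 S)
      then show ?case using permutes_surj[OF p] by (simp add: image_image surj_f_inv_f)
    next
      case (2 S)
      have "inv_into UNIV p ` S \<subseteq> {0..<b}"
        using 2 permutes_image[OF permutes_inv[OF p]] by blast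
      then show ?case
        using 2 permutes_inj[OF permutes_inv[OF p]] by (simp add: card_image inj_on_subset)
    next
      case (3 S)
      then show ?case using inj by (simp add: image_image)
    next
      case (4 S)
      have "p ` S \<subseteq> {0..<b}"
        using 4 permutes_image[OF p] by blast
      then show ?case
        using 4 inj by (simp add: card_image inj_on_subset)
    next
      case (5 S)
      then show ?case using permutes_surj[OF p] by (simp add: image_image surj_f_inv_f)
    qed
    also have "\<dots> = (\<Sum>S\<in>?S. \<Prod>i = 0..<b. ?f (p ` S) (p i))"
      using prod.permute[OF p, of "?f (p ` S)" for S] by (simp add: o_def)
    finally have "(\<Sum>S\<in>?S. \<Prod>t = 0..<b. ?f S t) = \<dots>" .
    then have "(\<Sum>S\<in>?S. (\<Prod>t = 0..<b. ?f S t)) * (\<Prod>i = 0..<b. ?u i (p i)) =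
        (\<Sum>S\<in>?S. \<Prod>i = 0..<b. ?f (p ` S) (p i) * ?u i (p i))"
      by (simp add: sum_distrib_right prod.distrib)
    also have "\<dots> = (\<Sum>S\<in>?S. \<Prod>i = 0..<b. coord_x z (p i) ^ (\<gamma> i + of_bool (i \<in> S)) *
        coord_y z (p i) ^ (Suc d - (\<gamma> i + of_bool (i \<in> S))))"
      using assms inj by (intro sum.cong prod.cong refl) (auto simp: inj_image_mem_iff Suc_diff_le)
    finally show ?thesis .
  qed
  have "(elem_sym b r * alternant b d \<gamma>) z =
      (\<Sum>p\<in>?P. signof p * ((\<Sum>S\<in>?S. (\<Prod>t = 0..<b. ?f S t)) * (\<Prod>i = 0..<b. ?u i (p i))))"
    by (simp add: elem_sym_def alternant_def fdet_leibniz sum_distrib_left ac_simps)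
  also have "\<dots> = (\<Sum>p\<in>?P. signof p * (\<Sum>S\<in>?S. \<Prod>i = 0..<b. coord_x z (p i) ^ (\<gamma> i + of_bool (i \<in> S)) *
        coord_y z (p i) ^ (Suc d - (\<gamma> i + of_bool (i \<in> S)))))"
    using summand by (intro sum.cong) auto
  also have "\<dots> = (\<Sum>S\<in>?S. alternant b (Suc d) (\<lambda>i. \<gamma> i + of_bool (i \<in> S)) z)"
    unfolding alternant_def fdet_leibniz sum_distrib_left by (rule sum.swap)
  finally show "(elem_sym b r * alternant b d \<gamma>) z =
      (\<Sum>S\<in>?S. alternant b (Suc d) (\<lambda>i. \<gamma> i + of_bool (i \<in> S))) z"
    by (simp add: sum_fun_apply)
qed

section \<open>The Vandermonde determinant\<close>

definition vandermonde :: "nat \<Rightarrow> 'f::field config_fun" where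
  "vandermonde b z = (\<Prod>j = 0..<b. \<Prod>i = 0..<j. coord_y z i * coord_x z j - coord_x z i * coord_y z j)"

lemma vandermonde_nonzero [simp]: "vandermonde b z \<noteq> 0"
proof -
  have "coord_y z i * coord_x z j - coord_x z i * coord_y z j \<noteq> 0" if "i < j" for i j
    using points_independent[of i j z] that by (auto simp: mult.commute)
  then show ?thesis by (simp add: vandermonde_def)
qed

lemma vandermonde_move: "g \<in> SL2 \<Longrightarrow> vandermonde b (move g z) = vandermonde b z"
  by (simp add: vandermonde_def wedge_move)

text \<open>The product is a binary form of degree \<open>b\<close> in \<open>u\<close> and
  \<open>v\<close>. Only its top coefficient is recorded, for a later comparison of leading
  terms.\<close>

lemma linear_factors_expansion:
  fixes x y :: "nat \<Rightarrow> 'a::comm_ring_1"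
  shows "\<exists>D. (\<forall>u v. (\<Prod>i = 0..<b. y i * u - x i * v) = (\<Sum>j\<le>b. D j * (u ^ j * v ^ (b - j))))
    \<and> D b = (\<Prod>i = 0..<b. y i)"
proof (induction b)
  case 0
  show ?case by (intro exI[of _ "\<lambda>_. 1"]) simp
next
  case (Suc b)
  then obtain D where D: "\<And>u v. (\<Prod>i = 0..<b. y i * u - x i * v) = (\<Sum>j\<le>b. D j * (u ^ j * v ^ (b - j)))"
    and top: "D b = (\<Prod>i = 0..<b. y i)" by blast
  define D' where "D' j = (case j of 0 \<Rightarrow> 0 | Suc i \<Rightarrow> y b * D i) - (if j \<le> b then x b * D j else 0)" for j
  have "(\<Prod>i = 0..<Suc b. y i * u - x i * v) = (\<Sum>j\<le>Suc b. D' j * (u ^ j * v ^ (Suc b - j)))" for u v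
  proof -
    have "(\<Prod>i = 0..<Suc b. y i * u - x i * v) = (\<Sum>j\<le>b. D j * (u ^ j * v ^ (b - j))) * (y b * u - x b * v)"
      by (simp add: D)
    also have "\<dots> = (\<Sum>j\<le>b. y b * D j * (u ^ Suc j * v ^ (b - j))) - (\<Sum>j\<le>b. x b * D j * (u ^ j * v ^ (Suc b - j)))"
      by (subst right_diff_distrib) (simp add: sum_distrib_left Suc_diff_le ac_simps)
    also have "(\<Sum>j\<le>b. y b * D j * (u ^ Suc j * v ^ (b - j))) =
        (\<Sum>j\<le>Suc b. (case j of 0 \<Rightarrow> 0 | Suc i \<Rightarrow> y b * D i) * (u ^ j * v ^ (Suc b - j)))"
      by (subst sum.atMost_Suc_shift) simp
    also have "(\<Sum>j\<le>b. x b * D j * (u ^ j * v ^ (Suc b - j))) =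
        (\<Sum>j\<le>Suc b. (if j \<le> b then x b * D j else 0) * (u ^ j * v ^ (Suc b - j)))"
      by simp
    finally show ?thesis
      by (simp only: D'_def left_diff_distrib sum_subtractf)
  qed
  moreover have "D' (Suc b) = (\<Prod>i = 0..<Suc b. y i)"
    by (simp add: D'_def top mult.commute)
  ultimately show ?case by blast
qed

text \<open>In the induction step the last point is replaced by a free point. Both sides become
  binary forms of degree \<open>b\<close> in it that vanish at the first \<open>b\<close> points and
  agree in the leading coefficient. Their difference is therefore \<open>y\<close> times a form of
  degree \<open>b - 1\<close> with \<open>b\<close> zeros, hence zero.\<close>

lemma alternant_vandermonde: "alternant b (b - 1) (\<lambda>i. i) = vandermonde b"
proof
  fix z :: "'a config"
  show "alternant b (b - 1) (\<lambda>i. i) z = vandermonde b z"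
  proof (induction b)
    case 0
    then show ?case by (simp add: alternant_def fdet_leibniz vandermonde_def)
  next
    case (Suc b)
    let ?x = "coord_x z" and ?y = "coord_y z"
    define u where "u x y = (\<lambda>i j. if i < b then ?x i ^ j * ?y i ^ (b - j) else x ^ j * y ^ (b - j))" for x y
    define M where "M x y = mat (Suc b) (Suc b) (\<lambda>(i, j). u x y i j)" for x y
    \<comment> \<open>The cofactors of the last row do not involve that row, so they can be computed
      with the free point set to \<open>(0, 0)\<close>.\<close>
    define C where "C j = (-1) ^ (b + j) * det (mat_delete (M 0 0) b j)" for j
    have delete: "mat_delete (M x y) b j = mat_delete (M 0 0) b j" for x y j
      by (auto simp: mat_delete_def M_def u_def)
    have expand: "fdet (Suc b) (u x y) = (\<Sum>j<Suc b. C j * (x ^ j * y ^ (b - j)))" for x y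
      unfolding fdet_last_row
      by (intro sum.cong refl) (use delete[of x y] in \<open>auto simp: M_def u_def C_def\<close>)
    have roots: "fdet (Suc b) (u (?x i) (?y i)) = 0" if "i < b" for i
      by (rule fdet_identical_rows[of i b]) (use that in \<open>auto simp: u_def\<close>)
    have "C b = fdet b (u 0 0)"
      unfolding C_def M_def fdet_delete_last by (simp flip: power_add mult_2)
    also have "\<dots> = (\<Prod>i = 0..<b. ?y i) * fdet b (\<lambda>i j. ?x i ^ j * ?y i ^ (b - 1 - j))"
      unfolding fdet_leibniz sum_distrib_left
    proof (intro sum.cong refl)
      fix p assume "p \<in> {p. p permutes {0..<b}}"
      then have p: "p i < b" if "i < b" for i using permutes_lessD that by blast
      have "(\<Prod>i = 0..<b. u 0 0 i (p i)) = (\<Prod>i = 0..<b. ?y i * (?x i ^ p i * ?y i ^ (b - 1 - p i)))"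
      proof (intro prod.cong refl)
        fix i assume "i \<in> {0..<b}"
        then have "b - p i = Suc (b - 1 - p i)" using p[of i] by simp
        then show "u 0 0 i (p i) = ?y i * (?x i ^ p i * ?y i ^ (b - 1 - p i))"
          using \<open>i \<in> {0..<b}\<close> by (simp add: u_def ac_simps)
      qed
      then show "signof p * (\<Prod>i = 0..<b. u 0 0 i (p i)) =
          (\<Prod>i = 0..<b. ?y i) * (signof p * (\<Prod>i = 0..<b. ?x i ^ p i * ?y i ^ (b - 1 - p i)))"
        by (simp add: prod.distrib ac_simps)
    qed
    also have "fdet b (\<lambda>i j. ?x i ^ j * ?y i ^ (b - 1 - j)) = vandermonde b z"
      unfolding Suc.IH[symmetric] alternant_def by (rule fdet_transpose[symmetric])
    finally have C_top: "C b = (\<Prod>i = 0..<b. ?y i) * vandermonde b z" .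
    obtain D where D: "\<And>u v. (\<Prod>i = 0..<b. ?y i * u - ?x i * v) = (\<Sum>j\<le>b. D j * (u ^ j * v ^ (b - j)))"
      and D_top: "D b = (\<Prod>i = 0..<b. ?y i)"
      using linear_factors_expansion[where b = b and x = ?x and y = ?y] by blast
    define l where "l j = C j - vandermonde b z * D j" for j
    have l_expand: "(\<Sum>j<b. l j * (x ^ j * y ^ (b - j))) =
        fdet (Suc b) (u x y) - vandermonde b z * (\<Prod>i = 0..<b. ?y i * x - ?x i * y)" for x y
    proof -
      have "(\<Sum>j<b. l j * (x ^ j * y ^ (b - j))) = (\<Sum>j<Suc b. l j * (x ^ j * y ^ (b - j)))"
        by (simp add: l_def C_top D_top)
      then show ?thesis
        unfolding D expand l_def
        by (simp only: left_diff_distrib sum_subtractf sum_distrib_left lessThan_Suc_atMost mult.assoc)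
    qed
    have l0: "l j = 0" if "j < b" for j
    proof (rule form_eq_0[OF _ that])
      fix i assume "i < b"
      then have "(\<Sum>j<b. l j * (?x i ^ j * ?y i ^ (b - j))) = 0"
      proof -
        have "(\<Prod>k = 0..<b. ?y k * ?x i - ?x k * ?y i) = 0"
          using \<open>i < b\<close> by (intro prod_zero) (auto intro!: bexI[of _ i])
        then show ?thesis unfolding l_expand using roots[OF \<open>i < b\<close>] by simp
      qed
      \<comment> \<open>The top coefficients have cancelled, so a factor \<open>y\<close> splits off
        and the degree drops to the one that \<open>form_eq_0\<close> requires.\<close>
      moreover have "(\<Sum>j<b. l j * (?x i ^ j * ?y i ^ (b - j))) =
          ?y i * (\<Sum>j<b. l j * (?x i ^ j * ?y i ^ (b - 1 - j)))"
        unfolding sum_distrib_left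
      proof (intro sum.cong refl)
        fix j assume "j \<in> {..<b}"
        then have "b - j = Suc (b - 1 - j)" by auto
        then show "l j * (?x i ^ j * ?y i ^ (b - j)) = ?y i * (l j * (?x i ^ j * ?y i ^ (b - 1 - j)))"
          by (simp add: ac_simps)
      qed
      ultimately show "(\<Sum>j<b. l j * (?x i ^ j * ?y i ^ (b - 1 - j))) = 0" by simp
    qed
    have "alternant (Suc b) (Suc b - 1) (\<lambda>i. i) z = fdet (Suc b) (\<lambda>i j. ?x i ^ j * ?y i ^ (b - j))"
      unfolding alternant_def by (subst fdet_transpose) simp
    also have "\<dots> = fdet (Suc b) (u (?x b) (?y b))"
      by (rule fdet_cong) (auto simp: u_def less_Suc_eq)
    also have "\<dots> = vandermonde b z * (\<Prod>i = 0..<b. ?y i * ?x b - ?x i * ?y b)"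
      using l_expand[of "?x b" "?y b"] l0 by simp
    finally show ?case by (simp add: vandermonde_def)
  qed
qed

section \<open>Symmetric functions as quotients of alternants\<close>

definition strict_exponents :: "nat \<Rightarrow> nat \<Rightarrow> nat list set" where
  "strict_exponents b n = {\<gamma>. length \<gamma> = b \<and> sorted_wrt (<) \<gamma> \<and> set \<gamma> \<subseteq> {0..<n}}"

lemma strict_exponents_image: "strict_exponents b n = sorted_list_of_set ` {S. S \<subseteq> {0..<n} \<and> card S = b}"
proof (intro equalityI subsetI)
  fix \<gamma> assume "\<gamma> \<in> strict_exponents b n"
  then show "\<gamma> \<in> sorted_list_of_set ` {S. S \<subseteq> {0..<n} \<and> card S = b}"
    by (intro image_eqI[of _ _ "set \<gamma>"])
      (auto simp: strict_exponents_def strict_sorted_iff distinct_card sorted_list_of_set.idem_if_sorted_distinct)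
next
  fix \<gamma> assume "\<gamma> \<in> sorted_list_of_set ` {S. S \<subseteq> {0..<n} \<and> card S = b}"
  then obtain S where S: "S \<subseteq> {0..<n}" "card S = b" "\<gamma> = sorted_list_of_set S" by blast
  moreover have "finite S" using S(1) finite_subset by blast
  ultimately show "\<gamma> \<in> strict_exponents b n"
    by (simp add: strict_exponents_def)
qed

lemma finite_strict_exponents [simp]: "finite (strict_exponents b n)"
  unfolding strict_exponents_image by simp

lemma card_strict_exponents: "card (strict_exponents b n) = n choose b"
proof -
  have "inj_on sorted_list_of_set {S. S \<subseteq> {0..<n} \<and> card S = b}"
    by (rule inj_on_subset[OF inj_on_inverseI[of "{S. finite S}" set]]) (auto intro: finite_subset)
  then show ?thesis
    unfolding strict_exponents_image by (simp add: card_image n_subsets)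
qed

lemma strict_exponents_nth:
  assumes "\<gamma> \<in> strict_exponents b n"
  shows "i < b \<Longrightarrow> \<gamma> ! i < n" "i < j \<Longrightarrow> j < b \<Longrightarrow> \<gamma> ! i < \<gamma> ! j" "length \<gamma> = b"
  using assms nth_mem[of i \<gamma>] by (auto simp: strict_exponents_def sorted_wrt_iff_nth_less simp del: nth_mem)

lemma strict_growth:
  fixes \<gamma> :: "nat \<Rightarrow> nat"
  assumes "\<And>i j. i < j \<Longrightarrow> j < b \<Longrightarrow> \<gamma> i < \<gamma> j" "i \<le> j" "j < b"
  shows "\<gamma> i + (j - i) \<le> \<gamma> j"
  using assms(2,3)
proof (induction j rule: dec_induct)
  case (step j)
  then show ?case using assms(1)[of j "Suc j"] by simp
qed simp

lemma funs_span_mult: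
  assumes "f \<in> funs.span A" "\<And>g. g \<in> A \<Longrightarrow> h * g \<in> funs.span B"
  shows "h * f \<in> funs.span B"
proof -
  have "funs.subspace {f. h * f \<in> funs.span B}"
    by (rule funs.subspaceI)
      (simp_all add: distrib_left funs.span_zero funs.span_add funs.span_scale flip: fun_scale_mult(2))
  with assms(2) have "funs.span A \<subseteq> {f. h * f \<in> funs.span B}"
    by (intro funs.span_minimal) auto
  with assms(1) show ?thesis by blast
qed

text \<open>The power of a set consists of products of its elements, so the generators are the
  \<open>l\<close>-fold products. The span is the space of symmetric forms over the base field that
  have degree \<open>l\<close> in each of the \<open>b\<close> points.\<close>

definition elem_sym_span :: "nat \<Rightarrow> nat \<Rightarrow> ('f::field config_fun) set" where
  "elem_sym_span b l = funs.span (range (elem_sym b) ^ l)"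

abbreviation alternants :: "nat \<Rightarrow> nat \<Rightarrow> 'f::field config_fun set" where
  "alternants b l \<equiv> {alternant b (b + l - 1) \<gamma> | \<gamma>. \<forall>i<b. \<gamma> i < b + l}"

text \<open>
  By the Pieri rule, the alternant with exponents \<open>\<gamma>\<close> is one of the terms of an elementary symmetric
  function times the alternant obtained by lowering all \<open>\<gamma> i > i\<close> by one. The other non-zero terms
  have fewer fixed points \<open>\<gamma> i = i\<close>.
\<close>

lemma alternant_in_vandermonde_multiples:
  assumes "b \<ge> 1" "\<And>i j. i < j \<Longrightarrow> j < b \<Longrightarrow> \<gamma> i < \<gamma> j" "\<And>i. i < b \<Longrightarrow> \<gamma> i < b + l"
  shows "(alternant b (b + l - 1) \<gamma> :: 'f::field config_fun) \<in> (*) (vandermonde b) ` elem_sym_span b l"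
  using assms(2,3)
proof (induction l arbitrary: \<gamma>)
  case 0
  \<comment> \<open>For \<open>l = 0\<close> there are only \<open>b\<close> possible exponents, so
    strictness leaves no choice.\<close>
  have "\<gamma> i = i" if "i < b" for i
  proof -
    have "i \<le> b - 1" "b - 1 < b" using that by auto
    then have "\<gamma> i + (b - 1 - i) \<le> \<gamma> (b - 1)" "\<gamma> (b - 1) < b" "\<gamma> 0 + (i - 0) \<le> \<gamma> i"
      using 0(2)[of "b - 1"] strict_growth[of b \<gamma> i "b - 1", OF 0(1)] strict_growth[of b \<gamma> 0 i, OF 0(1)] that by simp_all
    then show ?thesis using \<open>i \<le> b - 1\<close> by linarith
  qed
  then have "alternant b (b + 0 - 1) \<gamma> = alternant b (b - 1) (\<lambda>i. i)"
    using alternant_cong[of b \<gamma> "\<lambda>i. i"] by simp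
  also have "\<dots> = vandermonde b * 1"
    by (simp only: alternant_vandermonde mult_1_right)
  finally have eq: "alternant b (b + 0 - 1) \<gamma> = vandermonde b * 1" .
  show ?case
    unfolding eq elem_sym_span_def
    by (intro imageI funs.span_base) (simp only: power_0 set_one singleton_iff)
next
  case (Suc l)
  let ?W = "(*) (vandermonde b) ` elem_sym_span b (Suc l) :: 'f config_fun set"
  have subspace: "funs.subspace ?W"
  proof (rule funs.subspaceI)
    show "0 \<in> ?W" by (auto simp: elem_sym_span_def intro!: image_eqI[of _ _ 0] funs.span_zero)
    show "f + g \<in> ?W" if "f \<in> ?W" "g \<in> ?W" for f g
      using that by (auto simp: elem_sym_span_def simp flip: distrib_left intro!: funs.span_add)
    show "fun_scale c f \<in> ?W" if "f \<in> ?W" for c f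
      using that by (auto simp: elem_sym_span_def fun_scale_mult(2) intro!: funs.span_scale)
  qed
  show ?case
    using Suc.prems
  proof (induction "card {i. i < b \<and> \<gamma> i = i}" arbitrary: \<gamma> rule: less_induct)
    case less
    define A where "A = {i. i < b \<and> i < \<gamma> i}"
    define \<gamma>' where "\<gamma>' i = \<gamma> i - of_bool (i \<in> A)" for i
    let ?S = "{S. S \<subseteq> {0..<b} \<and> card S = card A}"
    define \<gamma>S where "\<gamma>S S = (\<lambda>i. \<gamma>' i + of_bool (i \<in> S))" for S
    have ge: "i \<le> \<gamma> i" if "i < b" for i
      using strict_growth[of b \<gamma> 0 i] less.prems that by simp
    \<comment> \<open>A lowered exponent stays at least its index. So the order is kept even if only
      the later of two exponents is lowered, as the earlier one then equals its own index.\<close>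
    have strict': "\<gamma>' i < \<gamma>' j" if "i < j" "j < b" for i j
    proof -
      have "\<gamma> i < \<gamma> j" "i \<le> \<gamma> i" "j \<le> \<gamma> j" using less.prems(1) ge that by auto
      then show ?thesis using that by (auto simp: \<gamma>'_def A_def)
    qed
    have bound': "\<gamma>' i < b + l" if "i < b" for i
      using less.prems(2)[OF that] that by (auto simp: \<gamma>'_def A_def)
    have "(alternant b (b + l - 1) \<gamma>' :: 'f config_fun) \<in> (*) (vandermonde b) ` elem_sym_span b l"
      by (rule Suc.IH) (use strict' bound' in auto)
    then obtain h :: "'f config_fun" where h: "h \<in> elem_sym_span b l" "alternant b (b + l - 1) \<gamma>' = vandermonde b * h"
      by blast
    have "elem_sym b (card A) * h \<in> elem_sym_span b (Suc l)"
      using h(1) unfolding elem_sym_span_def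
      by (rule funs_span_mult) (auto intro!: funs.span_base set_times_intro)
    then have prod: "elem_sym b (card A) * (alternant b (b + l - 1) \<gamma>' :: 'f config_fun) \<in> ?W"
      unfolding h(2) mult.left_commute[of "elem_sym b (card A)"] by (rule imageI)
    have suc: "Suc (b + l - 1) = b + Suc l - 1" using assms(1) by simp
    have pieri: "elem_sym b (card A) * (alternant b (b + l - 1) \<gamma>' :: 'f config_fun) = (\<Sum>S\<in>?S. alternant b (b + Suc l - 1) (\<gamma>S S))"
    proof -
      have "\<gamma>' i \<le> b + l - 1" if "i < b" for i using bound'[OF that] by simp
      from elem_sym_mult_alternant[where \<gamma> = \<gamma>', OF this] show ?thesis
        unfolding \<gamma>S_def suc .
    qed
    have A_mem: "A \<in> ?S" by (auto simp: A_def)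
    have fin: "finite ?S" by simp
    have "\<gamma>S A i = \<gamma> i" for i
      by (auto simp: \<gamma>S_def \<gamma>'_def A_def)
    then have \<gamma>SA: "\<gamma>S A = \<gamma>" by auto
    have others: "(alternant b (b + Suc l - 1) (\<gamma>S S) :: 'f config_fun) \<in> ?W" if S: "S \<in> ?S - {A}" for S
    proof (cases "\<exists>i j. i < j \<and> j < b \<and> \<gamma>S S i = \<gamma>S S j")
      case True
      then obtain i j where "i < j" "j < b" "\<gamma>S S i = \<gamma>S S j" by blast
      then have "(alternant b (b + Suc l - 1) (\<gamma>S S) :: 'f config_fun) = 0"
        by (intro alternant_eq_0[of i j]) auto
      then show ?thesis using funs.subspace_0[OF subspace] by simp
    next
      case False
      have strictS: "\<gamma>S S i < \<gamma>S S j" if "i < j" "j < b" for i j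
      proof -
        have "\<gamma>S S i \<le> \<gamma>S S j" using strict'[OF that] by (auto simp: \<gamma>S_def)
        moreover have "\<gamma>S S i \<noteq> \<gamma>S S j" using False that by blast
        ultimately show ?thesis by simp
      qed
      have boundS: "\<gamma>S S i < b + Suc l" if "i < b" for i
        using bound'[OF that] by (auto simp: \<gamma>S_def)
      have "finite A" by (simp add: A_def)
      have "finite S" "card S = card A" "S \<noteq> A"
        using S finite_subset[of S "{0..<b}"] by auto
      \<comment> \<open>As \<open>S\<close> and \<open>A\<close> have equal size, \<open>S\<close>
        raises an exponent at some fixed point \<open>s\<close>. Strictness pushes all later
        exponents above their indices, while the indices before \<open>s\<close> were fixed points
        already. So the set of fixed points shrinks and loses \<open>s\<close>.\<close>
      then have "\<not> S \<subseteq> A" using \<open>finite A\<close> card_subset_eq by blast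
      then obtain s where s: "s \<in> S" "s \<notin> A" by blast
      then have "s < b" using S by auto
      then have s_fix: "\<gamma> s = s" using s(2) ge[of s] by (simp add: A_def)
      then have s_up: "\<gamma>S S s > s" using s by (simp add: \<gamma>S_def \<gamma>'_def)
      have "i < s" if "i < b" "\<gamma>S S i = i" for i
      proof (rule ccontr)
        assume "\<not> i < s"
        then have "\<gamma>S S s + (i - s) \<le> \<gamma>S S i"
          by (intro strict_growth[of b "\<gamma>S S"]) (use strictS that in auto)
        then show False using s_up that \<open>\<not> i < s\<close> by simp
      qed
      moreover have "\<gamma> i = i" if "i < s" for i
        using strict_growth[of b \<gamma> i s] less.prems(1) that \<open>s < b\<close> s_fix ge[of i] by simp
      ultimately have "{i. i < b \<and> \<gamma>S S i = i} \<subseteq> {i. i < b \<and> \<gamma> i = i} - {s}"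
        by auto
      then have "{i. i < b \<and> \<gamma>S S i = i} \<subset> {i. i < b \<and> \<gamma> i = i}"
        using s_fix \<open>s < b\<close> by auto
      then have "card {i. i < b \<and> \<gamma>S S i = i} < card {i. i < b \<and> \<gamma> i = i}"
        by (intro psubset_card_mono) auto
      then show ?thesis
        by (rule less.hyps) (use strictS boundS in auto)
    qed
    have eq: "(alternant b (b + Suc l - 1) \<gamma> :: 'f config_fun) = elem_sym b (card A) * alternant b (b + l - 1) \<gamma>'
        - (\<Sum>S\<in>?S - {A}. alternant b (b + Suc l - 1) (\<gamma>S S))"
      unfolding pieri by (subst sum.remove[OF fin A_mem]) (simp add: \<gamma>SA)
    show ?case
      unfolding eq by (intro funs.subspace_diff[OF subspace prod] funs.subspace_sum[OF subspace] others)
  qed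
qed

lemma vandermonde_mult_elem_sym_span:
  assumes "b \<ge> 1" "h \<in> elem_sym_span b l"
  shows "vandermonde b * h \<in> funs.span (alternants b l)"
  using assms(2) unfolding elem_sym_span_def
proof (rule funs_span_mult)
  fix g assume "g \<in> range (elem_sym b) ^ l"
  then show "vandermonde b * g \<in> funs.span (alternants b l)"
  proof (induction l arbitrary: g)
    case 0
    then have "vandermonde b * g = alternant b (b - 1) (\<lambda>i. i)"
      by (simp add: alternant_vandermonde[unfolded One_nat_def])
    moreover have "alternant b (b + 0 - 1) (\<lambda>i. i) \<in> alternants b 0"
      by (rule CollectI, rule exI[of _ "\<lambda>i. i"]) simp
    ultimately show "vandermonde b * g \<in> funs.span (alternants b 0)"
      by (auto simp only: add_0_right intro: funs.span_base)
  next
    case (Suc l)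
    then obtain r f where f: "g = elem_sym b r * f" "f \<in> range (elem_sym b) ^ l"
      by (auto elim!: set_times_elim)
    have "elem_sym b r * (vandermonde b * f) \<in> funs.span (alternants b (Suc l))"
      using Suc.IH[OF f(2)]
    proof (rule funs_span_mult)
      fix a assume "a \<in> alternants b l"
      then obtain \<gamma> where a: "a = alternant b (b + l - 1) \<gamma>" "\<And>i. i < b \<Longrightarrow> \<gamma> i < b + l" by auto
      have "elem_sym b r * a = (\<Sum>S | S \<subseteq> {0..<b} \<and> card S = r.
          alternant b (Suc (b + l - 1)) (\<lambda>i. \<gamma> i + of_bool (i \<in> S)))"
        unfolding a(1)
      proof (rule elem_sym_mult_alternant)
        show "\<gamma> i \<le> b + l - 1" if "i < b" for i using a(2)[OF that] by simp
      qed
      also have "Suc (b + l - 1) = b + Suc l - 1" using assms(1) by simp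
      also have "(\<Sum>S | S \<subseteq> {0..<b} \<and> card S = r. alternant b (b + Suc l - 1) (\<lambda>i. \<gamma> i + of_bool (i \<in> S)))
          \<in> funs.span (alternants b (Suc l))"
      proof (intro funs.span_sum funs.span_base)
        fix S
        have "\<gamma> i + of_bool (i \<in> S) < b + Suc l" if "i < b" for i
          using a(2)[OF that] by simp
        then show "alternant b (b + Suc l - 1) (\<lambda>i. \<gamma> i + of_bool (i \<in> S)) \<in>
            alternants b (Suc l)"
          by blast
      qed
      finally show "elem_sym b r * a \<in> funs.span (alternants b (Suc l))" .
    qed
    then show "vandermonde b * g \<in> funs.span (alternants b (Suc l))"
      by (simp only: f(1) mult.left_commute)
  qed
qed

section \<open>Linear independence of alternants\<close>

lemma sum_mult_of_bool:
  fixes f :: "'b \<Rightarrow> 'a::comm_ring_1"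
  assumes "finite A"
  shows "(\<Sum>q\<in>A. f q * of_bool (q = x)) = (if x \<in> A then f x else 0)"
proof -
  have "(\<Sum>q\<in>A. f q * of_bool (q = x)) = (\<Sum>q\<in>A. if q = x then f q else 0)"
    by (intro sum.cong) auto
  then show ?thesis using assms by simp
qed

text \<open>The minors attached to increasing exponents are dual to the wedges of unit vectors:
  equal lists give the identity matrix, and for different ones some unit row has no matching
  column.\<close>

lemma fdet_unit_rows:
  assumes "\<gamma> \<in> strict_exponents b n" "\<gamma>' \<in> strict_exponents b n"
  shows "fdet b (\<lambda>t s. of_bool (\<gamma>' ! t = \<gamma> ! s)) = (of_bool (\<gamma> = \<gamma>') :: 'a::comm_ring_1)"
proof (cases "\<gamma> = \<gamma>'")
  case True
  have dist: "distinct \<gamma>" and len: "length \<gamma> = b"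
    using assms(1) by (auto simp: strict_exponents_def strict_sorted_iff)
  have "fdet b (\<lambda>t s. of_bool (\<gamma>' ! t = \<gamma> ! s)) = det (1\<^sub>m b :: 'a mat)"
    unfolding fdet_def using dist len True
    by (intro arg_cong[where f = det] eq_matI) (auto simp: nth_eq_iff_index_eq)
  then show ?thesis using True by simp
next
  case False
  have "\<not> set \<gamma>' \<subseteq> set \<gamma>"
  proof
    assume sub: "set \<gamma>' \<subseteq> set \<gamma>"
    have "card (set \<gamma>') = card (set \<gamma>)"
      using assms by (simp add: strict_exponents_def strict_sorted_iff distinct_card)
    then have "set \<gamma>' = set \<gamma>" using sub by (simp add: card_subset_eq)
    then have "\<gamma>' = \<gamma>" using assms
      by (auto simp: strict_exponents_def strict_sorted_equal)
    then show False using False by simp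
  qed
  then obtain t where t: "t < length \<gamma>'" "\<gamma>' ! t \<notin> set \<gamma>"
    by (metis in_set_conv_nth subsetI)
  have "fdet b (\<lambda>t s. of_bool (\<gamma>' ! t = \<gamma> ! s)) = (0 :: 'a)"
  proof (rule fdet_zero_row)
    show "t < b" using t assms(2) by (simp add: strict_exponents_def)
    show "of_bool (\<gamma>' ! t = \<gamma> ! j) = (0 :: 'a)" if "j < b" for j
    proof -
      have "\<gamma> ! j \<in> set \<gamma>" using that assms(1) by (simp add: strict_exponents_def)
      then show ?thesis using t(2) by auto
    qed
  qed
  then show ?thesis using False by simp
qed

text \<open>A choice of distinct points thus becomes a renumbering of all points, to which
  statements about \<open>reindex\<close> apply.\<close>

lemma extend_to_permutation:
  fixes f :: "nat \<Rightarrow> nat"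
  assumes "inj_on f {0..<b}" "f ` {0..<b} \<subseteq> {0..<n}"
  obtains p where "p permutes {0..<n}" "\<And>t. t < b \<Longrightarrow> p t = f t"
proof -
  have bn: "b \<le> n"
    using card_inj_on_le[OF assms finite_atLeastLessThan] by simp
  have "card ({0..<n} - {0..<b}) = card ({0..<n} - f ` {0..<b})"
    using assms bn by (simp add: card_Diff_subset card_image)
  then obtain g where g: "bij_betw g ({0..<n} - {0..<b}) ({0..<n} - f ` {0..<b})"
    using finite_same_card_bij by blast
  define p where "p t = (if t < b then f t else if t < n then g t else t)" for t
  have "bij_betw p ({0..<b} \<union> ({0..<n} - {0..<b})) (f ` {0..<b} \<union> ({0..<n} - f ` {0..<b}))"
  proof (rule bij_betw_combine)
    show "bij_betw p {0..<b} (f ` {0..<b})"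
      using assms(1) by (auto simp: bij_betw_def p_def inj_on_def)
    show "bij_betw p ({0..<n} - {0..<b}) ({0..<n} - f ` {0..<b})"
      using g by (rule bij_betw_cong[THEN iffD1, rotated]) (auto simp: p_def)
  qed auto
  moreover have "{0..<b} \<union> ({0..<n} - {0..<b}) = {0..<n}" "f ` {0..<b} \<union> ({0..<n} - f ` {0..<b}) = {0..<n}"
    using bn assms(2) by auto
  ultimately have "p permutes {0..<n}"
    by (intro bij_imp_permutes) (auto simp: p_def)
  then show thesis by (rule that) (simp add: p_def)
qed

text \<open>
  The vanishing of the sum at all permutations of a configuration says that an alternating form
  vanishes on all tuples of the \<open>n\<close> vectors of monomials of degree \<open>n - 1\<close> at its points. As these
  vectors span, the form vanishes.
\<close>

lemma alternants_independent:
  fixes c :: "nat list \<Rightarrow> 'f::field config_fun"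
  assumes eq0: "\<And>z. (\<Sum>\<gamma>\<in>strict_exponents b n. c \<gamma> z * alternant b (n - 1) ((!) \<gamma>) z) = 0"
    and inv: "\<And>p z. p permutes {0..<n} \<Longrightarrow>
      \<exists>\<epsilon>. \<epsilon> \<noteq> 0 \<and> (\<forall>\<gamma>\<in>strict_exponents b n. c \<gamma> (reindex p z) = \<epsilon> * c \<gamma> z)"
    and \<gamma>0: "\<gamma>0 \<in> strict_exponents b n"
  shows "c \<gamma>0 z = 0"
proof -
  let ?I = "strict_exponents b n"
  define V where "V i j = coord_x z i ^ j * coord_y z i ^ (n - 1 - j)" for i j
  \<comment> \<open>For fixed \<open>z\<close> the coefficients are scalars, and \<open>G\<close> is
    an alternating form in \<open>b\<close> freely chosen rows.\<close>
  define G where "G u = (\<Sum>\<gamma>\<in>?I. c \<gamma> z * fdet b (\<lambda>t s. u t (\<gamma> ! s)))" for u :: "nat \<Rightarrow> nat \<Rightarrow> 'f poly fract"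
  have G_alternant: "c \<gamma> z * fdet b (\<lambda>t s. V (p t) (\<gamma> ! s)) = c \<gamma> z * alternant b (n - 1) ((!) \<gamma>) (reindex p z)"
    if "p permutes {0..<n}" for p \<gamma>
    unfolding alternant_def V_def coord_reindex[OF permutes_inj[OF that]]
    by (subst fdet_transpose[symmetric]) (rule refl)
  have base: "G (\<lambda>t. V (f t)) = 0" if f: "f ` {0..<b} \<subseteq> {0..<n}" for f
  proof (cases "inj_on f {0..<b}")
    case True
    then obtain p where p: "p permutes {0..<n}" "\<And>t. t < b \<Longrightarrow> p t = f t"
      using f by (rule extend_to_permutation) blast
    from inv[OF p(1), of z] obtain \<epsilon> where \<epsilon>: "\<epsilon> \<noteq> 0" "\<And>\<gamma>. \<gamma> \<in> ?I \<Longrightarrow> c \<gamma> (reindex p z) = \<epsilon> * c \<gamma> z"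
      by blast
    \<comment> \<open>The coefficients at the permuted configuration are those at \<open>z\<close>
      up to the common factor \<open>\<epsilon>\<close>; so the vanishing of the sum there is a
      statement about \<open>G\<close>, which is built at \<open>z\<close>.\<close>
    have "\<epsilon> * G (\<lambda>t. V (f t)) = (\<Sum>\<gamma>\<in>?I. \<epsilon> * c \<gamma> z * alternant b (n - 1) ((!) \<gamma>) (reindex p z))"
      unfolding G_def sum_distrib_left
    proof (intro sum.cong refl)
      fix \<gamma>
      have "fdet b (\<lambda>t s. V (f t) (\<gamma> ! s)) = fdet b (\<lambda>t s. V (p t) (\<gamma> ! s))"
        by (rule fdet_cong) (simp add: p(2))
      then show "\<epsilon> * (c \<gamma> z * fdet b (\<lambda>t s. V (f t) (\<gamma> ! s))) =
          \<epsilon> * c \<gamma> z * alternant b (n - 1) ((!) \<gamma>) (reindex p z)"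
        using G_alternant[OF p(1), of \<gamma>] by (simp only: mult.assoc)
    qed
    also have "\<dots> = (\<Sum>\<gamma>\<in>?I. c \<gamma> (reindex p z) * alternant b (n - 1) ((!) \<gamma>) (reindex p z))"
      by (intro sum.cong refl) (simp only: \<epsilon>(2))
    also have "\<dots> = 0" by (rule eq0)
    finally show ?thesis using \<epsilon>(1) by simp
  next
    case False
    then obtain i j where ij: "i < b" "j < b" "i \<noteq> j" "f i = f j" by (auto simp: inj_on_def)
    have "fdet b (\<lambda>t s. V (f t) (\<gamma> ! s)) = 0" for \<gamma>
      by (rule fdet_identical_rows[of i j]) (use ij in auto)
    then show ?thesis by (simp add: G_def)
  qed
  \<comment> \<open>The rows are exchanged one by one for the unit vectors of
    \<open>\<gamma>0\<close>. As a function of row \<open>m\<close> alone, \<open>G\<close> is a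
    linear form that vanishes at the monomial vectors of \<open>n\<close> points, so its
    coefficients vanish by \<open>form_eq_0\<close>. The choice \<open>f\<close> stays arbitrary so
    that row \<open>m\<close> may run through all these points.\<close>
  have step: "G (\<lambda>t. if t < m then (\<lambda>j. of_bool (\<gamma>0 ! t = j)) else V (f t)) = 0"
    if "m \<le> b" "f ` {0..<b} \<subseteq> {0..<n}" for m f
    using that
  proof (induction m arbitrary: f)
    case 0
    then show ?case using base by simp
  next
    case (Suc m)
    define u where "u t = (if t < m then (\<lambda>j. of_bool (\<gamma>0 ! t = j)) else V (f t))" for t
    define l where "l q = G (u(m := (\<lambda>j. of_bool (q = j))))" for q
    have linear: "G (u(m := v)) = (\<Sum>q<n. l q * v q)" for v
    proof -
      have "G (u(m := v)) = (\<Sum>\<gamma>\<in>?I. c \<gamma> z * (\<Sum>q<n. v q *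
          fdet b (\<lambda>t s. (u(m := (\<lambda>j. of_bool (q = j)))) t (\<gamma> ! s))))"
        unfolding G_def
      proof (intro sum.cong refl arg_cong2[where f = "(*)"])
        fix \<gamma> assume \<gamma>: "\<gamma> \<in> ?I"
        let ?u = "\<lambda>t s. u t (\<gamma> ! s)"
        have "fdet b (\<lambda>t s. (u(m := v)) t (\<gamma> ! s)) = fdet b (?u(m := (\<lambda>s. \<Sum>q<n. v q * of_bool (q = \<gamma> ! s))))"
        proof (rule fdet_cong)
          fix i j assume "i < b" "j < b"
          then have "\<gamma> ! j < n" using strict_exponents_nth(1)[OF \<gamma>] by simp
          then have "v (\<gamma> ! j) = (\<Sum>q<n. v q * of_bool (q = \<gamma> ! j))"
            by (simp add: sum_mult_of_bool)
          then show "(u(m := v)) i (\<gamma> ! j) = (?u(m := (\<lambda>s. \<Sum>q<n. v q * of_bool (q = \<gamma> ! s)))) i j"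
            by (cases "i = m") (simp_all only: fun_upd_same fun_upd_other not_False_eq_True)
        qed
        also have "\<dots> = (\<Sum>q<n. v q * fdet b (?u(m := (\<lambda>s. of_bool (q = \<gamma> ! s)))))"
          by (rule fdet_row_sum) (use Suc.prems in simp)
        also have "\<dots> = (\<Sum>q<n. v q * fdet b (\<lambda>t s. (u(m := (\<lambda>j. of_bool (q = j)))) t (\<gamma> ! s)))"
          by (intro sum.cong refl arg_cong2[where f = "(*)"] fdet_cong) auto
        finally show "fdet b (\<lambda>t s. (u(m := v)) t (\<gamma> ! s)) = \<dots>" .
      qed
      also have "\<dots> = (\<Sum>q<n. l q * v q)"
        unfolding l_def G_def sum_distrib_left sum_distrib_right
        by (subst sum.swap) (simp add: ac_simps)
      finally show ?thesis .
    qed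
    have zero: "(\<Sum>q<n. l q * (coord_x z i ^ q * coord_y z i ^ (n - 1 - q))) = 0" if "i < n" for i
    proof -
      have "G (\<lambda>t. if t < m then (\<lambda>j. of_bool (\<gamma>0 ! t = j)) else V ((f(m := i)) t)) = 0"
        by (rule Suc.IH) (use Suc.prems that in auto)
      moreover have "(\<lambda>t. if t < m then (\<lambda>j. of_bool (\<gamma>0 ! t = j)) else V ((f(m := i)) t)) = u(m := V i)"
        by (auto simp: u_def)
      ultimately show ?thesis
        using linear[of "V i"] by (simp add: V_def)
    qed
    have "l (\<gamma>0 ! m) = 0"
      by (rule form_eq_0[OF zero]) (use strict_exponents_nth(1)[OF \<gamma>0] Suc.prems in auto)
    moreover have "u(m := (\<lambda>j. of_bool (\<gamma>0 ! m = j))) =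
        (\<lambda>t. if t < Suc m then (\<lambda>j. of_bool (\<gamma>0 ! t = j)) else V (f t))"
      by (auto simp: u_def less_Suc_eq)
    ultimately show ?case by (simp add: l_def)
  qed
  have "b \<le> n"
  proof -
    have "b = card (set \<gamma>0)" "set \<gamma>0 \<subseteq> {0..<n}"
      using \<gamma>0 by (auto simp: strict_exponents_def strict_sorted_iff distinct_card)
    then show ?thesis using card_mono[of "{0..<n}" "set \<gamma>0"] by simp
  qed
  then have "G (\<lambda>t. if t < b then (\<lambda>j. of_bool (\<gamma>0 ! t = j)) else V (id t)) = 0"
    by (intro step) auto
  moreover have "G (\<lambda>t. if t < b then (\<lambda>j. of_bool (\<gamma>0 ! t = j)) else V (id t)) =
      (\<Sum>\<gamma>\<in>?I. c \<gamma> z * of_bool (\<gamma> = \<gamma>0))"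
    unfolding G_def
  proof (intro sum.cong refl arg_cong2[where f = "(*)"])
    fix \<gamma> assume "\<gamma> \<in> ?I"
    have "fdet b (\<lambda>t s. (if t < b then (\<lambda>j. of_bool (\<gamma>0 ! t = j)) else V (id t)) (\<gamma> ! s)) =
        fdet b (\<lambda>t s. of_bool (\<gamma>0 ! t = \<gamma> ! s) :: 'f poly fract)"
      by (rule fdet_cong) simp
    also have "\<dots> = of_bool (\<gamma> = \<gamma>0)"
      by (rule fdet_unit_rows[OF \<open>\<gamma> \<in> ?I\<close> \<gamma>0])
    finally show "fdet b (\<lambda>t s. (if t < b then (\<lambda>j. of_bool (\<gamma>0 ! t = j)) else V (id t)) (\<gamma> ! s)) = of_bool (\<gamma> = \<gamma>0)" .
  qed
  ultimately show ?thesis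
    using \<gamma>0 by (simp add: sum_mult_of_bool)
qed

text \<open>
  The order of the factors makes all alternants after \<open>(a, b)\<close> semi-invariant in the first \<open>a\<close> points.
\<close>

lemma alternant_chain_independent:
  fixes c :: "nat list list \<Rightarrow> 'f::field poly fract"
  assumes "\<And>z :: 'f config. (\<Sum>\<Gamma>\<in>listset (map (\<lambda>(a, b). strict_exponents b a) L).
      c \<Gamma> * (\<Prod>r<length L. alternant (snd (L ! r)) (fst (L ! r) - 1) ((!) (\<Gamma> ! r)) z)) = 0"
    and "sorted_wrt (\<lambda>(a, b) (a', b'). a \<le> b') L"
    and "\<Gamma> \<in> listset (map (\<lambda>(a, b). strict_exponents b a) L)"
  shows "c \<Gamma> = 0"
  using assms
proof (induction L arbitrary: c \<Gamma>)
  case Nil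
  then show ?case by simp
next
  case (Cons ab L)
  obtain a b where ab: "ab = (a, b)" by (cases ab)
  let ?J = "listset (map (\<lambda>(a, b). strict_exponents b a) L)"
  let ?A = "\<lambda>\<Gamma> z. \<Prod>r<length L. alternant (snd (L ! r)) (fst (L ! r) - 1) ((!) (\<Gamma> ! r)) z"
  \<comment> \<open>The remaining factors become coefficients that depend on the configuration; this
    is why \<open>alternants_independent\<close> allows functions as coefficients.\<close>
  define c' where "c' \<gamma> z = (\<Sum>\<Gamma>\<in>?J. c (\<gamma> # \<Gamma>) * ?A \<Gamma> z)" for \<gamma> and z :: "'f config"
  from Cons.prems(3) obtain \<gamma> \<Gamma>' where \<Gamma>: "\<Gamma> = \<gamma> # \<Gamma>'" "\<gamma> \<in> strict_exponents b a" "\<Gamma>' \<in> ?J"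
    by (auto simp: ab set_Cons_def)
  have split: "(\<Sum>\<Gamma>\<in>listset (map (\<lambda>(a, b). strict_exponents b a) (ab # L)). h \<Gamma>) =
      (\<Sum>\<gamma>\<in>strict_exponents b a. \<Sum>\<Gamma>\<in>?J. h (\<gamma> # \<Gamma>))" for h :: "nat list list \<Rightarrow> 'f poly fract"
  proof -
    have "listset (map (\<lambda>(a, b). strict_exponents b a) (ab # L)) =
        (\<lambda>(\<gamma>, \<Gamma>). \<gamma> # \<Gamma>) ` (strict_exponents b a \<times> ?J)"
      by (auto simp: ab set_Cons_def)
    moreover have "inj_on (\<lambda>(\<gamma>, \<Gamma>). \<gamma> # \<Gamma>) (strict_exponents b a \<times> ?J)"
      by (auto simp: inj_on_def)
    ultimately show ?thesis
      by (simp add: sum.reindex sum.cartesian_product case_prod_unfold)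
  qed
  have "c' \<gamma> z = 0" for z
  proof (rule alternants_independent[OF _ _ \<Gamma>(2)])
    fix z :: "'f config"
    show "(\<Sum>\<gamma>\<in>strict_exponents b a. c' \<gamma> z * alternant b (a - 1) ((!) \<gamma>) z) = 0"
      using Cons.prems(1)[of z] unfolding split c'_def sum_distrib_right
      by (simp add: ab prod.lessThan_Suc_shift ac_simps del: prod.lessThan_Suc)
  next
    fix p and z :: "'f config" assume p: "p permutes {0..<a}"
    have "?A \<Gamma> (reindex p z) = signof p ^ length L * ?A \<Gamma> z" for \<Gamma>
    proof -
      have "alternant (snd (L ! r)) (fst (L ! r) - 1) ((!) (\<Gamma> ! r)) (reindex p z) =
          signof p * alternant (snd (L ! r)) (fst (L ! r) - 1) ((!) (\<Gamma> ! r)) z" if "r < length L" for r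
      proof (rule alternant_reindex[OF permutes_subset[OF p]])
        have "L ! r \<in> set L" using that by simp
        then show "{0..<a} \<subseteq> {0..<snd (L ! r)}"
          using Cons.prems(2) by (auto simp: ab)
      qed
      then show ?thesis by (simp add: prod.distrib)
    qed
    then have "c' \<gamma> (reindex p z) = signof p ^ length L * c' \<gamma> z" for \<gamma>
      by (simp add: c'_def sum_distrib_left ac_simps)
    moreover have "(signof p ^ length L :: 'f poly fract) \<noteq> 0"
      by (simp add: sign_def)
    ultimately show "\<exists>\<epsilon>. \<epsilon> \<noteq> 0 \<and> (\<forall>\<gamma>\<in>strict_exponents b a. c' \<gamma> (reindex p z) = \<epsilon> * c' \<gamma> z)"
      by blast
  qed
  then have "\<And>z :: 'f config. (\<Sum>\<Gamma>\<in>?J. c (\<gamma> # \<Gamma>) * ?A \<Gamma> z) = 0"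
    by (simp add: c'_def)
  from Cons.IH[OF this _ \<Gamma>(3)] Cons.prems(2) show ?case
    by (simp add: \<Gamma>(1))
qed

section \<open>Realizations by functions on configurations\<close>

abbreviation single :: "'x \<Rightarrow> 'a::zero \<Rightarrow> 'x \<Rightarrow>\<^sub>0 'a" where "single \<equiv> Poly_Mapping.single"
abbreviation keys :: "('x \<Rightarrow>\<^sub>0 'a::zero) \<Rightarrow> 'x set" where "keys \<equiv> Poly_Mapping.keys"
abbreviation lookup :: "('x \<Rightarrow>\<^sub>0 'a::zero) \<Rightarrow> 'x \<Rightarrow> 'a" where "lookup \<equiv> Poly_Mapping.lookup"

text \<open>A faithful equivariant model: the group acts on functions by moving the points. Closure
  of the carrier is included because an \<open>sl2_rep\<close> record by itself guarantees nothing
  about its operations.\<close>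

definition realizes ::
    "('f::field, 'v) sl2_rep \<Rightarrow> ('v \<Rightarrow> 'f config_fun) \<Rightarrow> bool" where
  "realizes V \<Psi> \<longleftrightarrow>
    (\<forall>u\<in>rep_space V. \<forall>v\<in>rep_space V. rep_add V u v \<in> rep_space V \<and> \<Psi> (rep_add V u v) = \<Psi> u + \<Psi> v) \<and>
    (\<forall>c. \<forall>v\<in>rep_space V. rep_scale V c v \<in> rep_space V \<and> \<Psi> (rep_scale V c v) = fun_scale c (\<Psi> v)) \<and>
    (\<forall>g\<in>SL2. \<forall>v\<in>rep_space V. rep_act V g v \<in> rep_space V \<and> \<Psi> (rep_act V g v) = \<Psi> v \<circ> move g) \<and>
    inj_on \<Psi> (rep_space V)"

text \<open>The action on functions is the same for all realizations, so \<open>\<Psi>\<close>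
  followed by the inverse of \<open>\<Phi>\<close> is an isomorphism once the images agree.\<close>

lemma realizes_isomorphic:
  assumes V: "realizes V \<Psi>" and W: "realizes W \<Phi>" and image: "\<Psi> ` rep_space V = \<Phi> ` rep_space W"
  shows "rep_isomorphic V W"
proof -
  define \<phi> where "\<phi> v = inv_into (rep_space W) \<Phi> (\<Psi> v)" for v
  have \<Phi>\<phi>: "\<Phi> (\<phi> v) = \<Psi> v" and space: "\<phi> v \<in> rep_space W" if "v \<in> rep_space V" for v
  proof -
    have "\<Psi> v \<in> \<Phi> ` rep_space W" using that image by blast
    then show "\<Phi> (\<phi> v) = \<Psi> v" "\<phi> v \<in> rep_space W"
      unfolding \<phi>_def by (rule f_inv_into_f, rule inv_into_into)
  qed
  have eqI: "x = y" if "x \<in> rep_space W" "y \<in> rep_space W" "\<Phi> x = \<Phi> y" for x y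
    using W that unfolding realizes_def by (auto dest: inj_onD)
  have "inj_on \<phi> (rep_space V)"
    using V \<Phi>\<phi> unfolding realizes_def by (metis inj_on_def)
  moreover have "\<phi> ` rep_space V = rep_space W"
  proof (intro equalityI subsetI)
    fix w assume "w \<in> rep_space W"
    then obtain v where "v \<in> rep_space V" "\<Psi> v = \<Phi> w" using image by (metis image_iff)
    then have "\<phi> v = w" using \<Phi>\<phi> space \<open>w \<in> rep_space W\<close> by (intro eqI) auto
    then show "w \<in> \<phi> ` rep_space V" using \<open>v \<in> rep_space V\<close> by blast
  qed (use space in auto)
  ultimately have "bij_betw \<phi> (rep_space V) (rep_space W)" by (simp add: bij_betw_def)
  moreover have "\<phi> (rep_add V u v) = rep_add W (\<phi> u) (\<phi> v)" if "u \<in> rep_space V" "v \<in> rep_space V" for u v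
    by (rule eqI) (use V W that space \<Phi>\<phi> in \<open>auto simp: realizes_def\<close>)
  moreover have "\<phi> (rep_scale V c v) = rep_scale W c (\<phi> v)" if "v \<in> rep_space V" for c v
    by (rule eqI) (use V W that space \<Phi>\<phi> in \<open>auto simp: realizes_def\<close>)
  moreover have "\<phi> (rep_act V g v) = rep_act W g (\<phi> v)" if "g \<in> SL2" "v \<in> rep_space V" for g v
    by (rule eqI) (use V W that space \<Phi>\<phi> in \<open>auto simp: realizes_def\<close>)
  ultimately show ?thesis
    unfolding rep_isomorphic_def by blast
qed

text \<open>Spanning in terms of the record operations. Zero enters only as a multiple of a
  generator by 0, so the empty set does not generate a non-empty carrier.\<close>

definition generates :: "('f, 'v) sl2_rep \<Rightarrow> 'v set \<Rightarrow> bool" where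
  "generates V B \<longleftrightarrow> B \<subseteq> rep_space V \<and>
    (\<forall>u\<in>rep_space V. \<forall>v\<in>rep_space V. rep_add V u v \<in> rep_space V) \<and>
    (\<forall>c. \<forall>v\<in>rep_space V. rep_scale V c v \<in> rep_space V) \<and>
    (\<forall>X. B \<subseteq> X \<longrightarrow> X \<subseteq> rep_space V \<longrightarrow> (\<forall>u\<in>X. \<forall>v\<in>X. rep_add V u v \<in> X) \<longrightarrow>
      (\<forall>c. \<forall>v\<in>X. rep_scale V c v \<in> X) \<longrightarrow> X = rep_space V)"

lemma generates_induct:
  assumes "generates V B"
    and "\<And>v. v \<in> B \<Longrightarrow> P v"
    and "\<And>u v. u \<in> rep_space V \<Longrightarrow> v \<in> rep_space V \<Longrightarrow> P u \<Longrightarrow> P v \<Longrightarrow> P (rep_add V u v)"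
    and "\<And>c v. v \<in> rep_space V \<Longrightarrow> P v \<Longrightarrow> P (rep_scale V c v)"
    and "v \<in> rep_space V"
  shows "P v"
proof -
  have *: "B \<subseteq> X \<Longrightarrow> X \<subseteq> rep_space V \<Longrightarrow> (\<forall>u\<in>X. \<forall>v\<in>X. rep_add V u v \<in> X) \<Longrightarrow>
      (\<forall>c. \<forall>v\<in>X. rep_scale V c v \<in> X) \<Longrightarrow> X = rep_space V" for X
    using assms(1) unfolding generates_def by blast
  have "{v \<in> rep_space V. P v} = rep_space V"
    by (rule *) (use assms(1-4) in \<open>auto simp: generates_def\<close>)
  with assms(5) show ?thesis by blast
qed

lemma in_listset_iff: "xs \<in> listset As \<longleftrightarrow> length xs = length As \<and> (\<forall>i<length As. xs ! i \<in> As ! i)"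
proof (induction As arbitrary: xs)
  case (Cons A As)
  then show ?case
    by (cases xs) (auto simp: set_Cons_def nth_Cons' All_less_Suc2 dest: spec[of _ 0])
qed simp

lemma in_tuples_iff:
  "xs \<in> tuples Vs \<longleftrightarrow> length xs = length Vs \<and> (\<forall>i<length Vs. xs ! i \<in> rep_space (Vs ! i))"
  by (auto simp: tuples_def in_listset_iff)

text \<open>One coordinate at a time: with the others fixed, the vectors whose insertion gives an
  element of the span are closed under addition and scaling, because of the multilinear relations,
  and they contain the generators.\<close>

lemma multilinear_span:
  assumes len: "length Bs = length Vs"
    and gen: "\<And>i. i < length Vs \<Longrightarrow> generates (Vs ! i) (Bs ! i)"
    and x: "xs \<in> tuples Vs"
  shows "(single xs 1 :: _ \<Rightarrow>\<^sub>0 'f::field) \<in>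
    formal.span (multilinear_relations Vs \<union> (\<lambda>b. single b 1) ` listset Bs)"
proof -
  let ?U = "formal.span (multilinear_relations Vs \<union> (\<lambda>b. single b (1 :: 'f)) ` listset Bs)"
  \<comment> \<open>The coordinates from \<open>n\<close> on are generators, those before are
    arbitrary.\<close>
  have "single xs 1 \<in> ?U"
    if "xs \<in> tuples Vs" "\<forall>i<length Vs. n \<le> i \<longrightarrow> xs ! i \<in> Bs ! i" for n xs
    using that
  proof (induction n arbitrary: xs)
    case 0
    then have "xs \<in> listset Bs" by (auto simp: in_listset_iff in_tuples_iff len)
    then show ?case by (intro formal.span_base) blast
  next
    case (Suc n)
    show ?case
    proof (cases "n < length Vs")
      case False
      then show ?thesis using Suc by auto
    next
      case True
      let ?V = "Vs ! n"
      have closed: "Bs ! n \<subseteq> rep_space ?V" using gen[OF True] by (simp add: generates_def)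
      have "single (xs[n := xs ! n]) 1 \<in> ?U"
      proof (rule generates_induct[OF gen[OF True], where P = "\<lambda>v. single (xs[n := v]) 1 \<in> ?U"])
        show "single (xs[n := v]) 1 \<in> ?U" if "v \<in> Bs ! n" for v
        proof (rule Suc.IH)
          show "xs[n := v] \<in> tuples Vs"
            using Suc.prems(1) subsetD[OF closed that] True by (auto simp: in_tuples_iff nth_list_update)
          show "\<forall>i<length Vs. n \<le> i \<longrightarrow> xs[n := v] ! i \<in> Bs ! i"
            using Suc.prems that True by (auto simp: in_tuples_iff nth_list_update)
        qed
      next
        fix u v
        assume uv: "u \<in> rep_space ?V" "v \<in> rep_space ?V"
          and U: "single (xs[n := u]) 1 \<in> ?U" "single (xs[n := v]) 1 \<in> ?U"
        let ?r = "single (xs[n := rep_add ?V u v]) 1 - single (xs[n := u]) 1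
          - single (xs[n := v]) (1 :: 'f)"
        have "?r \<in> multilinear_relations Vs"
          using uv Suc.prems True unfolding multilinear_relations_def by blast
        then have "?r \<in> ?U" by (intro formal.span_base) blast
        then have "?r + single (xs[n := u]) 1 + single (xs[n := v]) 1 \<in> ?U"
          using U by (intro formal.span_add)
        then show "single (xs[n := rep_add ?V u v]) 1 \<in> ?U" by simp
      next
        fix c v
        assume v: "v \<in> rep_space ?V" and U: "single (xs[n := v]) 1 \<in> ?U"
        let ?r = "single (xs[n := rep_scale ?V c v]) 1
          - fscale c (single (xs[n := v]) (1 :: 'f))"
        have "?r \<in> multilinear_relations Vs"
          using v Suc.prems True unfolding multilinear_relations_def by blast
        then have "?r \<in> ?U" by (intro formal.span_base) blast
        then have "?r + fscale c (single (xs[n := v]) 1) \<in> ?U"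
          using U by (intro formal.span_add formal.span_scale)
        then show "single (xs[n := rep_scale ?V c v]) 1 \<in> ?U" by simp
      next
        show "xs ! n \<in> rep_space ?V" using Suc.prems(1) True by (simp add: in_tuples_iff)
      qed
      then show ?thesis by simp
    qed
  qed
  from this[OF x, of "length Vs"] show ?thesis by simp
qed

section \<open>Quotients of formal linear combinations\<close>

definition formal_eval :: "('x \<Rightarrow> 'f config_fun) \<Rightarrow> ('x \<Rightarrow>\<^sub>0 'f::field) \<Rightarrow> 'f config_fun" where
  "formal_eval \<psi> p = (\<Sum>x\<in>keys p. fun_scale (lookup p x) (\<psi> x))"

lemma fun_scale_zero_left [simp]: "fun_scale 0 f = 0" and fun_scale_one [simp]: "fun_scale 1 f = f"
  by (simp_all add: fun_eq_iff)

lemma fun_scale_add_left: "fun_scale (a + b) f = fun_scale a f + fun_scale b f"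
  by (simp add: fun_eq_iff algebra_simps)

lemma formal_eval_superset:
  assumes "finite A" "keys p \<subseteq> A"
  shows "formal_eval \<psi> p = (\<Sum>x\<in>A. fun_scale (lookup p x) (\<psi> x))"
  unfolding formal_eval_def
  by (rule sum.mono_neutral_left) (use assms in \<open>auto simp: in_keys_iff\<close>)

lemma formal_eval_add: "formal_eval \<psi> (p + q) = formal_eval \<psi> p + formal_eval \<psi> q"
proof -
  let ?A = "keys p \<union> keys q"
  have "formal_eval \<psi> (p + q) = (\<Sum>x\<in>?A. fun_scale (lookup (p + q) x) (\<psi> x))"
    by (rule formal_eval_superset) (simp_all add: Poly_Mapping.keys_add)
  also have "\<dots> = formal_eval \<psi> p + formal_eval \<psi> q"
    by (simp add: formal_eval_superset[of ?A] lookup_add fun_scale_add_left sum.distrib)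
  finally show ?thesis .
qed

lemma keys_fscale: "keys (fscale c p) \<subseteq> keys p"
  by (auto simp: in_keys_iff lookup_fscale)

lemma formal_eval_scale: "formal_eval \<psi> (fscale c p) = fun_scale c (formal_eval \<psi> p)"
proof -
  have "formal_eval \<psi> (fscale c p) =
      (\<Sum>x\<in>keys p. fun_scale (lookup (fscale c p) x) (\<psi> x))"
    by (rule formal_eval_superset) (simp_all add: keys_fscale)
  then show ?thesis
    by (simp add: formal_eval_def lookup_fscale funs.scale_sum_right)
qed

lemma formal_eval_zero [simp]: "formal_eval \<psi> 0 = 0"
  by (simp add: formal_eval_def)

lemma formal_eval_single [simp]: "formal_eval \<psi> (single x c) = fun_scale c (\<psi> x)"
  by (simp add: formal_eval_def)

lemma formal_eval_minus: "formal_eval \<psi> (p - q) = formal_eval \<psi> p - formal_eval \<psi> q"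
  using formal_eval_add[of \<psi> "p - q" q] by (simp add: algebra_simps)

lemma formal_eval_sum: "formal_eval \<psi> (\<Sum>i\<in>A. f i) = (\<Sum>i\<in>A. formal_eval \<psi> (f i))"
  by (induction A rule: infinite_finite_induct) (auto simp: formal_eval_add)

lemma poly_mapping_decompose:
  "p = (\<Sum>x\<in>keys p. fscale (lookup p x) (single x 1))"
  by (rule poly_mapping_eqI)
    (auto simp: lookup_sum lookup_fscale lookup_single when_def in_keys_iff if_distrib[of "(*) _"] sum.delta cong: if_cong)

lemma fscale_single: "fscale c (single x d) = single x (c * d)"
  by (rule poly_mapping_eqI) (simp add: lookup_fscale lookup_single when_def)

lemma linear_ext_add: "linear_ext h (p + q) = linear_ext h p + linear_ext h q"
  unfolding linear_ext_def by (rule setsum_keys_plus_distrib) (auto simp: single_add)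

lemma keys_linear_ext: "keys (linear_ext h p) \<subseteq> h ` keys p"
proof
  fix y assume "y \<in> keys (linear_ext h p)"
  then have "(\<Sum>x\<in>keys p. lookup (single (h x) (lookup p x)) y) \<noteq> 0"
    by (simp add: linear_ext_def in_keys_iff lookup_sum)
  then obtain x where "x \<in> keys p" "lookup (single (h x) (lookup p x)) y \<noteq> 0"
    by (rule sum.not_neutral_contains_not_neutral)
  then show "y \<in> h ` keys p"
    by (auto simp: lookup_single when_def split: if_splits)
qed

lemma formal_eval_linear_ext:
  assumes "\<And>x. x \<in> keys p \<Longrightarrow> \<psi> (h x) = \<psi> x \<circ> move g"
  shows "formal_eval \<psi> (linear_ext h p) = formal_eval \<psi> p \<circ> move g"
proof -
  have "formal_eval \<psi> (linear_ext h p) = (\<Sum>x\<in>keys p. fun_scale (lookup p x) (\<psi> x \<circ> move g))"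
    unfolding linear_ext_def formal_eval_sum using assms by (intro sum.cong) auto
  also have "\<dots> = formal_eval \<psi> p \<circ> move g"
    by (simp add: fun_eq_iff formal_eval_def sum_fun_apply)
  finally show ?thesis .
qed

lemma formal_span_eval_0:
  assumes "p \<in> formal.span R" "\<And>r. r \<in> R \<Longrightarrow> formal_eval \<psi> r = 0"
  shows "formal_eval \<psi> p = 0"
proof -
  have "formal.subspace {p. formal_eval \<psi> p = 0}"
    by (rule formal.subspaceI) (simp_all add: formal_eval_add formal_eval_scale)
  with assms(2) have "formal.span R \<subseteq> {p. formal_eval \<psi> p = 0}"
    by (intro formal.span_minimal) auto
  with assms(1) show ?thesis by blast
qed

lemma formal_span_keys:
  assumes "p \<in> formal.span R" "\<And>r. r \<in> R \<Longrightarrow> keys r \<subseteq> T"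
  shows "keys p \<subseteq> T"
proof -
  have "formal.subspace {p. keys p \<subseteq> T}"
    by (rule formal.subspaceI) (auto dest!: subsetD[OF Poly_Mapping.keys_add] subsetD[OF keys_fscale])
  with assms(2) have "formal.span R \<subseteq> {p. keys p \<subseteq> T}"
    by (intro formal.span_minimal) auto
  with assms(1) show ?thesis by blast
qed

lemma single_one_eq_iff: "single x (1 :: 'f::field) = single y 1 \<longleftrightarrow> x = y"
  by (metis keys_single one_neq_zero singleton_inject)

lemma formal_span_singles:
  assumes "finite B" "p \<in> formal.span ((\<lambda>b. single b 1) ` B)"
  obtains c where "p = (\<Sum>b\<in>B. fscale (c b) (single b 1))"
proof -
  have "p \<in> range (\<lambda>u. \<Sum>v\<in>(\<lambda>b. single b 1) ` B. fscale (u v) v)"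
    using assms(2) by (subst (asm) formal.span_finite) (simp_all add: assms(1))
  then obtain u where "p = (\<Sum>v\<in>(\<lambda>b. single b 1) ` B. fscale (u v) v)" by blast
  also have "\<dots> = (\<Sum>b\<in>B. fscale (u (single b 1)) (single b 1))"
    by (subst sum.reindex) (auto simp: inj_on_def single_one_eq_iff)
  finally show thesis by (rule that)
qed

text \<open>
  The hypotheses make the span of the relations the kernel of the linear extension of \<open>\<psi>\<close>, so all
  operations on cosets are well defined.
\<close>

lemma quotient_realizes:
  fixes Vs :: "('f::field, 'v) sl2_rep list" and \<psi> :: "'v list \<Rightarrow> 'f config_fun"
  defines "\<Psi> \<equiv> \<lambda>A. formal_eval \<psi> (SOME p. p \<in> A)"
  assumes rel_keys: "\<And>r. r \<in> R \<Longrightarrow> keys r \<subseteq> tuples Vs"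
    and rel_0: "\<And>r. r \<in> R \<Longrightarrow> formal_eval \<psi> r = 0"
    and B: "finite B" "B \<subseteq> tuples Vs" "B \<noteq> {}"
    and gen: "\<And>x. x \<in> tuples Vs \<Longrightarrow>
      single x 1 \<in> formal.span (R \<union> (\<lambda>b. single b 1) ` B)"
    and ind: "\<And>c b. (\<Sum>b\<in>B. fun_scale (c b) (\<psi> b)) = 0 \<Longrightarrow> b \<in> B \<Longrightarrow> c b = 0"
    and act: "\<And>g x. g \<in> SL2 \<Longrightarrow> x \<in> tuples Vs \<Longrightarrow>
      map2 (\<lambda>V v. rep_act V g v) Vs x \<in> tuples Vs \<and>
      \<psi> (map2 (\<lambda>V v. rep_act V g v) Vs x) = \<psi> x \<circ> move g"
  shows "realizes (tuple_quotient Vs R) \<Psi>"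
    and "keys p \<subseteq> tuples Vs \<Longrightarrow> \<Psi> (p +o formal.span R) = formal_eval \<psi> p"
    and "\<Psi> ` rep_space (tuple_quotient Vs R) = funs.span (\<psi> ` B)"
    and "generates (tuple_quotient Vs R) ((\<lambda>b. single b 1 +o formal.span R) ` B)"
proof -
  let ?U = "formal.span R" and ?Q = "tuple_quotient Vs R" and ?T = "tuples Vs"
  have U_0: "formal_eval \<psi> u = 0" if "u \<in> ?U" for u
    using that rel_0 by (rule formal_span_eval_0)
  have U_keys: "keys u \<subseteq> ?T" if "u \<in> ?U" for u
    using that rel_keys by (rule formal_span_keys)
  have mem: "q \<in> p +o ?U \<longleftrightarrow> q - p \<in> ?U" for p q
    by (simp add: set_minus_plus)
  have self: "p \<in> p +o ?U" for p by (simp add: mem formal.span_zero)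
  have coset_eq: "p +o ?U = q +o ?U" if "p - q \<in> ?U" for p q
  proof (rule Set.set_eqI)
    fix r
    have "r - q \<in> ?U" if "r - p \<in> ?U"
      using formal.span_add[OF that \<open>p - q \<in> ?U\<close>] by simp
    moreover have "r - p \<in> ?U" if "r - q \<in> ?U"
      using formal.span_diff[OF that \<open>p - q \<in> ?U\<close>] by simp
    ultimately show "r \<in> p +o ?U \<longleftrightarrow> r \<in> q +o ?U" by (auto simp: mem)
  qed
  have UU: "?U + ?U = ?U"
    using formal.span_add formal.span_zero by (force simp: set_plus_def)
  \<comment> \<open>The choice inside \<open>\<Psi>\<close> is harmless, since differences of
    representatives evaluate to 0.\<close>
  have eval_coset: "\<Psi> (p +o ?U) = formal_eval \<psi> p" for p
  proof -
    have "(SOME q. q \<in> p +o ?U) \<in> p +o ?U" using self by (rule someI)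
    then have "formal_eval \<psi> ((SOME q. q \<in> p +o ?U) - p) = 0"
      by (intro U_0) (simp add: mem)
    then show ?thesis by (simp add: \<Psi>_def formal_eval_minus)
  qed
  have decompose: "\<exists>u\<in>?U. \<exists>c. p = u + (\<Sum>b\<in>B. fscale (c b) (single b 1))"
    if "keys p \<subseteq> ?T" for p
  proof -
    have "p \<in> formal.span (R \<union> (\<lambda>b. single b 1) ` B)"
      by (subst poly_mapping_decompose[of p])
        (intro formal.span_sum formal.span_scale gen, use that in blast)
    then obtain u v where "p = u + v" "u \<in> ?U" "v \<in> formal.span ((\<lambda>b. single b 1) ` B)"
      unfolding formal.span_Un by blast
    moreover obtain c where "v = (\<Sum>b\<in>B. fscale (c b) (single b 1))"
      using formal_span_singles[OF B(1) calculation(3)] by blast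
    ultimately show ?thesis by blast
  qed
  have kernel: "p \<in> ?U" if keys: "keys p \<subseteq> ?T" and zero: "formal_eval \<psi> p = 0" for p
  proof -
    obtain u c where u: "u \<in> ?U" and p: "p = u + (\<Sum>b\<in>B. fscale (c b) (single b 1))"
      using decompose[OF keys] by blast
    have "(\<Sum>b\<in>B. fun_scale (c b) (\<psi> b)) = 0"
      using zero U_0[OF u] by (simp add: p formal_eval_add formal_eval_sum fscale_single)
    then have "c b = 0" if "b \<in> B" for b using ind that by blast
    then show ?thesis using u by (simp add: p)
  qed
  have space: "rep_space ?Q = {p +o ?U | p. keys p \<subseteq> ?T}"
    by (simp add: tuple_quotient_def Let_def)
  have add: "rep_add ?Q (p +o ?U) (q +o ?U) = (p + q) +o ?U" for p q
    by (simp add: tuple_quotient_def Let_def set_plus_rearrange UU)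
  have scale: "rep_scale ?Q c (p +o ?U) = fscale c p +o ?U" for c p
  proof -
    have "fscale c q +o ?U = fscale c p +o ?U" if "q \<in> p +o ?U" for q
    proof (rule coset_eq)
      have "fscale c (q - p) \<in> ?U" using that by (intro formal.span_scale) (simp add: mem)
      then show "fscale c q - fscale c p \<in> ?U" by (simp add: formal.scale_right_diff_distrib)
    qed
    \<comment> \<open>All cosets in the union coincide, and the union is not empty.\<close>
    then have "(\<Union>q\<in>p +o ?U. fscale c q +o ?U) = fscale c p +o ?U"
      using self[of p] by blast
    then show ?thesis by (simp add: tuple_quotient_def Let_def)
  qed
  have act_keys: "keys (diagonal_act Vs g p) \<subseteq> ?T"
    and act_eval: "formal_eval \<psi> (diagonal_act Vs g p) = formal_eval \<psi> p \<circ> move g"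
    if "g \<in> SL2" "keys p \<subseteq> ?T" for g p
  proof -
    have "map2 (\<lambda>V v. rep_act V g v) Vs ` keys p \<subseteq> ?T"
      using act[OF that(1)] that(2) by auto
    then show "keys (diagonal_act Vs g p) \<subseteq> ?T"
      unfolding diagonal_act_def by (rule order_trans[OF keys_linear_ext])
    show "formal_eval \<psi> (diagonal_act Vs g p) = formal_eval \<psi> p \<circ> move g"
      unfolding diagonal_act_def
      by (rule formal_eval_linear_ext) (rule act[OF that(1) subsetD[OF that(2)], THEN conjunct2])
  qed
  have act_coset: "rep_act ?Q g (p +o ?U) = diagonal_act Vs g p +o ?U"
    if g: "g \<in> SL2" for g p
  proof -
    have "diagonal_act Vs g q +o ?U = diagonal_act Vs g p +o ?U" if "q \<in> p +o ?U" for q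
    proof (rule coset_eq)
      have qp: "q - p \<in> ?U" using that by (simp add: mem)
      \<comment> \<open>That the action preserves the span is not checked on the relations
        themselves: by equivariance the image evaluates to 0, and the kernel of the evaluation is
        the span.\<close>
      have "diagonal_act Vs g (q - p) \<in> ?U"
        using act_keys[OF g U_keys[OF qp]] act_eval[OF g U_keys[OF qp]] U_0[OF qp]
        by (intro kernel) (auto simp: fun_eq_iff)
      moreover have "diagonal_act Vs g q = diagonal_act Vs g (q - p) + diagonal_act Vs g p"
        unfolding diagonal_act_def by (simp flip: linear_ext_add)
      ultimately show "diagonal_act Vs g q - diagonal_act Vs g p \<in> ?U" by simp
    qed
    then have "(\<Union>q\<in>p +o ?U. diagonal_act Vs g q +o ?U) = diagonal_act Vs g p +o ?U"
      using self[of p] by blast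
    then show ?thesis by (simp add: tuple_quotient_def Let_def)
  qed
  have coset_space: "p +o ?U \<in> rep_space ?Q" if "keys p \<subseteq> ?T" for p
    using that by (auto simp: space)
  have keys_add: "keys (p + q) \<subseteq> ?T"
    if "keys p \<subseteq> ?T" "keys q \<subseteq> ?T" for p q
    using Poly_Mapping.keys_add[of p q] that by blast
  have keys_scale: "keys (fscale c p) \<subseteq> ?T" if "keys p \<subseteq> ?T" for c p
    using keys_fscale[of c p] that by blast
  show "keys p \<subseteq> ?T \<Longrightarrow> \<Psi> (p +o ?U) = formal_eval \<psi> p"
    by (rule eval_coset)
  show "realizes ?Q \<Psi>"
    unfolding realizes_def
  proof (intro conjI ballI allI)
    fix A A' assume "A \<in> rep_space ?Q" "A' \<in> rep_space ?Q"
    then obtain p q where "A = p +o ?U" "A' = q +o ?U" "keys p \<subseteq> ?T" "keys q \<subseteq> ?T"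
      by (auto simp: space)
    then show "rep_add ?Q A A' \<in> rep_space ?Q" "\<Psi> (rep_add ?Q A A') = \<Psi> A + \<Psi> A'"
      by (simp_all add: add coset_space keys_add eval_coset formal_eval_add)
  next
    fix c A assume "A \<in> rep_space ?Q"
    then obtain p where "A = p +o ?U" "keys p \<subseteq> ?T" by (auto simp: space)
    then show "rep_scale ?Q c A \<in> rep_space ?Q" "\<Psi> (rep_scale ?Q c A) = fun_scale c (\<Psi> A)"
      by (simp_all add: scale coset_space keys_scale eval_coset formal_eval_scale)
  next
    fix g :: "'f ^ 2 ^ 2" and A assume g: "g \<in> SL2" and "A \<in> rep_space ?Q"
    then obtain p where "A = p +o ?U" "keys p \<subseteq> ?T" by (auto simp: space)
    then show "rep_act ?Q g A \<in> rep_space ?Q" "\<Psi> (rep_act ?Q g A) = \<Psi> A \<circ> move g"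
      by (simp_all add: act_coset[OF g] coset_space act_keys[OF g] eval_coset act_eval[OF g])
  next
    show "inj_on \<Psi> (rep_space ?Q)"
    proof (rule inj_onI)
      fix A A' assume "A \<in> rep_space ?Q" "A' \<in> rep_space ?Q" and eq: "\<Psi> A = \<Psi> A'"
      then obtain p q where pq: "A = p +o ?U" "A' = q +o ?U" "keys p \<subseteq> ?T" "keys q \<subseteq> ?T"
        by (auto simp: space)
      have "p - q \<in> ?U"
      proof (rule kernel)
        have "p - q = p + fscale (- 1) q" by simp
        then show "keys (p - q) \<subseteq> ?T"
          using keys_add[OF pq(3) keys_scale[OF pq(4)]] by metis
        show "formal_eval \<psi> (p - q) = 0"
          using eq by (simp add: pq eval_coset formal_eval_minus)
      qed
      then show "A = A'" unfolding pq by (rule coset_eq)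
    qed
  qed
  show "\<Psi> ` rep_space ?Q = funs.span (\<psi> ` B)"
  proof (intro equalityI subsetI)
    fix f assume "f \<in> \<Psi> ` rep_space ?Q"
    then obtain p where p: "f = formal_eval \<psi> p" "keys p \<subseteq> ?T"
      by (auto simp: space eval_coset)
    obtain u c where u: "u \<in> ?U" and "p = u + (\<Sum>b\<in>B. fscale (c b) (single b 1))"
      using decompose[OF p(2)] by blast
    then have "f = (\<Sum>b\<in>B. fun_scale (c b) (\<psi> b))"
      by (simp add: p(1) U_0 formal_eval_add formal_eval_sum fscale_single)
    then show "f \<in> funs.span (\<psi> ` B)"
      by (simp only:) (intro funs.span_sum funs.span_scale funs.span_base imageI)
  next
    fix f assume "f \<in> funs.span (\<psi> ` B)"
    have "funs.subspace (\<Psi> ` rep_space ?Q)"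
    proof (rule funs.subspaceI)
      have "\<Psi> (0 +o ?U) = 0" by (simp only: eval_coset formal_eval_zero)
      then show "0 \<in> \<Psi> ` rep_space ?Q"
        using coset_space[of 0] by (metis image_eqI keys_zero empty_subsetI)
    next
      fix f f' assume "f \<in> \<Psi> ` rep_space ?Q" "f' \<in> \<Psi> ` rep_space ?Q"
      then obtain p q where "f = formal_eval \<psi> p" "f' = formal_eval \<psi> q"
        "keys p \<subseteq> ?T" "keys q \<subseteq> ?T"
        by (auto simp: space eval_coset)
      then show "f + f' \<in> \<Psi> ` rep_space ?Q"
        using coset_space[OF keys_add, of p q] eval_coset[of "p + q"] by (metis formal_eval_add image_eqI)
    next
      fix c f assume "f \<in> \<Psi> ` rep_space ?Q"
      then obtain p where "f = formal_eval \<psi> p" "keys p \<subseteq> ?T"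
        by (auto simp: space eval_coset)
      then show "fun_scale c f \<in> \<Psi> ` rep_space ?Q"
        using coset_space[OF keys_scale, of p c] eval_coset[of "fscale c p"] by (metis formal_eval_scale image_eqI)
    qed
    moreover have "\<psi> b \<in> \<Psi> ` rep_space ?Q" if "b \<in> B" for b
    proof -
      have "\<Psi> (single b 1 +o ?U) = \<psi> b" by (simp add: eval_coset)
      moreover have "single b 1 +o ?U \<in> rep_space ?Q"
        by (rule coset_space) (use B(2) that in auto)
      ultimately show ?thesis by (metis image_eqI)
    qed
    ultimately show "f \<in> \<Psi> ` rep_space ?Q"
      using \<open>f \<in> funs.span (\<psi> ` B)\<close> funs.span_minimal[of "\<psi> ` B"] by blast
  qed
  show "generates ?Q ((\<lambda>b. single b 1 +o ?U) ` B)"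
    unfolding generates_def
  proof (intro conjI allI impI ballI)
    show "(\<lambda>b. single b 1 +o ?U) ` B \<subseteq> rep_space ?Q"
      using B(2) by (auto intro!: coset_space)
    show "rep_add ?Q A A' \<in> rep_space ?Q" if "A \<in> rep_space ?Q" "A' \<in> rep_space ?Q" for A A'
      using \<open>realizes ?Q \<Psi>\<close> that by (simp add: realizes_def)
    show "rep_scale ?Q c A \<in> rep_space ?Q" if "A \<in> rep_space ?Q" for c A
      using \<open>realizes ?Q \<Psi>\<close> that by (simp add: realizes_def)
  next
    fix X
    assume X: "(\<lambda>b. single b 1 +o ?U) ` B \<subseteq> X" "X \<subseteq> rep_space ?Q"
      and X_add: "\<forall>u\<in>X. \<forall>v\<in>X. rep_add ?Q u v \<in> X" and X_scale: "\<forall>c. \<forall>v\<in>X. rep_scale ?Q c v \<in> X"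
    \<comment> \<open>Closure under sums does not provide the empty sum; it is obtained from a
      generator, which exists as \<open>B\<close> is not empty.\<close>
    have X0: "0 +o ?U \<in> X"
    proof -
      obtain b where "b \<in> B" using B(3) by blast
      then have "rep_scale ?Q 0 (single b 1 +o ?U) \<in> X" using X(1) X_scale by blast
      then show ?thesis by (simp only: scale formal.scale_zero_left)
    qed
    have X_sum: "(\<Sum>b\<in>B'. fscale (c b) (single b 1)) +o ?U \<in> X" if "finite B'" "B' \<subseteq> B" for B' c
      using that
    proof (induction B' rule: finite_induct)
      case empty
      then show ?case using X0 by (simp only: sum.empty)
    next
      case (insert b B')
      have "rep_scale ?Q (c b) (single b 1 +o ?U) \<in> X" using X(1) X_scale insert.prems by blast
      then have "rep_add ?Q (fscale (c b) (single b 1) +o ?U)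
          ((\<Sum>b\<in>B'. fscale (c b) (single b 1)) +o ?U) \<in> X"
        using X_add insert by (auto simp: scale)
      then show ?case using insert.hyps by (simp only: add sum.insert not_False_eq_True)
    qed
    show "X = rep_space ?Q"
    proof (intro equalityI X(2) subsetI)
      fix A assume "A \<in> rep_space ?Q"
      then obtain p where p: "A = p +o ?U" "keys p \<subseteq> ?T" by (auto simp: space)
      obtain u c where u: "u \<in> ?U" and eq: "p = u + (\<Sum>b\<in>B. fscale (c b) (single b 1))"
        using decompose[OF p(2)] by blast
      have "A = (\<Sum>b\<in>B. fscale (c b) (single b 1)) +o ?U"
        unfolding p(1) by (rule coset_eq) (use u eq in simp)
      then show "A \<in> X" using X_sum[OF B(1) order_refl] by simp
    qed
  qed
qed

section \<open>Evaluation of binary forms\<close>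

definition point_eval :: "'f::field bipoly \<Rightarrow> 'f poly fract \<Rightarrow> 'f poly fract \<Rightarrow> 'f poly fract" where
  "point_eval P x y =
    (\<Sum>k\<in>keys P. const_fract (lookup P k) * (x ^ fst k * y ^ snd k))"

lemma point_eval_superset:
  assumes "finite A" "keys P \<subseteq> A"
  shows "point_eval P x y = (\<Sum>k\<in>A. const_fract (lookup P k) * (x ^ fst k * y ^ snd k))"
  unfolding point_eval_def
  by (rule sum.mono_neutral_left) (use assms in \<open>auto simp: in_keys_iff\<close>)

lemma point_eval_add: "point_eval (P + Q) x y = point_eval P x y + point_eval Q x y"
proof -
  let ?A = "keys P \<union> keys Q"
  have "point_eval (P + Q) x y =
      (\<Sum>k\<in>?A. const_fract (lookup (P + Q) k) * (x ^ fst k * y ^ snd k))"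
    by (rule point_eval_superset) (simp_all add: Poly_Mapping.keys_add)
  also have "\<dots> = point_eval P x y + point_eval Q x y"
    by (simp add: point_eval_superset[of ?A] lookup_add distrib_right sum.distrib)
  finally show ?thesis .
qed

lemma point_eval_scale: "point_eval (fscale c P) x y = const_fract c * point_eval P x y"
proof -
  have "point_eval (fscale c P) x y =
      (\<Sum>k\<in>keys P. const_fract (lookup (fscale c P) k) * (x ^ fst k * y ^ snd k))"
    by (rule point_eval_superset) (simp_all add: keys_fscale)
  then show ?thesis
    by (simp add: point_eval_def lookup_fscale sum_distrib_left mult.assoc)
qed

lemma point_eval_zero [simp]: "point_eval 0 x y = 0"
  by (simp add: point_eval_def)

lemma point_eval_single [simp]:
  "point_eval (single k c) x y = const_fract c * (x ^ fst k * y ^ snd k)"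
  by (simp add: point_eval_def)

lemma point_eval_sum: "point_eval (\<Sum>i\<in>A. f i) x y = (\<Sum>i\<in>A. point_eval (f i) x y)"
  by (induction A rule: infinite_finite_induct) (auto simp: point_eval_add)

lemma point_eval_mult: "point_eval (P * Q) x y = point_eval P x y * point_eval Q x y"
proof -
  have "P * Q = (\<Sum>k\<in>keys P. \<Sum>l\<in>keys Q.
      single (k + l) (lookup P k * lookup Q l))"
    by (subst poly_mapping_decompose[of P], subst poly_mapping_decompose[of Q])
      (simp add: sum_product fscale_single mult_single)
  then show ?thesis
    by (simp add: point_eval_sum) (simp add: point_eval_def sum_product power_add ac_simps)
qed

lemma point_eval_power: "point_eval (P ^ n) x y = point_eval P x y ^ n"
proof (induction n)
  case 0
  show ?case by (simp add: point_eval_def)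
next
  case (Suc n)
  then show ?case by (simp add: point_eval_mult)
qed

lemma point_eval_subst_XY:
  "point_eval (subst_XY S T P) x y = point_eval P (point_eval S x y) (point_eval T x y)"
  unfolding subst_XY_def case_prod_unfold
  by (simp add: point_eval_sum point_eval_scale point_eval_mult point_eval_power)
    (simp add: point_eval_def)

lemma point_eval_sl2_subst:
  assumes "g \<in> SL2"
  shows "point_eval (sl2_subst g P) (coord_x z i) (coord_y z i)
    = point_eval P (coord_x (move g z) i) (coord_y (move g z) i)"
  by (simp add: sl2_subst_def Let_def point_eval_subst_XY point_eval_add point_eval_scale coord_move[OF assms])

section \<open>Homogeneous forms and their monomials\<close>

definition homogeneous :: "nat \<Rightarrow> 'f::field bipoly \<Rightarrow> bool" where
  "homogeneous d P \<longleftrightarrow> (\<forall>k\<in>keys P. fst k + snd k = d)"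

lemma homogeneous_add: "homogeneous d P \<Longrightarrow> homogeneous d Q \<Longrightarrow> homogeneous d (P + Q)"
  unfolding homogeneous_def using Poly_Mapping.keys_add[of P Q] by blast

lemma homogeneous_scale: "homogeneous d P \<Longrightarrow> homogeneous d (fscale c P)"
  unfolding homogeneous_def using keys_fscale[of c P] by blast

lemma homogeneous_sum: "(\<And>i. i \<in> A \<Longrightarrow> homogeneous d (f i)) \<Longrightarrow> homogeneous d (\<Sum>i\<in>A. f i)"
  by (induction A rule: infinite_finite_induct) (auto simp: homogeneous_add, auto simp: homogeneous_def)

lemma homogeneous_mult:
  assumes "homogeneous d P" "homogeneous e Q"
  shows "homogeneous (d + e) (P * Q)"
  unfolding homogeneous_def
proof
  fix k assume "k \<in> keys (P * Q)"
  then obtain a b where "k = a + b" "a \<in> keys P" "b \<in> keys Q"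
    using Poly_Mapping.keys_mult[of P Q] by blast
  then show "fst k + snd k = d + e"
    using assms by (fastforce simp: homogeneous_def)
qed

lemma homogeneous_power: "homogeneous d P \<Longrightarrow> homogeneous (d * n) (P ^ n)"
proof (induction n)
  case 0
  show ?case by (simp add: homogeneous_def)
next
  case (Suc n)
  then show ?case using homogeneous_mult[of d P "d * n" "P ^ n"] by simp
qed

lemma homogeneous_sl2_subst:
  assumes "homogeneous d P"
  shows "homogeneous d (sl2_subst g P)"
proof -
  have X: "homogeneous 1 (single (1, 0) 1)" "homogeneous 1 (single (0, 1) 1)"
    by (simp_all add: homogeneous_def)
  have "homogeneous (fst k + snd k) (S ^ fst k * T ^ snd k)"
    if "homogeneous 1 S" "homogeneous 1 T" for S T :: "'a bipoly" and k :: "nat \<times> nat"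
    using homogeneous_mult[OF homogeneous_power[OF that(1), of "fst k"] homogeneous_power[OF that(2), of "snd k"]]
    by simp
  then have subst: "homogeneous d (subst_XY S T P)" if "homogeneous 1 S" "homogeneous 1 T" for S T
    unfolding subst_XY_def case_prod_unfold using assms that
    by (intro homogeneous_sum homogeneous_scale) (metis homogeneous_def prod.collapse)
  show ?thesis
    unfolding sl2_subst_def Let_def by (intro subst homogeneous_add homogeneous_scale X)
qed

lemma Sym_E_simps [simp]:
  "P \<in> rep_space (Sym_E d) \<longleftrightarrow> homogeneous d P"
  "rep_add (Sym_E d) = (+)" "rep_scale (Sym_E d) = fscale" "rep_act (Sym_E d) = sl2_subst"
  by (auto simp: Sym_E_def homogeneous_def)

definition form_monomial :: "nat \<Rightarrow> nat \<Rightarrow> 'f::field bipoly" where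
  "form_monomial d i = single (i, d - i) 1"

lemma generates_Sym_E: "generates (Sym_E d) (form_monomial d ` {0..<Suc d} :: 'f::field bipoly set)"
  unfolding generates_def
proof (intro conjI allI impI ballI)
  show "form_monomial d ` {0..<Suc d} \<subseteq> rep_space (Sym_E d)"
    by (auto simp: homogeneous_def form_monomial_def)
next
  fix X :: "'f bipoly set"
  assume X: "form_monomial d ` {0..<Suc d} \<subseteq> X" "X \<subseteq> rep_space (Sym_E d)"
    and X_add: "\<forall>u\<in>X. \<forall>v\<in>X. rep_add (Sym_E d) u v \<in> X"
    and X_scale: "\<forall>c. \<forall>v\<in>X. rep_scale (Sym_E d) c v \<in> X"
  have "form_monomial d 0 \<in> X" using X(1) by auto
  then have "fscale 0 (form_monomial d 0) \<in> X" using X_scale[unfolded Sym_E_simps] by blast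
  then have X0: "0 \<in> X" by (simp only: formal.scale_zero_left)
  have sum: "(\<Sum>i\<in>A. f i) \<in> X" if "finite A" "\<And>i. i \<in> A \<Longrightarrow> f i \<in> X" for A and f :: "nat \<times> nat \<Rightarrow> 'f bipoly"
    using that X0 X_add by (induction A rule: finite_induct) auto
  show "X = rep_space (Sym_E d)"
  proof (intro equalityI X(2) subsetI)
    fix P :: "'f bipoly" assume P: "P \<in> rep_space (Sym_E d)"
    have "fscale (lookup P k) (single k 1) \<in> X" if "k \<in> keys P" for k
    proof -
      have "fst k + snd k = d" using P that by (simp add: homogeneous_def)
      then have "k = (fst k, d - fst k)" "fst k < Suc d" by (auto simp: prod_eq_iff)
      then have "(single k 1 :: 'f bipoly) = form_monomial d (fst k)"
        by (metis form_monomial_def)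
      moreover have "form_monomial d (fst k) \<in> X" using X(1) \<open>fst k < Suc d\<close> by auto
      ultimately show ?thesis using X_scale by simp
    qed
    then show "P \<in> X"
      by (subst poly_mapping_decompose) (intro sum, auto)
  qed
qed (auto intro: homogeneous_add homogeneous_scale)

section \<open>Exterior powers of symmetric powers\<close>

text \<open>Sorting by selection: each entry of the target is moved to the front by adjacent swaps,
  and the prefix \<open>p\<close> collects the entries already in place.\<close>

lemma adjacent_swaps:
  assumes swap: "\<And>p u v q. P (p @ u # v # q) \<Longrightarrow> P (p @ v # u # q)"
  shows "mset xs = mset ys \<Longrightarrow> P (p @ xs) \<Longrightarrow> P (p @ ys)"
proof (induction ys arbitrary: p xs)
  case (Cons y ys)
  have move_left: "P (p @ as @ y # bs) \<Longrightarrow> P (p @ y # as @ bs)" for p as bs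
  proof (induction as arbitrary: p)
    case (Cons a as)
    have "P ((p @ [a]) @ y # as @ bs)" by (rule Cons.IH) (use Cons.prems in simp)
    then show ?case using swap[of p a y "as @ bs"] by simp
  qed simp
  have "y \<in> set xs" using Cons.prems(1) by (metis list.set_intros(1) set_mset_mset)
  then obtain as bs where xs: "xs = as @ y # bs" by (meson split_list)
  have "P ((p @ [y]) @ as @ bs)" using move_left Cons.prems(2) xs by simp
  moreover have "mset (as @ bs) = mset ys" using Cons.prems(1) xs by simp
  ultimately show ?case using Cons.IH[of "as @ bs" "p @ [y]"] by simp
qed simp

lemma multilinear_relations_keys:
  assumes "\<And>V u v. V \<in> set Vs \<Longrightarrow> u \<in> rep_space V \<Longrightarrow> v \<in> rep_space V \<Longrightarrow> rep_add V u v \<in> rep_space V"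
    and "\<And>V c v. V \<in> set Vs \<Longrightarrow> v \<in> rep_space V \<Longrightarrow> rep_scale V c v \<in> rep_space V"
    and "r \<in> multilinear_relations Vs"
  shows "keys r \<subseteq> tuples Vs"
proof -
  have upd: "xs[i := w] \<in> tuples Vs" if "xs \<in> tuples Vs" "i < length Vs" "w \<in> rep_space (Vs ! i)" for xs i w
    using that by (auto simp: in_tuples_iff nth_list_update)
  have diff: "keys (p - q) \<subseteq> tuples Vs"
    if "keys p \<subseteq> tuples Vs" "keys q \<subseteq> tuples Vs" for p q :: "'b list \<Rightarrow>\<^sub>0 'a"
  proof
    fix x assume "x \<in> keys (p - q)"
    then have "lookup p x \<noteq> 0 \<or> lookup q x \<noteq> 0"
      by (auto simp: in_keys_iff lookup_minus)
    then show "x \<in> tuples Vs" using that by (auto simp: in_keys_iff subset_iff)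
  qed
  from assms(3) show ?thesis
    unfolding multilinear_relations_def
  proof (elim UnE CollectE exE conjE)
    fix xs i u v
    assume "r = single (xs[i := rep_add (Vs ! i) u v]) 1
        - single (xs[i := u]) 1 - single (xs[i := v]) 1"
      "xs \<in> tuples Vs" "i < length Vs" "u \<in> rep_space (Vs ! i)" "v \<in> rep_space (Vs ! i)"
    then show ?thesis
      by (simp only:) (intro diff, simp_all add: upd assms(1))
  next
    fix xs i c v
    assume "r = single (xs[i := rep_scale (Vs ! i) c v]) 1
        - fscale c (single (xs[i := v]) 1)"
      "xs \<in> tuples Vs" "i < length Vs" "v \<in> rep_space (Vs ! i)"
    then show ?thesis
      by (simp only: fscale_single) (intro diff, simp_all add: upd assms(2))
  qed
qed

lemma multilinear_relations_eval:
  assumes "\<And>xs i u v. xs \<in> tuples Vs \<Longrightarrow> i < length Vs \<Longrightarrow> u \<in> rep_space (Vs ! i) \<Longrightarrow> v \<in> rep_space (Vs ! i) \<Longrightarrow>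
      \<psi> (xs[i := rep_add (Vs ! i) u v]) = \<psi> (xs[i := u]) + \<psi> (xs[i := v])"
    and "\<And>xs i c v. xs \<in> tuples Vs \<Longrightarrow> i < length Vs \<Longrightarrow> v \<in> rep_space (Vs ! i) \<Longrightarrow>
      \<psi> (xs[i := rep_scale (Vs ! i) c v]) = fun_scale c (\<psi> (xs[i := v]))"
    and "r \<in> multilinear_relations Vs"
  shows "formal_eval \<psi> r = 0"
  using assms(3) unfolding multilinear_relations_def
  by (auto simp: formal_eval_minus formal_eval_scale assms(1,2) simp del: fun_scale_apply)

section \<open>Evaluation of wedge products\<close>

type_synonym 'f wedge_sum = "'f bipoly list \<Rightarrow>\<^sub>0 'f"

definition wedge_eval :: "nat \<Rightarrow> 'f::field bipoly list \<Rightarrow> 'f config_fun" where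
  "wedge_eval b Ps z =
    fdet b (\<lambda>s t. point_eval (Ps ! s) (coord_x z t) (coord_y z t)) / vandermonde b z"

lemma wedge_eval_monomials:
  assumes "length \<gamma> = b"
  shows "wedge_eval b (map (form_monomial d) \<gamma>) z = alternant b d ((!) \<gamma>) z / vandermonde b z"
  unfolding wedge_eval_def alternant_def
  by (intro arg_cong2[where f = "(/)"] fdet_cong refl) (simp add: form_monomial_def assms)

lemma wedge_eval_add:
  fixes u v :: "'f::field bipoly"
  assumes "i < b" "length Ps = b"
  shows "wedge_eval b (Ps[i := u + v]) = wedge_eval b (Ps[i := u]) + wedge_eval b (Ps[i := v])"
proof
  fix z :: "'f config"
  let ?e = "\<lambda>P t. point_eval P (coord_x z t) (coord_y z t)"
  have upd: "fdet b (\<lambda>s t. ?e (Ps[i := w] ! s) t) = fdet b ((\<lambda>s t. ?e (Ps ! s) t)(i := ?e w))" for w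
    by (rule fdet_cong) (use assms in \<open>auto simp: nth_list_update\<close>)
  show "wedge_eval b (Ps[i := u + v]) z = (wedge_eval b (Ps[i := u]) + wedge_eval b (Ps[i := v])) z"
    using fdet_row_add[OF assms(1), of "\<lambda>s t. ?e (Ps ! s) t" "?e u" "?e v"]
    by (simp add: wedge_eval_def upd point_eval_add add_divide_distrib)
qed

lemma wedge_eval_scale:
  fixes v :: "'f::field bipoly"
  assumes "i < b" "length Ps = b"
  shows "wedge_eval b (Ps[i := fscale c v]) = fun_scale c (wedge_eval b (Ps[i := v]))"
proof
  fix z :: "'f config"
  let ?e = "\<lambda>P t. point_eval P (coord_x z t) (coord_y z t)"
  have upd: "fdet b (\<lambda>s t. ?e (Ps[i := w] ! s) t) = fdet b ((\<lambda>s t. ?e (Ps ! s) t)(i := ?e w))" for w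
    by (rule fdet_cong) (use assms in \<open>auto simp: nth_list_update\<close>)
  show "wedge_eval b (Ps[i := fscale c v]) z = fun_scale c (wedge_eval b (Ps[i := v])) z"
    using fdet_row_scale[OF assms(1), of "\<lambda>s t. ?e (Ps ! s) t" "const_fract c" "?e v"]
    by (simp add: wedge_eval_def upd point_eval_scale)
qed

lemma wedge_eval_repeated:
  assumes "length Ps = b" "\<not> distinct Ps"
  shows "wedge_eval b Ps = 0"
proof
  fix z
  obtain i j where "i < b" "j < b" "i \<noteq> j" "Ps ! i = Ps ! j"
    using assms by (auto simp: distinct_conv_nth)
  then have "fdet b (\<lambda>s t. point_eval (Ps ! s) (coord_x z t) (coord_y z t)) = 0"
    by (intro fdet_identical_rows[of i j]) auto
  then show "wedge_eval b Ps z = 0 z" by (simp add: wedge_eval_def)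
qed

lemma wedge_eval_move:
  assumes "g \<in> SL2" "length Ps = b"
  shows "wedge_eval b (map (sl2_subst g) Ps) = wedge_eval b Ps \<circ> move g"
proof
  fix z
  have "fdet b (\<lambda>s t. point_eval (map (sl2_subst g) Ps ! s) (coord_x z t) (coord_y z t)) =
      fdet b (\<lambda>s t. point_eval (Ps ! s) (coord_x (move g z) t) (coord_y (move g z) t))"
    by (rule fdet_cong) (simp add: assms point_eval_sl2_subst)
  then show "wedge_eval b (map (sl2_subst g) Ps) z = (wedge_eval b Ps \<circ> move g) z"
    by (simp add: wedge_eval_def vandermonde_move[OF assms(1)])
qed

definition ext_relations :: "nat \<Rightarrow> nat \<Rightarrow> 'f::field wedge_sum set" where
  "ext_relations b d = multilinear_relations (replicate b (Sym_E d)) \<union> alternating_relations (replicate b (Sym_E d))"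

lemma exterior_power_eq: "exterior_power b (Sym_E d) = tuple_quotient (replicate b (Sym_E d)) (ext_relations b d)"
  by (simp add: exterior_power_def ext_relations_def Let_def)

lemma in_sym_tuples_iff:
  "Ps \<in> tuples (replicate b (Sym_E d)) \<longleftrightarrow> length Ps = b \<and> (\<forall>P\<in>set Ps. homogeneous d P)"
  by (auto simp: in_tuples_iff all_set_conv_all_nth)

text \<open>The alternating relations imply antisymmetry in every characteristic, by expanding the
  tuple with \<open>u + v\<close> in both places.\<close>

lemma wedge_swap:
  assumes "p @ u # v # q \<in> tuples (replicate b (Sym_E d))"
  shows "single (p @ u # v # q) 1 + single (p @ v # u # q) 1
    \<in> formal.span (ext_relations b d)"
proof -
  let ?Vs = "replicate b (Sym_E d)" and ?U = "formal.span (ext_relations b d)"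
  let ?s = "\<lambda>x y. single (p @ x # y # q) 1 :: 'a bipoly list \<Rightarrow>\<^sub>0 'a"
  have hom: "homogeneous d u" "homogeneous d v" "homogeneous d (u + v)"
    using assms by (auto simp: in_sym_tuples_iff intro: homogeneous_add)
  have len: "length p < b" "Suc (length p) < b" using assms by (auto simp: in_sym_tuples_iff)
  have tup: "p @ x # y # q \<in> tuples ?Vs" if "homogeneous d x" "homogeneous d y" for x y
    using assms that by (auto simp: in_sym_tuples_iff)
  have alt: "?s x x \<in> ?U" if "homogeneous d x" for x
    by (rule formal.span_base) (use tup[OF that that] in \<open>auto simp: ext_relations_def alternating_relations_def\<close>)
  have left: "?s (u + v) y - ?s u y - ?s v y \<in> ?U" if "homogeneous d y" for y
  proof (rule formal.span_base)
    have "?s (u + v) y - ?s u y - ?s v y =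
        single ((p @ u # y # q)[length p := rep_add (?Vs ! length p) u v]) 1
        - single ((p @ u # y # q)[length p := u]) 1
        - single ((p @ u # y # q)[length p := v]) 1"
      using len by simp
    moreover have "\<dots> \<in> multilinear_relations ?Vs"
      unfolding multilinear_relations_def
      by (rule UnI1, rule CollectI, rule exI[of _ "p @ u # y # q"], rule exI[of _ "length p"],
          rule exI[of _ u], rule exI[of _ v]) (use tup that hom len in auto)
    ultimately show "?s (u + v) y - ?s u y - ?s v y \<in> ext_relations b d"
      by (simp add: ext_relations_def)
  qed
  have right: "?s x (u + v) - ?s x u - ?s x v \<in> ?U" if "homogeneous d x" for x
  proof (rule formal.span_base)
    have upd: "(p @ x # u # q)[Suc (length p) := w] = p @ x # w # q" for w
      using list_update_length[of "p @ [x]" u q w] by simp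
    have "?s x (u + v) - ?s x u - ?s x v =
        single ((p @ x # u # q)[Suc (length p) := rep_add (?Vs ! Suc (length p)) u v]) 1
        - single ((p @ x # u # q)[Suc (length p) := u]) 1
        - single ((p @ x # u # q)[Suc (length p) := v]) 1"
      unfolding upd using len by simp
    moreover have "\<dots> \<in> multilinear_relations ?Vs"
      unfolding multilinear_relations_def
      by (rule UnI1, rule CollectI, rule exI[of _ "p @ x # u # q"], rule exI[of _ "Suc (length p)"],
          rule exI[of _ u], rule exI[of _ v]) (use tup that hom len in auto)
    ultimately show "?s x (u + v) - ?s x u - ?s x v \<in> ext_relations b d"
      by (simp add: ext_relations_def)
  qed
  have "?s u v + ?s v u = ?s (u + v) (u + v) - ?s u u - ?s v v
      - (?s (u + v) (u + v) - ?s u (u + v) - ?s v (u + v))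
      - (?s u (u + v) - ?s u u - ?s u v) - (?s v (u + v) - ?s v u - ?s v v)"
    by simp
  also have "\<dots> \<in> ?U"
    by (intro formal.span_diff alt left right hom)
  finally show ?thesis .
qed

lemma map_form_monomial_in_tuples:
  "length \<gamma> = b \<Longrightarrow> set \<gamma> \<subseteq> {0..<Suc d} \<Longrightarrow> map (form_monomial d) \<gamma> \<in> tuples (replicate b (Sym_E d))"
  by (fastforce simp: in_sym_tuples_iff homogeneous_def form_monomial_def)

definition ext_basis :: "nat \<Rightarrow> nat \<Rightarrow> 'f::field bipoly list set" where
  "ext_basis b d = map (form_monomial d) ` strict_exponents b (Suc d)"

lemma form_monomial_inject: "form_monomial d i = form_monomial d j \<longleftrightarrow> i = j"
  by (metis form_monomial_def keys_single one_neq_zero prod.inject singleton_inject)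

lemma inj_map_form_monomial: "inj_on (map (form_monomial d)) S"
  by (rule inj_onI) (metis form_monomial_inject inj_def map_injective)

text \<open>Multilinearity reduces to tuples of monomials. Those with a repetition are relations;
  the others are related to sorted ones by adjacent swaps, whose signs do not matter for membership
  in a span.\<close>

lemma ext_basis_spans:
  assumes "Ps \<in> tuples (replicate b (Sym_E d))"
  shows "(single Ps 1 :: _ \<Rightarrow>\<^sub>0 'f::field) \<in>
    formal.span (ext_relations b d \<union> (\<lambda>x. single x 1) ` ext_basis b d)"
proof -
  let ?Vs = "replicate b (Sym_E d)" and ?M = "form_monomial d ` {0..<Suc d} :: 'f bipoly set"
  let ?U = "formal.span (ext_relations b d \<union> (\<lambda>x. single x (1 :: 'f)) ` ext_basis b d)"
  have rel: "formal.span (ext_relations b d) \<subseteq> ?U"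
    by (rule formal.span_mono) blast
  have monomials: "single (map (form_monomial d) \<gamma>) 1 \<in> ?U"
    if \<gamma>: "length \<gamma> = b" "set \<gamma> \<subseteq> {0..<Suc d}" for \<gamma>
  proof (cases "distinct \<gamma>")
    case False
    have "map (form_monomial d) \<gamma> \<in> tuples ?Vs"
      using \<gamma> by (rule map_form_monomial_in_tuples)
    moreover have "\<not> distinct (map (form_monomial d) \<gamma>)" using False by (simp add: distinct_map)
    ultimately show ?thesis
      by (intro formal.span_base) (auto simp: ext_relations_def alternating_relations_def)
  next
    case True
    let ?P = "\<lambda>Ps. Ps \<in> tuples ?Vs \<and> single Ps 1 \<in> ?U"
    have "?P ([] @ map (form_monomial d) \<gamma>)"
    proof (rule adjacent_swaps[where P = ?P])
      fix p u v q assume uv: "?P (p @ u # v # q)"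
      then have "single (p @ u # v # q) 1 + single (p @ v # u # q) 1 \<in> ?U"
        using wedge_swap rel by blast
      then have "single (p @ u # v # q) 1 + single (p @ v # u # q) 1
          - single (p @ u # v # q) 1 \<in> ?U"
        using uv by (intro formal.span_diff) auto
      then show "?P (p @ v # u # q)" using uv by (auto simp: in_sym_tuples_iff)
    next
      have sorted: "sort \<gamma> \<in> strict_exponents b (Suc d)"
        using \<gamma> True by (simp add: strict_exponents_def strict_sorted_iff)
      then have "single (map (form_monomial d) (sort \<gamma>)) 1 \<in> ?U"
        by (intro formal.span_base UnI2 imageI) (simp add: ext_basis_def)
      moreover have "map (form_monomial d) (sort \<gamma>) \<in> tuples ?Vs"
        by (rule map_form_monomial_in_tuples) (use \<gamma> in auto)
      ultimately show "?P ([] @ map (form_monomial d) (sort \<gamma>))" by simp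
    qed simp
    then show ?thesis by simp
  qed
  have "multilinear_relations ?Vs \<union> (\<lambda>x. single x 1) ` listset (replicate b ?M) \<subseteq> ?U"
  proof (intro Un_least subsetI)
    show "r \<in> ?U" if "r \<in> multilinear_relations ?Vs" for r
      using that by (intro formal.span_base) (simp add: ext_relations_def)
  next
    fix r assume "r \<in> (\<lambda>x. single x (1 :: 'f)) ` listset (replicate b ?M)"
    then obtain x where x: "r = single x 1" "x \<in> listset (replicate b ?M)"
      by blast
    then have "length x = b" by (simp add: in_listset_iff)
    moreover have "set x \<subseteq> ?M" using x(2) by (auto simp: in_listset_iff in_set_conv_nth)
    then have "x \<in> map (form_monomial d) ` lists {0..<Suc d}"
      by (simp add: lists_image[symmetric] in_lists_conv_set subset_iff)
    then obtain \<gamma> where "x = map (form_monomial d) \<gamma>" "set \<gamma> \<subseteq> {0..<Suc d}"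
      by (auto simp: lists_eq_set)
    ultimately have "length \<gamma> = b" by simp
    note \<gamma> = this \<open>set \<gamma> \<subseteq> _\<close> \<open>x = _\<close>
    show "r \<in> ?U" using monomials[OF \<gamma>(1,2)] x(1) \<gamma>(3) by simp
  qed
  then have "formal.span (multilinear_relations ?Vs \<union> (\<lambda>x. single x 1) ` listset (replicate b ?M)) \<subseteq> ?U"
    by (rule formal.span_minimal) (rule formal.subspace_span)
  moreover have "single Ps 1 \<in>
      formal.span (multilinear_relations ?Vs \<union> (\<lambda>x. single x 1) ` listset (replicate b ?M))"
    by (rule multilinear_span) (use assms generates_Sym_E in auto)
  ultimately show ?thesis by blast
qed

definition ext_eval :: "nat \<Rightarrow> 'f::field wedge_sum set \<Rightarrow> 'f config_fun" where
  "ext_eval b A = formal_eval (wedge_eval b) (SOME p. p \<in> A)"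

definition ext_coset :: "nat \<Rightarrow> nat \<Rightarrow> nat list \<Rightarrow> 'f::field wedge_sum set" where
  "ext_coset b d \<gamma> = single (map (form_monomial d) \<gamma>) 1 +o formal.span (ext_relations b d)"

text \<open>Independence of the basis tuples is that of the alternants, after the common Vandermonde
  denominator is cleared. For the image, one inclusion is the divisibility of alternants by the
  Vandermonde determinant; the other uses tuples of monomials in any order, whose cosets also lie in
  the space.\<close>

lemma exterior_power_realizes:
  assumes "b \<ge> 1" "b \<le> Suc d"
  shows "realizes (exterior_power b (Sym_E d :: ('f::field, 'f bipoly) sl2_rep)) (ext_eval b)"
    and "\<gamma> \<in> strict_exponents b (Suc d) \<Longrightarrow>
      ext_eval b (ext_coset b d \<gamma> :: 'f wedge_sum set) z = alternant b d ((!) \<gamma>) z / vandermonde b z"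
    and "ext_eval b ` rep_space (exterior_power b (Sym_E d :: ('f, 'f bipoly) sl2_rep)) = elem_sym_span b (Suc d - b)"
    and "generates (exterior_power b (Sym_E d :: ('f, 'f bipoly) sl2_rep)) (ext_coset b d ` strict_exponents b (Suc d))"
proof -
  let ?V = "Sym_E d :: ('f, 'f bipoly) sl2_rep"
  let ?Vs = "replicate b ?V" and ?R = "ext_relations b d :: 'f wedge_sum set"
  let ?B = "ext_basis b d :: 'f bipoly list set"
  have \<Psi>: "ext_eval b = (\<lambda>A. formal_eval (wedge_eval b) (SOME p. p \<in> A))"
    by (auto simp: ext_eval_def)
  have basis_tuples: "?B \<subseteq> tuples ?Vs"
    unfolding ext_basis_def by (intro image_subsetI map_form_monomial_in_tuples) (auto simp: strict_exponents_def)
  have R_keys: "keys r \<subseteq> tuples ?Vs" if "r \<in> ?R" for r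
    using that unfolding ext_relations_def
  proof
    assume "r \<in> multilinear_relations ?Vs"
    then show ?thesis
      by (rule multilinear_relations_keys[rotated 2]) (auto intro: homogeneous_add homogeneous_scale)
  qed (auto simp: alternating_relations_def)
  have R_eval: "formal_eval (wedge_eval b) r = 0" if "r \<in> ?R" for r
    using that unfolding ext_relations_def
  proof
    assume "r \<in> multilinear_relations ?Vs"
    then show ?thesis
      by (rule multilinear_relations_eval[rotated 2])
        (simp_all add: in_sym_tuples_iff wedge_eval_add wedge_eval_scale)
  next
    assume "r \<in> alternating_relations ?Vs"
    then show ?thesis
      by (auto simp: alternating_relations_def in_sym_tuples_iff wedge_eval_repeated)
  qed
  have B: "finite ?B" "?B \<noteq> {}"
  proof -
    show "finite ?B" by (simp add: ext_basis_def)
    have "card (strict_exponents b (Suc d)) \<noteq> 0"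
      using assms(2) by (simp add: card_strict_exponents)
    then show "?B \<noteq> {}" by (auto simp: ext_basis_def)
  qed
  have ind: "c x = 0" if eq: "(\<Sum>x\<in>?B. fun_scale (c x) (wedge_eval b x)) = 0" and "x \<in> ?B" for c x
  proof -
    obtain \<gamma> where \<gamma>: "x = map (form_monomial d) \<gamma>" "\<gamma> \<in> strict_exponents b (Suc d)"
      using \<open>x \<in> ?B\<close> by (auto simp: ext_basis_def)
    have "const_fract (c (map (form_monomial d) \<gamma>)) = 0"
    proof (rule alternants_independent[where c = "\<lambda>\<gamma> z. const_fract (c (map (form_monomial d) \<gamma>))", OF _ _ \<gamma>(2)])
      fix z :: "'f config"
      have "0 = (\<Sum>x\<in>?B. fun_scale (c x) (wedge_eval b x)) z" using eq by simp
      also have "\<dots> = (\<Sum>\<gamma>\<in>strict_exponents b (Suc d). const_fract (c (map (form_monomial d) \<gamma>)) *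
          (alternant b d ((!) \<gamma>) z / vandermonde b z))"
        unfolding sum_fun_apply ext_basis_def
        by (subst sum.reindex[OF inj_map_form_monomial])
          (auto simp: wedge_eval_monomials strict_exponents_def intro!: sum.cong)
      also have "\<dots> = (\<Sum>\<gamma>\<in>strict_exponents b (Suc d). const_fract (c (map (form_monomial d) \<gamma>)) *
          alternant b d ((!) \<gamma>) z) / vandermonde b z"
        by (simp add: sum_divide_distrib)
      finally show "(\<Sum>\<gamma>\<in>strict_exponents b (Suc d). const_fract (c (map (form_monomial d) \<gamma>)) *
          alternant b (Suc d - 1) ((!) \<gamma>) z) = 0"
        by simp
    next
      show "\<exists>\<epsilon>::'f poly fract. \<epsilon> \<noteq> 0 \<and> (\<forall>\<gamma>\<in>strict_exponents b (Suc d).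
          const_fract (c (map (form_monomial d) \<gamma>)) = \<epsilon> * const_fract (c (map (form_monomial d) \<gamma>)))"
        by (intro exI[of _ 1]) simp
    qed
    then show ?thesis by (simp add: \<gamma>(1))
  qed
  have act: "map2 (\<lambda>V v. rep_act V g v) ?Vs x \<in> tuples ?Vs \<and>
      wedge_eval b (map2 (\<lambda>V v. rep_act V g v) ?Vs x) = wedge_eval b x \<circ> move g"
    if "g \<in> SL2" "x \<in> tuples ?Vs" for g x
  proof -
    have len: "length x = b" using that(2) by (simp add: in_sym_tuples_iff)
    have "map2 (\<lambda>V v. rep_act V g v) ?Vs x = map (sl2_subst g) x"
      by (rule nth_equalityI) (simp_all add: len)
    then show ?thesis
      using that len by (auto simp: in_sym_tuples_iff homogeneous_sl2_subst wedge_eval_move)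
  qed
  note hyps = R_keys R_eval B basis_tuples ext_basis_spans ind act
  have Q1: "realizes (exterior_power b ?V) (ext_eval b)"
    unfolding \<Psi> exterior_power_eq by (rule quotient_realizes(1)[where B = ?B]; fact hyps)
  have Q2: "ext_eval b (p +o formal.span ?R) = formal_eval (wedge_eval b) p"
    if "keys p \<subseteq> tuples ?Vs" for p
    unfolding \<Psi> by (rule quotient_realizes(2)[where B = ?B]; fact hyps that)
  have Q3: "ext_eval b ` rep_space (exterior_power b ?V) = funs.span (wedge_eval b ` ?B)"
    unfolding \<Psi> exterior_power_eq by (rule quotient_realizes(3)[where B = ?B]; fact hyps)
  have Q4: "generates (exterior_power b ?V) ((\<lambda>x. single x 1 +o formal.span ?R) ` ?B)"
    unfolding exterior_power_eq by (rule quotient_realizes(4)[where B = ?B]; fact hyps)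
  show realizes: "realizes (exterior_power b ?V) (ext_eval b)"
    by (rule Q1)
  have coset_eval: "ext_eval b (ext_coset b d \<gamma> :: 'f wedge_sum set) = wedge_eval b (map (form_monomial d) \<gamma>)"
    and coset_space: "(ext_coset b d \<gamma> :: 'f wedge_sum set) \<in> rep_space (exterior_power b ?V)"
    if "length \<gamma> = b" "\<forall>i\<in>set \<gamma>. i < Suc d" for \<gamma>
  proof -
    have t: "keys (single (map (form_monomial d) \<gamma>) (1 :: 'f)) \<subseteq> tuples ?Vs"
      using map_form_monomial_in_tuples[of \<gamma> b d] that by (auto simp: subset_iff)
    then show "ext_eval b (ext_coset b d \<gamma> :: 'f wedge_sum set) = wedge_eval b (map (form_monomial d) \<gamma>)"
      unfolding ext_coset_def by (subst Q2) simp_all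
    show "(ext_coset b d \<gamma> :: 'f wedge_sum set) \<in> rep_space (exterior_power b ?V)"
      unfolding ext_coset_def exterior_power_eq using t by (auto simp: tuple_quotient_def Let_def)
  qed
  show "\<gamma> \<in> strict_exponents b (Suc d) \<Longrightarrow>
      ext_eval b (ext_coset b d \<gamma> :: 'f wedge_sum set) z = alternant b d ((!) \<gamma>) z / vandermonde b z"
    by (subst coset_eval) (auto simp: strict_exponents_def wedge_eval_monomials)
  show "generates (exterior_power b ?V) (ext_coset b d ` strict_exponents b (Suc d))"
    using Q4 by (simp add: ext_basis_def image_image ext_coset_def)
  have d: "d = b + (Suc d - b) - 1" "Suc d = b + (Suc d - b)" using assms by auto
  show "ext_eval b ` rep_space (exterior_power b ?V) = elem_sym_span b (Suc d - b)"
  proof (intro equalityI)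
    have "wedge_eval b x \<in> elem_sym_span b (Suc d - b)" if x: "x \<in> ?B" for x
    proof -
      obtain \<gamma> where \<gamma>: "x = map (form_monomial d) \<gamma>" "\<gamma> \<in> strict_exponents b (Suc d)"
        using x by (auto simp: ext_basis_def)
      have "(alternant b (b + (Suc d - b) - 1) ((!) \<gamma>) :: 'f config_fun) \<in> (*) (vandermonde b) ` elem_sym_span b (Suc d - b)"
        by (rule alternant_in_vandermonde_multiples)
          (use assms strict_exponents_nth[OF \<gamma>(2)] in auto)
      then obtain h :: "'f config_fun" where h: "h \<in> elem_sym_span b (Suc d - b)" "alternant b d ((!) \<gamma>) = vandermonde b * h"
        unfolding d(1)[symmetric] by blast
      have "wedge_eval b x z = h z" for z
        using \<gamma> h(2) by (simp add: wedge_eval_monomials strict_exponents_def)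
      then show ?thesis using h(1) by (metis ext)
    qed
    then show "ext_eval b ` rep_space (exterior_power b ?V) \<subseteq> elem_sym_span b (Suc d - b)"
      unfolding Q3 elem_sym_span_def by (intro funs.span_minimal funs.subspace_span) auto
  next
    let ?W = "ext_eval b ` rep_space (exterior_power b ?V)"
    have W: "?W = funs.span (wedge_eval b ` ?B)" by (rule Q3)
    show "elem_sym_span b (Suc d - b) \<subseteq> ?W"
    proof
      fix h :: "'f config_fun" assume "h \<in> elem_sym_span b (Suc d - b)"
      then have "vandermonde b * h \<in> funs.span (alternants b (Suc d - b))"
        by (rule vandermonde_mult_elem_sym_span[OF assms(1)])
      then have "(\<lambda>z. inverse (vandermonde b z)) * (vandermonde b * h) \<in> funs.span (wedge_eval b ` ?B)"
      proof (rule funs_span_mult)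
        fix a :: "'f config_fun"
        assume "a \<in> alternants b (Suc d - b)"
        then obtain \<gamma> where a: "a = alternant b d \<gamma>" "\<forall>i<b. \<gamma> i < Suc d"
          unfolding d(2)[symmetric] diff_Suc_1 by blast
        let ?\<gamma> = "map \<gamma> [0..<b]"
        have "a = alternant b d ((!) ?\<gamma>)"
          unfolding a(1) by (rule alternant_cong) simp
        then have "(\<lambda>z. inverse (vandermonde b z)) * a = wedge_eval b (map (form_monomial d) ?\<gamma>)"
          by (simp add: fun_eq_iff wedge_eval_monomials field_simps del: map_map)
        also have "\<dots> = ext_eval b (ext_coset b d ?\<gamma>)"
          by (rule coset_eval[symmetric]) (use a(2) in auto)
        also have "\<dots> \<in> ?W"
          by (intro imageI coset_space) (use a(2) in auto)
        finally show "(\<lambda>z. inverse (vandermonde b z)) * a \<in> funs.span (wedge_eval b ` ?B)"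
          unfolding W .
      qed
      also have "(\<lambda>z. inverse (vandermonde b z)) * (vandermonde b * h) = h"
        by (auto simp: fun_eq_iff field_simps)
      finally show "h \<in> ?W" unfolding W .
    qed
  qed
qed

section \<open>Independent families of functions\<close>

lemma family_independent_image:
  assumes "finite J" "\<And>c. (\<Sum>x\<in>J. fun_scale (c x) (f x)) = 0 \<Longrightarrow> \<forall>x\<in>J. c x = 0"
  shows "inj_on f J" "\<not> funs.dependent (f ` J)"
proof -
  show inj: "inj_on f J"
  proof (rule inj_onI, rule ccontr)
    fix x y assume xy: "x \<in> J" "y \<in> J" "f x = f y" "x \<noteq> y"
    define c where "c w = (if w = x then 1 else if w = y then - 1 else (0 :: 'b))" for w
    have "(\<Sum>w\<in>J. fun_scale (c w) (f w)) = (\<Sum>w\<in>{x, y}. fun_scale (c w) (f w))"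
      by (rule sum.mono_neutral_right) (use xy assms(1) in \<open>auto simp: c_def\<close>)
    also have "\<dots> = 0"
      using xy by (simp add: c_def)
    finally have "c x = 0" using assms(2) xy(1) by blast
    then show False by (simp add: c_def)
  qed
  show "\<not> funs.dependent (f ` J)"
  proof
    assume "funs.dependent (f ` J)"
    then obtain u v where u: "v \<in> f ` J" "u v \<noteq> 0" "(\<Sum>v\<in>f ` J. fun_scale (u v) v) = 0"
      using assms(1) by (auto simp: funs.dependent_finite)
    then have "(\<Sum>x\<in>J. fun_scale (u (f x)) (f x)) = 0"
      by (simp add: sum.reindex[OF inj])
    then show False using assms(2)[of "\<lambda>x. u (f x)"] u(1,2) by blast
  qed
qed

text \<open>By the exchange lemma \<open>card E\<close> is at most the size of any finite set whose
  span contains \<open>E\<close>. With \<open>card B \<le> card E\<close>, neither a repetition in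
  \<open>f\<close> nor a redundant image is possible, and \<open>E\<close> cannot be enlarged
  independently within the span. This turns a one-sided inclusion into an equality.\<close>

lemma spanning_family_independent:
  assumes "finite B" and E: "\<not> funs.dependent E" "E \<subseteq> funs.span (f ` B)" "card B \<le> card E"
  shows "funs.span (f ` B) = funs.span E"
    and "(\<Sum>b\<in>B. fun_scale (c b) (f b)) = 0 \<Longrightarrow> b \<in> B \<Longrightarrow> c b = 0"
proof -
  have bound: "finite E" "card E \<le> card (f ` B)"
    using funs.independent_span_bound[OF finite_imageI[OF assms(1)] E(1,2)] by auto
  have "card (f ` B) = card B"
    using bound E(3) card_image_le[OF assms(1), of f] by simp
  then have inj: "inj_on f B" using assms(1) by (intro eq_card_imp_inj_on)
  have indep: "\<not> funs.dependent (f ` B)"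
  proof
    assume "funs.dependent (f ` B)"
    then obtain a where a: "a \<in> f ` B" "a \<in> funs.span (f ` B - {a})"
      by (auto simp: funs.dependent_def)
    have "E \<subseteq> funs.span (f ` B - {a})"
      using E(2) funs.span_redundant[OF a(2)] a(1) by (simp add: insert_absorb)
    then have "card E \<le> card (f ` B - {a})"
      using funs.independent_span_bound[OF _ E(1)] assms(1) by simp
    also have "\<dots> < card (f ` B)"
      using a(1) assms(1) by (intro psubset_card_mono) auto
    finally show False using \<open>card (f ` B) = card B\<close> E(3) by simp
  qed
  show "c b = 0" if zero: "(\<Sum>b\<in>B. fun_scale (c b) (f b)) = 0" and b: "b \<in> B"
  proof -
    have "(\<Sum>v\<in>f ` B. fun_scale (c (the_inv_into B f v)) v) = (\<Sum>b\<in>B. fun_scale (c b) (f b))"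
      by (subst sum.reindex[OF inj]) (auto simp: the_inv_into_f_f[OF inj] intro!: sum.cong)
    then have "c (the_inv_into B f (f b)) = 0"
      using zero b assms(1)
      by (intro funs.independentD[OF indep, of "f ` B" "\<lambda>v. c (the_inv_into B f v)"]) auto
    then show ?thesis using b by (simp add: the_inv_into_f_f[OF inj])
  qed
  have "f ` B \<subseteq> funs.span E"
  proof
    fix a assume a: "a \<in> f ` B"
    show "a \<in> funs.span E"
    proof (rule ccontr)
      assume not_in: "a \<notin> funs.span E"
      then have "\<not> funs.dependent (insert a E)"
        using E(1) by (rule funs.independent_insertI)
      moreover have "insert a E \<subseteq> funs.span (f ` B)"
        using a E(2) by (simp add: funs.span_base)
      ultimately have "finite (insert a E) \<and> card (insert a E) \<le> card (f ` B)"
        by (rule funs.independent_span_bound[OF finite_imageI[OF assms(1)]])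
      moreover have "a \<notin> E" using not_in funs.span_base by metis
      ultimately show False
        using bound(1) \<open>card (f ` B) = card B\<close> E(3) by simp
    qed
  qed
  then show "funs.span (f ` B) = funs.span E"
    using E(2) by (intro equalityI funs.span_minimal funs.subspace_span)
qed

lemma funs_span_times:
  assumes "A \<subseteq> funs.span A'" "B \<subseteq> funs.span B'"
  shows "A * B \<subseteq> funs.span (A' * B')"
proof
  fix f assume "f \<in> A * B"
  then obtain a b where f: "f = a * b" "a \<in> A" "b \<in> B" by (rule set_times_elim)
  have "a * b' \<in> funs.span (A' * B')" if "b' \<in> B'" for b'
  proof -
    have "b' * a \<in> funs.span (A' * B')"
    proof (rule funs_span_mult)
      show "a \<in> funs.span A'" using f assms by blast
      show "b' * g \<in> funs.span (A' * B')" if "g \<in> A'" for g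
        using that \<open>b' \<in> B'\<close> by (subst mult.commute) (intro funs.span_base set_times_intro)
    qed
    then show ?thesis by (simp only: mult.commute)
  qed
  then show "f \<in> funs.span (A' * B')"
    unfolding f(1) using f(3) assms(2) by (intro funs_span_mult[of b B']) auto
qed

lemma funs_span_power: "A \<subseteq> funs.span B \<Longrightarrow> A ^ n \<subseteq> funs.span (B ^ n)"
proof (induction n)
  case 0
  show "A ^ 0 \<subseteq> funs.span (B ^ 0)" by (simp only: power_0 funs.span_superset)
next
  case (Suc n)
  show "A ^ Suc n \<subseteq> funs.span (B ^ Suc n)"
    unfolding power_Suc by (rule funs_span_times[OF Suc.prems Suc.IH[OF Suc.prems]])
qed

lemma funs_span_prod_list:
  assumes "\<And>x. x \<in> set xs \<Longrightarrow> f x \<subseteq> funs.span (g x)"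
  shows "prod_list (map f xs) \<subseteq> funs.span (prod_list (map g xs))"
  using assms
proof (induction xs)
  case Nil
  show "prod_list (map f []) \<subseteq> funs.span (prod_list (map g []))"
    by (simp only: list.map prod_list.Nil funs.span_superset)
next
  case (Cons x xs)
  have "f x * prod_list (map f xs) \<subseteq> funs.span (g x * prod_list (map g xs))"
    by (intro funs_span_times Cons.IH Cons.prems) simp_all
  then show "prod_list (map f (x # xs)) \<subseteq> funs.span (prod_list (map g (x # xs)))"
    by (simp only: list.map prod_list.Cons)
qed

section \<open>The function space of a tree\<close>

definition shift :: "nat \<Rightarrow> ('f::field config_fun) \<Rightarrow> 'f config_fun" where
  "shift p f = f \<circ> reindex (\<lambda>t. t + p)"

lemma shift_0 [simp]: "shift 0 f = f"
proof -
  have "reindex (\<lambda>t. t) z = z" for z :: "'a config"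
    by (rule config_eqI) (simp_all add: inj_on_def)
  then show ?thesis by (simp add: shift_def fun_eq_iff)
qed

lemma shift_shift: "shift p (shift q f) = shift (p + q) f"
proof -
  have "reindex (\<lambda>t. t + q) (reindex (\<lambda>t. t + p) z) = reindex (\<lambda>t. t + (p + q)) z" for z :: "'a config"
    by (rule config_eqI) (simp_all add: inj_on_def ac_simps)
  then show ?thesis by (simp add: shift_def fun_eq_iff)
qed

lemma shift_mult: "shift p (f * g) = shift p f * shift p g"
  and shift_add: "shift p (f + g) = shift p f + shift p g"
  and shift_scale: "shift p (fun_scale c f) = fun_scale c (shift p f)"
  and shift_one: "shift p 1 = 1"
  and shift_zero: "shift p 0 = 0"
  by (auto simp: shift_def fun_eq_iff)

lemma shift_sum: "shift p (\<Sum>i\<in>A. f i) = (\<Sum>i\<in>A. shift p (f i))"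
  by (rule ext) (simp add: shift_def sum_fun_apply)

lemma shift_move: "g \<in> SL2 \<Longrightarrow> shift p (f \<circ> move g) = shift p f \<circ> move g"
  by (simp add: shift_def fun_eq_iff reindex_move inj_on_def)

lemma shift_image_power: "shift p ` (A ^ l) = (shift p ` A) ^ l"
proof (induction l)
  case 0
  show "shift p ` (A ^ 0) = (shift p ` A) ^ 0"
    by (simp only: power_0 set_one image_insert image_empty shift_one)
next
  case (Suc l)
  have "shift p ` (A * A ^ l) = shift p ` A * shift p ` (A ^ l)"
    by (auto simp: set_times_image image_iff shift_mult) blast+
  then show "shift p ` (A ^ Suc l) = (shift p ` A) ^ Suc l"
    by (simp only: power_Suc Suc.IH)
qed

lemma shift_image_span: "shift p ` funs.span A = funs.span (shift p ` A)"
proof (intro equalityI)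
  have "funs.subspace {f. shift p f \<in> funs.span (shift p ` A)}"
    by (rule funs.subspaceI) (simp_all add: shift_zero shift_add shift_scale funs.span_zero funs.span_add funs.span_scale)
  then have "funs.span A \<subseteq> {f. shift p f \<in> funs.span (shift p ` A)}"
    by (intro funs.span_minimal) (auto intro: funs.span_base)
  then show "shift p ` funs.span A \<subseteq> funs.span (shift p ` A)" by blast
next
  have "funs.subspace (shift p ` funs.span A)"
  proof (rule funs.subspaceI)
    show "0 \<in> shift p ` funs.span A" by (rule image_eqI[of _ _ 0]) (simp_all only: shift_zero funs.span_zero)
    show "f + g \<in> shift p ` funs.span A" if "f \<in> shift p ` funs.span A" "g \<in> shift p ` funs.span A" for f g
      using that by (auto simp flip: shift_add intro!: imageI funs.span_add)
    show "fun_scale c f \<in> shift p ` funs.span A" if "f \<in> shift p ` funs.span A" for c f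
      using that by (auto simp flip: shift_scale intro!: imageI funs.span_scale)
  qed
  then show "funs.span (shift p ` A) \<subseteq> shift p ` funs.span A"
    by (intro funs.span_minimal) (auto intro: funs.span_base)
qed

text \<open>The homogeneous form of the usual generating function: in the expansion,
  \<open>S\<close> is the set of points that contribute their first coordinate.\<close>

lemma coeff_linear_factors:
  "coeff (\<Prod>t = 0..<b. [:coord_y z t, coord_x z t:]) r = elem_sym b r z"
proof -
  have "(\<Prod>t = 0..<b. [:coord_y z t, coord_x z t:]) =
      (\<Prod>t = 0..<b. monom (coord_x z t) 1 + monom (coord_y z t) 0)"
    by (simp add: monom_altdef)
  also have "\<dots> = (\<Sum>S\<in>Pow {0..<b}. (\<Prod>t\<in>S. monom (coord_x z t) 1) * (\<Prod>t\<in>{0..<b} - S. monom (coord_y z t) 0))"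
    by (rule prod_add) simp
  also have "coeff \<dots> r = (\<Sum>S\<in>Pow {0..<b}. if card S = r then \<Prod>t = 0..<b. if t \<in> S then coord_x z t else coord_y z t else 0)"
    unfolding coeff_sum
  proof (intro sum.cong refl)
    fix S assume "S \<in> Pow {0..<b}"
    then have S: "S \<subseteq> {0..<b}" "finite S" by (auto intro: finite_subset)
    have mono: "(\<Prod>t\<in>A. monom (f t) e) = monom (\<Prod>t\<in>A. f t) (card A * e)"
      if "finite A" for A and f :: "nat \<Rightarrow> 'a poly fract" and e
      using that by (induction A rule: finite_induct) (auto simp: mult_monom one_pCons monom_0)
    have "(\<Prod>t = 0..<b. if t \<in> S then coord_x z t else coord_y z t) =
        (\<Prod>t\<in>S. coord_x z t) * (\<Prod>t\<in>{0..<b} - S. coord_y z t)"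
      using S by (subst prod.subset_diff[of S]) (auto simp: mult.commute intro!: arg_cong2[where f = "(*)"] prod.cong)
    then show "coeff ((\<Prod>t\<in>S. monom (coord_x z t) 1) * (\<Prod>t\<in>{0..<b} - S. monom (coord_y z t) 0)) r =
        (if card S = r then \<Prod>t = 0..<b. if t \<in> S then coord_x z t else coord_y z t else 0)"
      using S(2) by (simp add: mono mult_monom)
  qed
  also have "\<dots> = elem_sym b r z"
    unfolding elem_sym_def by (subst sum.inter_filter[symmetric]) (auto intro: sum.cong)
  finally show ?thesis .
qed

text \<open>The generating function is a product over the points, so it can be cut after the first
  \<open>b\<close> of them; the sum is the coefficient of a product of two polynomials.\<close>

lemma elem_sym_split:
  "elem_sym (b + b') r = (\<Sum>s\<le>r. elem_sym b s * shift b (elem_sym b' (r - s)))"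
proof
  fix z :: "'a config"
  let ?f = "\<lambda>t. [:coord_y z t, coord_x z t:]" and ?z = "reindex (\<lambda>t. t + b) z"
  have "elem_sym (b + b') r z = coeff ((\<Prod>t = 0..<b. ?f t) * (\<Prod>t = b..<b + b'. ?f t)) r"
    by (simp add: prod.atLeastLessThan_concat flip: coeff_linear_factors)
  also have "(\<Prod>t = b..<b + b'. ?f t) = (\<Prod>t = 0..<b'. [:coord_y ?z t, coord_x ?z t:])"
    using prod.shift_bounds_nat_ivl[of ?f 0 b b'] by (simp add: inj_on_def add.commute)
  also have "coeff ((\<Prod>t = 0..<b. ?f t) * (\<Prod>t = 0..<b'. [:coord_y ?z t, coord_x ?z t:])) r =
      (\<Sum>s\<le>r. elem_sym b s z * elem_sym b' (r - s) ?z)"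
    by (simp only: coeff_mult coeff_linear_factors)
  finally show "elem_sym (b + b') r z = (\<Sum>s\<le>r. elem_sym b s * shift b (elem_sym b' (r - s))) z"
    by (simp add: sum_fun_apply shift_def)
qed

definition interval_elem_syms :: "(nat \<Rightarrow> nat) \<Rightarrow> nat \<Rightarrow> nat \<Rightarrow> ('f::field config_fun) set" where
  "interval_elem_syms N i m = shift (N i) ` range (elem_sym (N m - N i))"

text \<open>The exponent is \<open>a - b\<close> for the symbol with \<open>a = N j - N i\<close>
  and \<open>b = N m - N i\<close>.\<close>

definition node_generators :: "(nat \<Rightarrow> nat) \<Rightarrow> nat \<times> nat \<times> nat \<Rightarrow> ('f::field config_fun) set" where
  "node_generators N = (\<lambda>(i, m, j). interval_elem_syms N i m ^ (N j - N m))"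

definition tree_span :: "(nat \<Rightarrow> nat) \<Rightarrow> (nat \<times> nat \<times> nat) multiset \<Rightarrow> ('f::field config_fun) set" where
  "tree_span N t = funs.span (\<Prod>x\<in>#t. node_generators N x)"

lemma interval_elem_syms_split:
  assumes "N i \<le> N p" "N p \<le> N m"
  shows "interval_elem_syms N i m \<subseteq> funs.span (interval_elem_syms N i p * interval_elem_syms N p m)"
proof
  fix f :: "'a config \<Rightarrow> 'a poly fract" assume "f \<in> interval_elem_syms N i m"
  then obtain r where f: "f = shift (N i) (elem_sym (N m - N i) r)"
    by (auto simp: interval_elem_syms_def)
  have eq: "N m - N i = (N p - N i) + (N m - N p)" "N i + (N p - N i) = N p" using assms by auto
  have "f = (\<Sum>s\<le>r. shift (N i) (elem_sym (N p - N i) s) * shift (N p) (elem_sym (N m - N p) (r - s)))"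
    unfolding f eq(1) elem_sym_split by (simp add: shift_sum shift_mult shift_shift assms(1))
  also have "\<dots> \<in> funs.span (interval_elem_syms N i p * interval_elem_syms N p m)"
    unfolding interval_elem_syms_def by (intro funs.span_sum funs.span_base set_times_intro imageI rangeI)
  finally show "f \<in> funs.span (interval_elem_syms N i p * interval_elem_syms N p m)" .
qed

lemma prod_mset_pair: "(\<Prod>x\<in>#{#a, b#} + Q. f x) = f a * (f b * (\<Prod>x\<in>#Q. f x))"
  by simp

text \<open>Each of the \<open>N j - N m\<close> factors of the upper node splits at
  \<open>N p\<close> into a factor on either side. Together with the \<open>N m - N p\<close>
  factors of the lower node this makes \<open>N j - N p\<close> factors on the first part and
  \<open>N j - N m\<close> on the second, exactly the exponents of the rotated nodes.\<close>

lemma tree_span_rotate: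
  assumes "N i \<le> N p" "N p \<le> N m" "N m \<le> N j"
  shows "(tree_span N ({#(i, m, j), (i, p, m)#} + Q) :: ('f::field config_fun) set) \<subseteq>
    tree_span N ({#(i, p, j), (p, m, j)#} + Q)"
proof -
  let ?E = "interval_elem_syms N :: nat \<Rightarrow> nat \<Rightarrow> 'f config_fun set"
  let ?Q = "(\<Prod>x\<in>#Q. node_generators N x) :: 'f config_fun set"
  have "?E i m ^ (N j - N m) \<subseteq> funs.span ((?E i p * ?E p m) ^ (N j - N m))"
    by (intro funs_span_power interval_elem_syms_split assms)
  then have "?E i m ^ (N j - N m) * (?E i p ^ (N m - N p) * ?Q) \<subseteq>
      funs.span ((?E i p * ?E p m) ^ (N j - N m) * (?E i p ^ (N m - N p) * ?Q))"
    by (rule funs_span_times) (rule funs.span_superset)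
  also have "(?E i p * ?E p m) ^ (N j - N m) * (?E i p ^ (N m - N p) * ?Q) =
      ?E i p ^ ((N j - N m) + (N m - N p)) * (?E p m ^ (N j - N m) * ?Q)"
    by (simp only: power_mult_distrib power_add ac_simps)
  also have "(N j - N m) + (N m - N p) = N j - N p" using assms by simp
  finally have "?E i m ^ (N j - N m) * (?E i p ^ (N m - N p) * ?Q) \<subseteq>
      funs.span (?E i p ^ (N j - N p) * (?E p m ^ (N j - N m) * ?Q))" .
  then show ?thesis
    unfolding tree_span_def prod_mset_pair
    by (intro funs.span_minimal funs.subspace_span) (simp only: node_generators_def case_prod_conv)
qed

lemma tree_span_mono:
  assumes "strict_mono_on {0..k} N" "t \<in> rotations k"
  shows "tree_span N (mset (map (\<lambda>i. (0, i, i + 1)) [1..<k])) \<subseteq> tree_span N t"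
  using assms(2)
proof induction
  case (rotate i m j p Q)
  have "N i \<le> N p" "N p \<le> N m" "N m \<le> N j"
    using rotate.hyps strict_mono_onD[OF assms(1)] by (auto intro!: less_imp_le)
  then show ?case using rotate.IH tree_span_rotate by blast
qed simp

abbreviation node_binomial :: "(nat \<Rightarrow> nat) \<Rightarrow> nat \<times> nat \<times> nat \<Rightarrow> nat" where
  "node_binomial N \<equiv> \<lambda>(i, m, j). (N j - N i) choose (N m - N i)"

lemma tree_binomials:
  assumes "strict_mono_on {0..k} N" "t \<in> rotations k"
  shows "(\<Prod>x\<in>#t. node_binomial N x) =
    (\<Prod>x\<in>#mset (map (\<lambda>i. (0, i, i + 1)) [1..<k]). node_binomial N x)"
  using assms(2)
proof induction
  case (rotate i m j p Q)
  have "N i < N p" "N p < N m" "N m < N j"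
    using rotate.hyps strict_mono_onD[OF assms(1)] by auto
  then have "((N j - N i) choose (N m - N i)) * ((N m - N i) choose (N p - N i)) =
      ((N j - N i) choose (N p - N i)) * ((N j - N p) choose (N m - N p))"
    using choose_mult[of "N p - N i" "N m - N i" "N j - N i"] by (simp add: diff_diff_eq)
  then show ?case
    using rotate.IH unfolding prod_mset_pair case_prod_conv mult.assoc[symmetric] by (simp only:)
qed simp

section \<open>Realization of the tensor products\<close>

definition node_ext :: "(nat \<Rightarrow> nat) \<Rightarrow> nat \<times> nat \<times> nat \<Rightarrow> ('f::field, 'f wedge_sum set) sl2_rep" where
  "node_ext N = (\<lambda>(i, m, j). exterior_power (N m - N i) (Sym_E (N j - N i - 1)))"

definition node_eval ::
    "(nat \<Rightarrow> nat) \<Rightarrow> nat \<times> nat \<times> nat \<Rightarrow> 'f::field wedge_sum set \<Rightarrow> 'f config_fun" where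
  "node_eval N = (\<lambda>(i, m, j) A. shift (N i) (ext_eval (N m - N i) A))"

definition node_cosets :: "(nat \<Rightarrow> nat) \<Rightarrow> nat \<times> nat \<times> nat \<Rightarrow> 'f::field wedge_sum set set" where
  "node_cosets N = (\<lambda>(i, m, j). ext_coset (N m - N i) (N j - N i - 1) ` strict_exponents (N m - N i) (N j - N i))"

definition split_node :: "(nat \<Rightarrow> nat) \<Rightarrow> nat \<times> nat \<times> nat \<Rightarrow> bool" where
  "split_node N = (\<lambda>(i, m, j). N i < N m \<and> N m < N j)"

text \<open>The cosets generate the exterior power and \<open>ext_eval\<close> is linear, so their
  values span its image, which is already known.\<close>

lemma ext_coset_span:
  assumes "1 \<le> b" "b \<le> Suc d"
  shows "funs.span (ext_eval b ` ext_coset b d ` strict_exponents b (Suc d)) =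
    (elem_sym_span b (Suc d - b) :: ('f::field config_fun) set)"
proof -
  let ?V = "exterior_power b (Sym_E d :: ('f, 'f bipoly) sl2_rep)"
  let ?C = "ext_coset b d ` strict_exponents b (Suc d) :: 'f wedge_sum set set"
  note real = exterior_power_realizes[OF assms, where 'f = 'f]
  have "ext_eval b A \<in> funs.span (ext_eval b ` ?C)" if "A \<in> rep_space ?V" for A
    using real(4) _ _ _ that
  proof (rule generates_induct)
    show "ext_eval b A \<in> funs.span (ext_eval b ` ?C)" if "A \<in> ?C" for A
      using that by (intro funs.span_base imageI)
  next
    fix u v assume "u \<in> rep_space ?V" "v \<in> rep_space ?V"
      and IH: "ext_eval b u \<in> funs.span (ext_eval b ` ?C)" "ext_eval b v \<in> funs.span (ext_eval b ` ?C)"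
    then have "ext_eval b (rep_add ?V u v) = ext_eval b u + ext_eval b v"
      using real(1) by (simp add: realizes_def)
    then show "ext_eval b (rep_add ?V u v) \<in> funs.span (ext_eval b ` ?C)"
      using funs.span_add[OF IH] by (simp only:)
  next
    fix c v assume "v \<in> rep_space ?V" and IH: "ext_eval b v \<in> funs.span (ext_eval b ` ?C)"
    then have "ext_eval b (rep_scale ?V c v) = fun_scale c (ext_eval b v)"
      using real(1) by (simp add: realizes_def)
    then show "ext_eval b (rep_scale ?V c v) \<in> funs.span (ext_eval b ` ?C)"
      using funs.span_scale[OF IH] by (simp only:)
  qed
  then have "elem_sym_span b (Suc d - b) \<subseteq> funs.span (ext_eval b ` ?C)"
    unfolding real(3)[symmetric] by blast
  moreover have "ext_eval b ` ?C \<subseteq> elem_sym_span b (Suc d - b)"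
    unfolding real(3)[symmetric] using real(4) by (intro image_mono) (simp add: generates_def)
  then have "funs.span (ext_eval b ` ?C) \<subseteq> elem_sym_span b (Suc d - b)"
    unfolding elem_sym_span_def by (intro funs.span_minimal funs.subspace_span)
  ultimately show ?thesis by blast
qed

text \<open>All that the tensor product uses about one factor. The number of generating cosets is
  bounded from above, which is the direction that the dimension count uses.\<close>

lemma node_facts:
  assumes "split_node N x"
  shows "generates (node_ext N x :: ('f::field, _) sl2_rep) (node_cosets N x)"
    and "u \<in> rep_space (node_ext N x) \<Longrightarrow> v \<in> rep_space (node_ext N x) \<Longrightarrow>
      node_eval N x (rep_add (node_ext N x) u v) = (node_eval N x u + node_eval N x v :: 'f config_fun)"
    and "v \<in> rep_space (node_ext N x) \<Longrightarrow>
      node_eval N x (rep_scale (node_ext N x) c v) = fun_scale c (node_eval N x v :: 'f config_fun)"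
    and "g \<in> SL2 \<Longrightarrow> v \<in> rep_space (node_ext N x) \<Longrightarrow> rep_act (node_ext N x) g v \<in> rep_space (node_ext N x) \<and>
      node_eval N x (rep_act (node_ext N x) g v) = (node_eval N x v :: 'f config_fun) \<circ> move g"
    and "funs.span (node_eval N x ` node_cosets N x) = funs.span (node_generators N x :: 'f config_fun set)"
    and "finite (node_cosets N x :: 'f wedge_sum set set)"
    and "node_cosets N x \<noteq> ({} :: 'f wedge_sum set set)"
    and "card (node_cosets N x :: 'f wedge_sum set set) \<le> node_binomial N x"
proof -
  obtain i m j where x: "x = (i, m, j)" by (cases x)
  define b d where "b = N m - N i" and "d = N j - N i - 1"
  have less: "N i < N m" "N m < N j" using assms by (auto simp: x split_node_def)
  then have bd: "1 \<le> b" "b \<le> Suc d" and Suc_d: "N j - N i = Suc d" and l: "Suc d - b = N j - N m"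
    by (auto simp: b_def d_def)
  have ext: "node_ext N x = exterior_power b (Sym_E d :: ('f, 'f bipoly) sl2_rep)"
    and eval: "node_eval N x = (\<lambda>A. shift (N i) (ext_eval b A) :: 'f config_fun)"
    and cosets: "node_cosets N x = (ext_coset b d ` strict_exponents b (Suc d) :: 'f wedge_sum set set)"
    unfolding node_ext_def node_eval_def node_cosets_def x case_prod_conv Suc_d b_def[symmetric] diff_Suc_1
    by (rule refl)+
  note real = exterior_power_realizes[OF bd, where 'f = 'f]
  show "generates (node_ext N x :: ('f, _) sl2_rep) (node_cosets N x)"
    unfolding ext cosets by (rule real(4))
  show "u \<in> rep_space (node_ext N x) \<Longrightarrow> v \<in> rep_space (node_ext N x) \<Longrightarrow>
      node_eval N x (rep_add (node_ext N x) u v) = (node_eval N x u + node_eval N x v :: 'f config_fun)"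
    unfolding ext eval using real(1) by (simp add: realizes_def shift_add)
  show "v \<in> rep_space (node_ext N x) \<Longrightarrow>
      node_eval N x (rep_scale (node_ext N x) c v) = fun_scale c (node_eval N x v :: 'f config_fun)"
    unfolding ext eval using real(1) by (simp add: realizes_def shift_scale)
  show "g \<in> SL2 \<Longrightarrow> v \<in> rep_space (node_ext N x) \<Longrightarrow> rep_act (node_ext N x) g v \<in> rep_space (node_ext N x) \<and>
      node_eval N x (rep_act (node_ext N x) g v) = (node_eval N x v :: 'f config_fun) \<circ> move g"
    unfolding ext eval using real(1) by (simp add: realizes_def shift_move)
  show "funs.span (node_eval N x ` node_cosets N x) = funs.span (node_generators N x :: 'f config_fun set)"
  proof -
    have "node_eval N x ` node_cosets N x =
        shift (N i) ` (ext_eval b ` ext_coset b d ` strict_exponents b (Suc d) :: 'f config_fun set)"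
      unfolding eval cosets by (simp only: image_image)
    then have "funs.span (node_eval N x ` node_cosets N x) =
        shift (N i) ` (elem_sym_span b (Suc d - b) :: 'f config_fun set)"
      by (simp only: shift_image_span[symmetric] ext_coset_span[OF bd])
    also have "\<dots> = funs.span (node_generators N x)"
      unfolding elem_sym_span_def shift_image_span shift_image_power l
      by (simp add: node_generators_def x interval_elem_syms_def b_def)
    finally show ?thesis .
  qed
  show "finite (node_cosets N x :: 'f wedge_sum set set)"
    unfolding cosets by simp
  have "card (strict_exponents b (Suc d)) \<noteq> 0" using bd by (simp add: card_strict_exponents)
  then show "node_cosets N x \<noteq> ({} :: 'f wedge_sum set set)"
    unfolding cosets by auto
  have "card (node_cosets N x :: 'f wedge_sum set set) \<le> Suc d choose b"
    unfolding cosets using card_image_le[of "strict_exponents b (Suc d)"] by (simp add: card_strict_exponents)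
  then show "card (node_cosets N x :: 'f wedge_sum set set) \<le> node_binomial N x"
    by (simp add: x b_def Suc_d)
qed

lemma finite_card_listset:
  assumes "\<And>A. A \<in> set As \<Longrightarrow> finite A"
  shows "finite (listset As) \<and> card (listset As) = prod_list (map card As)"
  using assms
proof (induction As)
  case (Cons A As)
  have "listset (A # As) = (\<lambda>(x, xs). x # xs) ` (A \<times> listset As)"
    by (auto simp: set_Cons_def)
  moreover have "inj_on (\<lambda>(x, xs). x # xs) (A \<times> listset As)" by (auto simp: inj_on_def)
  ultimately show ?case using Cons by (simp add: card_image card_cartesian_product)
qed simp

lemma listset_prod_image:
  fixes h :: "'x \<Rightarrow> 'y \<Rightarrow> 'a::comm_monoid_mult"
  shows "(\<lambda>ys. \<Prod>r<length xs. h (xs ! r) (ys ! r)) ` listset (map G xs) = prod_list (map (\<lambda>x. h x ` G x) xs)"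
proof (induction xs)
  case (Cons x xs)
  have "(\<lambda>ys. \<Prod>r<length (x # xs). h ((x # xs) ! r) (ys ! r)) ` listset (map G (x # xs)) =
      (\<lambda>(y, ys). h x y * (\<Prod>r<length xs. h (xs ! r) (ys ! r))) ` (G x \<times> listset (map G xs))"
  proof -
    have "listset (map G (x # xs)) = (\<lambda>(y, ys). y # ys) ` (G x \<times> listset (map G xs))"
      by (auto simp: set_Cons_def)
    then show ?thesis
      by (simp add: image_image case_prod_unfold prod.lessThan_Suc_shift del: prod.lessThan_Suc listset.simps)
  qed
  also have "\<dots> = h x ` G x * (\<lambda>ys. \<Prod>r<length xs. h (xs ! r) (ys ! r)) ` listset (map G xs)"
    by (auto simp: set_times_image image_iff)
  finally show ?case
    unfolding Cons.IH by (simp only: list.map prod_list.Cons)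
qed simp

lemma tree_span_list: "tree_span N (mset xs) = funs.span (prod_list (map (node_generators N) xs))"
  unfolding tree_span_def by (simp only: mset_map[symmetric] prod_mset_prod_list)

definition tensor_eval ::
    "(nat \<Rightarrow> nat) \<Rightarrow> (nat \<times> nat \<times> nat) list \<Rightarrow> 'f::field wedge_sum set list \<Rightarrow> 'f config_fun" where
  "tensor_eval N xs As = (\<Prod>r<length xs. node_eval N (xs ! r) (As ! r))"

lemma tensor_eval_update:
  assumes "i < length xs" "length As = length xs"
  shows "tensor_eval N xs (As[i := A]) =
    node_eval N (xs ! i) A * (\<Prod>r\<in>{..<length xs} - {i}. node_eval N (xs ! r) (As ! r))"
  unfolding tensor_eval_def using assms
  by (subst prod.remove[of _ i]) (auto intro!: arg_cong2[where f = "(*)"] prod.cong)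

text \<open>Independence of the generating tensors is not attacked directly. Their values span a
  space that contains the independent set \<open>E\<close>, and they are at most as many as
  \<open>E\<close>; so \<open>spanning_family_independent\<close> supplies the independence and
  \<open>quotient_realizes\<close> the rest.\<close>

lemma tensor_product_realizes:
  fixes E :: "('f::field config_fun) set"
  assumes nodes: "\<And>x. x \<in> set xs \<Longrightarrow> split_node N x"
    and E: "\<not> funs.dependent E" "E \<subseteq> tree_span N (mset xs)"
      "prod_list (map (node_binomial N) xs) \<le> card E"
  shows "\<exists>\<Psi>. realizes (tensor_product (map (node_ext N) xs)) \<Psi> \<and>
    \<Psi> ` rep_space (tensor_product (map (node_ext N) xs)) = funs.span E"
proof -
  let ?Vs = "map (node_ext N) xs :: ('f, _) sl2_rep list" and ?R = "multilinear_relations (map (node_ext N) xs :: ('f, _) sl2_rep list)"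
  let ?B = "listset (map (node_cosets N) xs) :: 'f wedge_sum set list set"
  have node: "split_node N (xs ! r)" if "r < length xs" for r using nodes that by simp
  \<comment> \<open>The span of a product of sets depends only on the spans of the factors, so the
    values of the cosets may be replaced by the node generators.\<close>
  have image: "funs.span (tensor_eval N xs ` ?B) = tree_span N (mset xs)"
  proof -
    have B: "tensor_eval N xs ` ?B = prod_list (map (\<lambda>x. node_eval N x ` node_cosets N x) xs)"
      unfolding tensor_eval_def by (rule listset_prod_image)
    have "prod_list (map (\<lambda>x. node_eval N x ` node_cosets N x) xs) \<subseteq>
        funs.span (prod_list (map (node_generators N) xs) :: 'f config_fun set)"
      by (rule funs_span_prod_list) (use node_facts(5)[OF nodes, where 'f = 'f] funs.span_superset in blast)
    moreover have "(prod_list (map (node_generators N) xs) :: 'f config_fun set) \<subseteq>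
        funs.span (prod_list (map (\<lambda>x. node_eval N x ` node_cosets N x) xs))"
      by (rule funs_span_prod_list) (use node_facts(5)[OF nodes, where 'f = 'f] funs.span_superset in blast)
    ultimately show ?thesis
      unfolding B tree_span_list by (intro equalityI funs.span_minimal funs.subspace_span)
  qed
  have B: "finite ?B" "card ?B \<le> card E"
  proof -
    have fin: "finite ?B \<and> card ?B = prod_list (map card (map (node_cosets N) xs :: 'f wedge_sum set set list))"
      by (rule finite_card_listset) (use node_facts(6)[OF nodes] in auto)
    then show "finite ?B" by simp
    have "prod_list (map (\<lambda>x. card (node_cosets N x :: 'f wedge_sum set set)) xs) \<le>
        prod_list (map (node_binomial N) xs)"
      using nodes
    proof (induction xs)
      case (Cons x xs)
      then show ?case using node_facts(8)[of N x, where 'f = 'f] by (auto intro!: mult_le_mono)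
    qed simp
    then show "card ?B \<le> card E"
      using fin E(3) by (simp add: o_def)
  qed
  note span = spanning_family_independent[OF B(1) E(1) E(2)[folded image] B(2)]
  have ind: "c b = 0" if "(\<Sum>b\<in>?B. fun_scale (c b) (tensor_eval N xs b)) = 0" "b \<in> ?B" for c b
    using that by (rule span(2))
  have B_ne: "?B \<noteq> {}"
  proof -
    have "map (\<lambda>x. SOME A. A \<in> node_cosets N x) xs \<in> ?B"
      using node_facts(7)[OF node, where 'f = 'f] by (auto simp: in_listset_iff some_in_eq)
    then show ?thesis by blast
  qed
  have gens: "generates (?Vs ! r) (map (node_cosets N) xs ! r)" if "r < length ?Vs" for r
    using node_facts(1)[OF node, where 'f = 'f] that by simp
  have B_tuples: "?B \<subseteq> tuples ?Vs"
    using gens by (auto simp: in_listset_iff in_tuples_iff generates_def subset_iff)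
  have R_keys: "keys r \<subseteq> tuples ?Vs" if "r \<in> ?R" for r
    by (rule multilinear_relations_keys[OF _ _ that])
      (use node_facts(1)[OF nodes, where 'f = 'f] in \<open>auto simp: generates_def\<close>)
  have R_eval: "formal_eval (tensor_eval N xs) r = 0" if "r \<in> ?R" for r
  proof (rule multilinear_relations_eval[OF _ _ that])
    fix As i u v
    assume "As \<in> tuples ?Vs" "i < length ?Vs" "u \<in> rep_space (?Vs ! i)" "v \<in> rep_space (?Vs ! i)"
    then show "tensor_eval N xs (As[i := rep_add (?Vs ! i) u v]) = tensor_eval N xs (As[i := u]) + tensor_eval N xs (As[i := v])"
      using node_facts(2)[OF node, where 'f = 'f] by (simp add: tensor_eval_update in_tuples_iff distrib_right)
  next
    fix As i c v
    assume "As \<in> tuples ?Vs" "i < length ?Vs" "v \<in> rep_space (?Vs ! i)"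
    then show "tensor_eval N xs (As[i := rep_scale (?Vs ! i) c v]) = fun_scale c (tensor_eval N xs (As[i := v]))"
      using node_facts(3)[OF node, where 'f = 'f] by (simp add: tensor_eval_update in_tuples_iff fun_scale_mult(1))
  qed
  have spans: "single As 1 \<in> formal.span (?R \<union> (\<lambda>b. single b (1 :: 'f)) ` ?B)"
    if "As \<in> tuples ?Vs" for As
    by (rule multilinear_span[OF _ gens that]) simp_all
  have act: "map2 (\<lambda>V v. rep_act V g v) ?Vs As \<in> tuples ?Vs \<and>
      tensor_eval N xs (map2 (\<lambda>V v. rep_act V g v) ?Vs As) = tensor_eval N xs As \<circ> move g"
    if "g \<in> SL2" "As \<in> tuples ?Vs" for g As
  proof
    have len: "length As = length xs" using that(2) by (simp add: in_tuples_iff)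
    have space: "As ! r \<in> rep_space (node_ext N (xs ! r))" if "r < length xs" for r
      using \<open>As \<in> tuples ?Vs\<close> that by (simp add: in_tuples_iff)
    show "map2 (\<lambda>V v. rep_act V g v) ?Vs As \<in> tuples ?Vs"
      using node_facts(4)[OF node that(1) space] by (simp add: in_tuples_iff len)
    have "tensor_eval N xs (map2 (\<lambda>V v. rep_act V g v) ?Vs As) =
        (\<Prod>r<length xs. node_eval N (xs ! r) (As ! r) \<circ> move g)"
      unfolding tensor_eval_def using node_facts(4)[OF node that(1) space] len
      by (intro prod.cong refl) simp
    also have "\<dots> = tensor_eval N xs As \<circ> move g"
      by (simp add: tensor_eval_def fun_eq_iff prod_fun_apply)
    finally show "tensor_eval N xs (map2 (\<lambda>V v. rep_act V g v) ?Vs As) = tensor_eval N xs As \<circ> move g" .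
  qed
  note hyps = R_keys R_eval B(1) B_tuples B_ne spans ind act
  define \<Psi> where "\<Psi> = (\<lambda>A. formal_eval (tensor_eval N xs) (SOME p. p \<in> A) :: 'f config_fun)"
  have "realizes (tensor_product ?Vs) \<Psi>"
    unfolding \<Psi>_def tensor_product_def by (rule quotient_realizes(1)[where B = ?B]; fact hyps)
  moreover have "\<Psi> ` rep_space (tensor_product ?Vs) = funs.span (tensor_eval N xs ` ?B)"
    unfolding \<Psi>_def tensor_product_def by (rule quotient_realizes(3)[where B = ?B]; fact hyps)
  ultimately show ?thesis
    unfolding span(1) by blast
qed

text \<open>All nodes of the comb start at 0, so no shift occurs, and the factor of node
  \<open>i\<close> involves the first \<open>N i\<close> points with exponents below
  \<open>N (i + 1)\<close>. Later factors involve at least \<open>N (i + 1)\<close> points, which is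
  the order that \<open>alternant_chain_independent\<close> requires.\<close>

lemma comb_independent_family:
  assumes N0: "N 0 = 0" and mono: "strict_mono_on {0..k} N"
  defines "comb \<equiv> map (\<lambda>i. (0, i, i + 1)) [1..<k]"
  obtains E :: "('f::field config_fun) set"
  where "\<not> funs.dependent E" "E \<subseteq> tree_span N (mset comb)"
    "card E = prod_list (map (node_binomial N) comb)"
proof -
  define L where "L = map (\<lambda>i. (N (i + 1), N i)) [1..<k]"
  define h :: "nat \<times> nat \<Rightarrow> nat list \<Rightarrow> 'f config_fun" where
    "h = (\<lambda>(a, b) \<gamma> z. alternant b (a - 1) ((!) \<gamma>) z / vandermonde b z)"
  define G where "G = (\<lambda>(a, b). strict_exponents b a)"
  define J where "J = listset (map G L)"
  define f where "f \<Gamma> = (\<Prod>r<length L. h (L ! r) (\<Gamma> ! r))" for \<Gamma>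
  have J: "finite J" "card J = prod_list (map (\<lambda>(a, b). a choose b) L)"
  proof -
    have "finite J \<and> card J = prod_list (map card (map G L))"
      unfolding J_def by (rule finite_card_listset) (auto simp: G_def)
    then show "finite J" "card J = prod_list (map (\<lambda>(a, b). a choose b) L)"
      by (simp_all add: G_def o_def case_prod_unfold card_strict_exponents)
  qed
  have "\<forall>\<Gamma>\<in>J. c \<Gamma> = 0" if zero: "(\<Sum>\<Gamma>\<in>J. fun_scale (c \<Gamma>) (f \<Gamma>)) = 0" for c
  proof
    fix \<Gamma> assume \<Gamma>: "\<Gamma> \<in> J"
    have "const_fract (c \<Gamma>) = 0"
    proof (rule alternant_chain_independent[where c = "\<lambda>\<Gamma>. const_fract (c \<Gamma>)"])
      show "\<Gamma> \<in> listset (map (\<lambda>(a, b). strict_exponents b a) L)"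
        using \<Gamma> by (simp add: J_def G_def)
      show "sorted_wrt (\<lambda>(a, b) (a', b'). a \<le> b') L"
      proof -
        have "N (Suc (Suc i)) \<le> N (Suc j)" if "i < j" "j < k - 1" for i j
          using strict_mono_on_leD[OF mono, of "Suc (Suc i)" "Suc j"] that by simp
        then show ?thesis by (auto simp: L_def sorted_wrt_iff_nth_less)
      qed
      fix z :: "'f config"
      \<comment> \<open>The Vandermonde denominators do not depend on \<open>\<Gamma>\<close>, so
        they form one common factor.\<close>
      let ?v = "\<Prod>r<length L. vandermonde (snd (L ! r)) z"
      have "(\<Sum>\<Gamma>\<in>J. const_fract (c \<Gamma>) *
          (\<Prod>r<length L. alternant (snd (L ! r)) (fst (L ! r) - 1) ((!) (\<Gamma> ! r)) z)) / ?v =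
          (\<Sum>\<Gamma>\<in>J. fun_scale (c \<Gamma>) (f \<Gamma>)) z"
        by (simp add: sum_fun_apply f_def prod_fun_apply h_def case_prod_unfold prod_dividef sum_divide_distrib)
      also have "\<dots> = 0" by (simp only: zero zero_fun_apply)
      finally show "(\<Sum>\<Gamma>\<in>listset (map (\<lambda>(a, b). strict_exponents b a) L). const_fract (c \<Gamma>) *
          (\<Prod>r<length L. alternant (snd (L ! r)) (fst (L ! r) - 1) ((!) (\<Gamma> ! r)) z)) = 0"
        by (simp add: J_def G_def)
    qed
    then show "c \<Gamma> = 0" by simp
  qed
  note ind = family_independent_image[OF J(1) this]
  have image: "f ` J = prod_list (map (\<lambda>x. h x ` G x) L)"
    unfolding f_def J_def by (rule listset_prod_image)
  have gen: "h (N (i + 1), N i) ` G (N (i + 1), N i) \<subseteq> funs.span (node_generators N (0, i, i + 1))"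
    if "i \<in> set [1..<k]" for i
  proof -
    have less: "0 < N i" "N i < N (i + 1)"
      using strict_mono_onD[OF mono, of 0 i] strict_mono_onD[OF mono, of i "i + 1"] that N0 by auto
    let ?d = "N (i + 1) - 1"
    have bd: "1 \<le> N i" "N i \<le> Suc ?d" and Suc_d: "Suc ?d = N (i + 1)" using less by auto
    have "h (N (i + 1), N i) \<gamma> \<in> elem_sym_span (N i) (Suc ?d - N i)" if \<gamma>: "\<gamma> \<in> strict_exponents (N i) (Suc ?d)" for \<gamma>
    proof -
      have "h (N (i + 1), N i) \<gamma> = ext_eval (N i) (ext_coset (N i) ?d \<gamma>)"
        using exterior_power_realizes(2)[OF bd \<gamma>, where 'f = 'f] by (simp add: fun_eq_iff h_def)
      also have "\<dots> \<in> funs.span (ext_eval (N i) ` ext_coset (N i) ?d ` strict_exponents (N i) (Suc ?d))"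
        using \<gamma> by (intro funs.span_base imageI)
      also have "\<dots> = elem_sym_span (N i) (Suc ?d - N i)" by (rule ext_coset_span[OF bd])
      finally show ?thesis .
    qed
    moreover have "(elem_sym_span (N i) (Suc ?d - N i) :: 'f config_fun set) = funs.span (node_generators N (0, i, i + 1))"
      unfolding Suc_d by (simp add: elem_sym_span_def node_generators_def interval_elem_syms_def N0)
    ultimately show ?thesis unfolding Suc_d by (auto simp: G_def)
  qed
  have "f ` J \<subseteq> tree_span N (mset comb)"
  proof -
    have "prod_list (map (\<lambda>i. h (N (i + 1), N i) ` G (N (i + 1), N i)) [1..<k]) \<subseteq>
        funs.span (prod_list (map (\<lambda>i. node_generators N (0, i, i + 1)) [1..<k]))"
      by (rule funs_span_prod_list) (rule gen)
    then show ?thesis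
      unfolding image tree_span_list by (simp add: L_def comb_def o_def)
  qed
  moreover have "card (f ` J) = prod_list (map (node_binomial N) comb)"
    by (simp add: card_image[OF ind(1)] J(2) L_def comb_def o_def N0)
  ultimately show thesis using ind(2) that by blast
qed

text \<open>Carries the order of the given factors over to the nodes, so that the tensor products
  agree factor by factor.\<close>

lemma mset_eq_image_mset_list:
  assumes "mset ys = image_mset f M"
  obtains xs where "mset xs = M" "map f xs = ys"
proof -
  have "\<exists>xs. mset xs = M \<and> map f xs = ys"
    using assms
  proof (induction ys arbitrary: M)
    case (Cons y ys)
    then obtain M' x where "M = add_mset x M'" "f x = y" "image_mset f M' = mset ys"
      by (metis msed_map_invR mset.simps(2))
    moreover from this Cons.IH[of M'] obtain xs where "mset xs = M'" "map f xs = ys" by auto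
    ultimately show ?case by (intro exI[of _ "x # xs"]) simp
  qed simp
  then show thesis using that by blast
qed

theorem corollary8p3:
  fixes k :: nat and N :: "nat \<Rightarrow> nat"
  assumes "k \<ge> 1"
    and "N 0 = 0"
    and "strict_mono_on {0..k} N"
    and "generic_position k N"
  shows "card (election_processes k N) = catalan (k - 1) \<and>
    (\<forall>P \<in> election_processes k N. \<forall>factors. mset factors = P \<longrightarrow>
      rep_isomorphic
        (tensor_product
          (map (\<lambda>(a, b). exterior_power b (Sym_E (a - 1) :: ('f::field, 'f bipoly) sl2_rep)) factors))
        (tensor_product
          (map (\<lambda>i. exterior_power (N i) (Sym_E (N (i + 1) - 1))) [1..<k])))"
proof (intro conjI ballI allI impI)
  show "card (election_processes k N) = catalan (k - 1)"
    by (rule card_election_processes[OF assms])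
next
  fix P and factors :: "(nat \<times> nat) list"
  assume P: "P \<in> election_processes k N" and factors: "mset factors = P"
  define comb where "comb = map (\<lambda>i. (0 :: nat, i, i + 1)) [1..<k]"
  obtain t where t: "t \<in> rotations k" "mset factors = image_mset (node_symbol N) t"
    using P factors by (auto simp: election_processes_eq[OF assms])
  obtain xs where xs: "mset xs = t" "map (node_symbol N) xs = factors"
    using t(2) by (rule mset_eq_image_mset_list)
  obtain E :: "('f config \<Rightarrow> 'f poly fract) set"
    where E: "\<not> funs.dependent E" "E \<subseteq> tree_span N (mset comb)"
      "card E = prod_list (map (node_binomial N) comb)"
    using comb_independent_family[where N = N, OF assms(2,3)] unfolding comb_def by blast
  have comb: "mset comb \<in> rotations k"
    unfolding comb_def by (rule rotations.initial)
  \<comment> \<open>The set \<open>E\<close> comes from the comb, yet it serves every tree, since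
    the spans grow under rotations and the products of binomial coefficients agree.\<close>
  have realize: "\<exists>\<Psi>. realizes (tensor_product (map (node_ext N) ys)) \<Psi> \<and>
      \<Psi> ` rep_space (tensor_product (map (node_ext N) ys)) = funs.span E"
    if ys: "mset ys \<in> rotations k" for ys
  proof (rule tensor_product_realizes[OF _ E(1)])
    show "split_node N x" if "x \<in> set ys" for x
      using rotations_range[OF assms(1) ys, of "fst x" "fst (snd x)" "snd (snd x)"] that
        strict_mono_onD[OF assms(3)] by (auto simp: split_node_def)
    show "E \<subseteq> tree_span N (mset ys)"
      using E(2) tree_span_mono[OF assms(3) ys] unfolding comb_def by blast
    show "prod_list (map (node_binomial N) ys) \<le> card E"
      using tree_binomials[OF assms(3) ys] E(3) unfolding comb_def
      by (simp only: mset_map[symmetric] prod_mset_prod_list order_refl)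
  qed
  obtain \<Psi> where \<Psi>: "realizes (tensor_product (map (node_ext N) xs)) \<Psi>"
    "\<Psi> ` rep_space (tensor_product (map (node_ext N) xs)) = funs.span E"
    using realize[of xs] t(1) xs(1) by blast
  obtain \<Phi> where \<Phi>: "realizes (tensor_product (map (node_ext N) comb)) \<Phi>"
    "\<Phi> ` rep_space (tensor_product (map (node_ext N) comb)) = funs.span E"
    using realize[OF comb] by blast
  have "rep_isomorphic (tensor_product (map (node_ext N) xs)) (tensor_product (map (node_ext N) comb) :: ('f, _) sl2_rep)"
    by (rule realizes_isomorphic[OF \<Psi>(1) \<Phi>(1)]) (simp only: \<Psi>(2) \<Phi>(2))
  moreover have "map (node_ext N) xs = map (\<lambda>(a, b). exterior_power b (Sym_E (a - 1) :: ('f, 'f bipoly) sl2_rep)) factors"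
    unfolding xs(2)[symmetric] by (auto simp: node_ext_def node_symbol_def)
  moreover have "map (node_ext N) comb = map (\<lambda>i. exterior_power (N i) (Sym_E (N (i + 1) - 1) :: ('f, 'f bipoly) sl2_rep)) [1..<k]"
    by (simp add: comb_def node_ext_def assms(2))
  ultimately show "rep_isomorphic
      (tensor_product (map (\<lambda>(a, b). exterior_power b (Sym_E (a - 1) :: ('f, 'f bipoly) sl2_rep)) factors))
      (tensor_product (map (\<lambda>i. exterior_power (N i) (Sym_E (N (i + 1) - 1))) [1..<k]))"
    by (simp only:)
qed

end
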